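(* Suppose that $\Omega$ is a bounded domain in $\mathbb O^2$ with smooth boundary such that $\mathbb O^2\setminus\overline\Omega$ is connected, and let $\rho$ be a smooth defining function of $\Omega$. If $f=(u_0,u_1)$ is a smooth tangentially octonionic pluriharmonic function on $\partial\Omega$, then there exists an octonionic pluriharmonic function $\tilde f$ in $\Omega$, smooth up to the boundary, such that $\tilde f=u_0+\rho u_1\pmod{\rho^2}$ at $\partial\Omega$.
   Context: Octonions: $\mathbb O$ is the real octonion algebra with basis $e_0=1,e_1,\dots,e_7$, $e_a^2=-1$ and $e_ae_b=-e_be_a$ for $a\ne b$ in $\{1,\dots,7\}$; writing $\mathbb O=\mathbb H\oplus\mathbb H e_4$, the product is $(a,b)(c,d)=(ac-\bar d b,\,da+b\bar c)$. Conjugation: $\bar e_0=e_0$, $\bar e_a=-e_a$ for $a\ge1$; $\operatorname{Re}(\sum_ax^ae_a)=x^0$. $\mathcal H_2(\mathbb O)=\{\begin{pmatrix}a&q\\ \bar q&b\end{pmatrix}: a,b\in\mathbb R,\ q\in\mathbb O\}$, with entries $u=(u_{\bar ij})_{i,j=1,2}$. Inner products: $\langle v,w\rangle=\sum_{i=1}^2\operatorname{Re}(v_i\bar w_i)$ on $\mathbb O^2$, and $\langle H,H'\rangle=H_{\bar11}H'_{\bar11}+H_{\bar22}H'_{\bar22}+2\operatorname{Re}(H_{\bar12}H'_{\bar21})$ on $\mathcal H_2(\mathbb O)$. Points of $\mathbb O^2\cong\mathbb R^{16}$ are $(x_1,x_2)$, $x_j=\sum_{a=0}^7x_j^ae_a$.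 For an $\mathbb O$-valued function $F$, $$\partial_{\bar j}F=\sum_a e_a\frac{\partial F}{\partial x_j^a},\quad \partial_jF=\sum_a\bar e_a\frac{\partial F}{\partial x_j^a},\quad F\overleftarrow{\partial_{\bar j}}=\sum_a\frac{\partial F}{\partial x_j^a}e_a,\quad F\overleftarrow{\partial_j}=\sum_a\frac{\partial F}{\partial x_j^a}\bar e_a,$$ $\Delta_j=\sum_{a=0}^7\partial^2/\partial (x_j^a)^2$, and $$\mathcal D_0f=\begin{pmatrix}\Delta_1f&\partial_{\bar1}\partial_2f\\ \partial_{\bar2}\partial_1f&\Delta_2f\end{pmatrix}\ (f\text{ real-valued}),\qquad \mathcal D_1u=\begin{pmatrix}u_{\bar12}\overleftarrow{\partial_{\bar2}}-\partial_{\bar1}u_{\bar22}\\ u_{\bar21}\overleftarrow{\partial_{\bar1}}-\partial_{\bar2}u_{\bar11}\end{pmatrix}\ (u\ \mathcal H_2(\mathbb O)\text{-valued}).$$ The formal adjoint of $\mathcal D_1$ is $\mathcal D_1^*v=\begin{pmatrix}\operatorname{Re}(\partial_2v_2)&-\frac12(\partial_{\bar1}\bar v_2+v_1\overleftarrow{\partial_2})\\ -\frac12(v_2\overleftarrow{\partial_1}+\partial_{\bar2}\bar v_1)&\operatorname{Re}(\partial_1v_1)\end{pmatrix}$ for $\mathbb O^2$-valued $v$. A real-valued function $f$ is octonionic pluriharmonic (OPH) on $\Omega$ if $\mathcal D_0f=0$ on $\Omega$. A defining function $\rho$ of $\Omega$ is a smooth real function near $\overline\Omega$ with $\Omega=\{\rho<0\}$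 and $\operatorname{grad}\rho\ne0$ on $\partial\Omega=\{\rho=0\}$. Tangentially OPH functions: for an open set $U$ meeting $\partial\Omega$, $\mathcal J_1(U)$ is the set of $u\in C^\infty(U,\mathcal H_2(\mathbb O))$ with zero Cauchy data on $\partial\Omega$ for $\mathcal D_1$, i.e. $\int_\Omega\langle\mathcal D_1u,v\rangle dV=\int_\Omega\langle u,\mathcal D_1^*v\rangle dV$ for all $v\in C^\infty_c(U,\mathbb O^2)$. A pair $(u_0,u_1)$ of smooth real functions on $\partial\Omega$ represents the class of $u_0+\rho u_1$ modulo functions that are $O(\rho^2)$, where $u_0,u_1$ also denote fixed smooth extensions to a neighbourhood $U$ of $\partial\Omega$ (where $\rho$ has the local form $\rho=x_1^0-\phi(x_1^1,\dots,x_1^7,x_2^0,\dots,x_2^7)$, the extensions independent of $x_1^0$). The tangential octonionic Hessian operator $\mathscr D_0$ is the operator induced by $\mathcal D_0$ from real functions modulo $O(\rho^2)$ to $\Gamma(U,\mathcal H_2(\mathbb O))/\mathcal J_1(U)$; thus $(u_0,u_1)$ is tangentially OPH, $\mathscr D_0(u_0,u_1)=0$, iff $\mathcal D_0(u_0+\rho u_1)\in\mathcal J_1(U)$. *)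

theory Defs
  imports "HOL-Analysis.Analysis"
begin

section \<open>Octonions\<close>

text \<open>A quaternion is a scalar part together with a vector part; the product is Hamilton's,
  with \<open>e\<^sub>1 e\<^sub>2 = e\<^sub>3\<close>.\<close>

type_synonym quat = "real \<times> (real^3)"

definition qmult :: "quat \<Rightarrow> quat \<Rightarrow> quat" where
  "qmult p q = (fst p * fst q - snd p \<bullet> snd q,
     fst p *\<^sub>R snd q + fst q *\<^sub>R snd p + cross3 (snd p) (snd q))"

definition qconj :: "quat \<Rightarrow> quat" where
  "qconj p = (fst p, - snd p)"

text \<open>The pair \<open>(a, b)\<close> stands for \<open>a + b e\<^sub>4\<close>.  The eight elements of
  \<open>Basis :: oct set\<close> are exactly the units \<open>e\<^sub>0, \<dots>, e\<^sub>7\<close>, so that a sum over \<open>a = 0, \<dots>, 7\<close>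
  is written below as a sum over \<open>e \<in> Basis\<close>.\<close>

type_synonym oct = "quat \<times> quat"

definition omult :: "oct \<Rightarrow> oct \<Rightarrow> oct" (infixl \<open>\<odot>\<close> 70) where
  "x \<odot> y = (case (x, y) of ((a, b), (c, d)) \<Rightarrow>
     (qmult a c - qmult (qconj d) b, qmult d a + qmult b (qconj c)))"

definition oconj :: "oct \<Rightarrow> oct" where
  "oconj x = (qconj (fst x), - snd x)"

definition ore :: "oct \<Rightarrow> real" where
  "ore x = fst (fst x)"

definition oct_of_real :: "real \<Rightarrow> oct" where
  "oct_of_real r = ((r, 0), 0)"

lemma oct_unit_square:
  assumes "e \<in> (Basis :: oct set)" and "e \<noteq> oct_of_real 1"
  shows "e \<odot> e = - oct_of_real 1"
  using assms
  by (auto simp: Basis_prod_def omult_def qmult_def qconj_def oct_of_real_def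
      Basis_vec_def inner_axis_axis zero_prod_def)

definition mat2 :: "oct \<Rightarrow> oct \<Rightarrow> oct \<Rightarrow> oct \<Rightarrow> oct^2^2" where
  "mat2 a b c d = vector [vector [a, b], vector [c, d]]"

definition H2O :: "(oct^2^2) set" where
  "H2O = {mat2 (oct_of_real a) q (oconj q) (oct_of_real b) | a q b. True}"

definition inner_O2 :: "oct^2 \<Rightarrow> oct^2 \<Rightarrow> real" where
  "inner_O2 v w = (\<Sum>i\<in>UNIV. ore (v $ i \<odot> oconj (w $ i)))"

text \<open>Only used on \<^term>\<open>H2O\<close>, whose diagonal entries are real.\<close>

definition inner_H2 :: "oct^2^2 \<Rightarrow> oct^2^2 \<Rightarrow> real" where
  "inner_H2 H K = ore (H $ 1 $ 1) * ore (K $ 1 $ 1) + ore (H $ 2 $ 2) * ore (K $ 2 $ 2)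
     + 2 * ore (H $ 1 $ 2 \<odot> K $ 2 $ 1)"

section \<open>Smooth functions\<close>

definition dderiv :: "'a::euclidean_space \<Rightarrow> ('a \<Rightarrow> 'b::real_normed_vector) \<Rightarrow> 'a \<Rightarrow> 'b" where
  "dderiv v F x = vector_derivative (\<lambda>t. F (x + t *\<^sub>R v)) (at 0)"

primrec iter_dderiv ::
  "'a::euclidean_space list \<Rightarrow> ('a \<Rightarrow> 'b::real_normed_vector) \<Rightarrow> 'a \<Rightarrow> 'b" where
  "iter_dderiv [] F = F"
| "iter_dderiv (v # vs) F = dderiv v (iter_dderiv vs F)"

text \<open>On an open set, \<open>F\<close> is \<open>C\<^sup>\<infinity>\<close> iff every iterated partial derivative exists and is
  (Frechet) differentiable, hence continuous.\<close>

definition C_infinity :: "'a::euclidean_space set \<Rightarrow> ('a \<Rightarrow> 'b::real_normed_vector) \<Rightarrow> bool" where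
  "C_infinity W F \<longleftrightarrow> open W \<and>
     (\<forall>vs. set vs \<subseteq> Basis \<longrightarrow> (\<forall>x\<in>W. iter_dderiv vs F differentiable (at x)))"

text \<open>Smoothness on an arbitrary set means smooth extendability to an open neighbourhood.
  For open \<open>X\<close> this is \<^term>\<open>C_infinity X F\<close>; for the closure of a domain it is smoothness
  up to the boundary.\<close>

definition smooth_on :: "'a::euclidean_space set \<Rightarrow> ('a \<Rightarrow> 'b::real_normed_vector) \<Rightarrow> bool" where
  "smooth_on X f \<longleftrightarrow> (\<exists>W F. X \<subseteq> W \<and> C_infinity W F \<and> (\<forall>x\<in>X. f x = F x))"

definition test_functions :: "'a::euclidean_space set \<Rightarrow> ('a \<Rightarrow> 'b::real_normed_vector) set" where
  "test_functions U = {v. smooth_on UNIV v \<and>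
     compact (closure {x. v x \<noteq> 0}) \<and> closure {x. v x \<noteq> 0} \<subseteq> U}"

section \<open>The differential operators\<close>

definition partial :: "2 \<Rightarrow> oct \<Rightarrow> (oct^2 \<Rightarrow> 'b::real_normed_vector) \<Rightarrow> oct^2 \<Rightarrow> 'b" where
  "partial j e F = dderiv (axis j e) F"

text \<open>In the four operators below, \<open>bar\<close> refers to the index \<open>\<bar>j\<close>; it is the unbarred
  index that carries the conjugated units.  The suffix \<open>_r\<close> marks the operators that
  multiply by the units from the right.\<close>

definition dbar :: "2 \<Rightarrow> (oct^2 \<Rightarrow> oct) \<Rightarrow> oct^2 \<Rightarrow> oct" where
  "dbar j F x = (\<Sum>e\<in>Basis. e \<odot> partial j e F x)"

definition dd :: "2 \<Rightarrow> (oct^2 \<Rightarrow> oct) \<Rightarrow> oct^2 \<Rightarrow> oct" where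
  "dd j F x = (\<Sum>e\<in>Basis. oconj e \<odot> partial j e F x)"

definition dbar_r :: "2 \<Rightarrow> (oct^2 \<Rightarrow> oct) \<Rightarrow> oct^2 \<Rightarrow> oct" where
  "dbar_r j F x = (\<Sum>e\<in>Basis. partial j e F x \<odot> e)"

definition dd_r :: "2 \<Rightarrow> (oct^2 \<Rightarrow> oct) \<Rightarrow> oct^2 \<Rightarrow> oct" where
  "dd_r j F x = (\<Sum>e\<in>Basis. partial j e F x \<odot> oconj e)"

definition laplace :: "2 \<Rightarrow> (oct^2 \<Rightarrow> real) \<Rightarrow> oct^2 \<Rightarrow> real" where
  "laplace j f x = (\<Sum>e\<in>Basis. partial j e (partial j e f) x)"

definition D0 :: "(oct^2 \<Rightarrow> real) \<Rightarrow> oct^2 \<Rightarrow> oct^2^2" where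
  "D0 f x = mat2
     (oct_of_real (laplace 1 f x)) (dbar 1 (dd 2 (\<lambda>y. oct_of_real (f y))) x)
     (dbar 2 (dd 1 (\<lambda>y. oct_of_real (f y))) x) (oct_of_real (laplace 2 f x))"

definition D1 :: "(oct^2 \<Rightarrow> oct^2^2) \<Rightarrow> oct^2 \<Rightarrow> oct^2" where
  "D1 u x = vector
     [dbar_r 2 (\<lambda>y. u y $ 1 $ 2) x - dbar 1 (\<lambda>y. u y $ 2 $ 2) x,
      dbar_r 1 (\<lambda>y. u y $ 2 $ 1) x - dbar 2 (\<lambda>y. u y $ 1 $ 1) x]"

definition D1_adj :: "(oct^2 \<Rightarrow> oct^2) \<Rightarrow> oct^2 \<Rightarrow> oct^2^2" where
  "D1_adj v x = mat2
     (oct_of_real (ore (dd 2 (\<lambda>y. v y $ 2) x)))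
     ((- 1 / 2) *\<^sub>R (dbar 1 (\<lambda>y. oconj (v y $ 2)) x + dd_r 2 (\<lambda>y. v y $ 1) x))
     ((- 1 / 2) *\<^sub>R (dd_r 1 (\<lambda>y. v y $ 2) x + dbar 2 (\<lambda>y. oconj (v y $ 1)) x))
     (oct_of_real (ore (dd 1 (\<lambda>y. v y $ 1) x)))"

text \<open>Smoothness is required explicitly because \<^term>\<open>D0 f\<close> has an unspecified value
  where \<open>f\<close> is not differentiable.\<close>

definition oct_pluriharmonic :: "(oct^2) set \<Rightarrow> (oct^2 \<Rightarrow> real) \<Rightarrow> bool" where
  "oct_pluriharmonic \<Omega> f \<longleftrightarrow> smooth_on \<Omega> f \<and> (\<forall>x\<in>\<Omega>. D0 f x = 0)"

section \<open>Domains and boundary data\<close>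

definition grad :: "('a::euclidean_space \<Rightarrow> real) \<Rightarrow> 'a \<Rightarrow> 'a" where
  "grad f x = (\<Sum>b\<in>Basis. dderiv b f x *\<^sub>R b)"

text \<open>\<open>W\<close> is the neighbourhood of the closure on which \<open>\<rho>\<close> lives; the values of the total
  function \<open>\<rho>\<close> outside \<open>W\<close> are irrelevant.  The existence of such a \<open>\<rho>\<close> says that
  \<open>\<Omega>\<close> has smooth boundary.\<close>

definition defining_function ::
  "'a::euclidean_space set \<Rightarrow> 'a set \<Rightarrow> ('a \<Rightarrow> real) \<Rightarrow> bool" where
  "defining_function \<Omega> W \<rho> \<longleftrightarrow>
     open W \<and> closure \<Omega> \<subseteq> W \<and> smooth_on W \<rho> \<and>
     \<Omega> = {x\<in>W. \<rho> x < 0} \<and> frontier \<Omega> = {x\<in>W. \<rho> x = 0} \<and>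
     (\<forall>x\<in>frontier \<Omega>. grad \<rho> x \<noteq> 0)"

text \<open>Both integrands vanish off the support of \<open>v\<close>, so the values of \<open>u\<close> outside \<open>U\<close>
  do not matter.\<close>

definition J1 :: "(oct^2) set \<Rightarrow> (oct^2) set \<Rightarrow> (oct^2 \<Rightarrow> oct^2^2) set" where
  "J1 \<Omega> U = {u. smooth_on U u \<and> u ` U \<subseteq> H2O \<and>
     (\<forall>v\<in>test_functions U.
        (LINT x:\<Omega>|lborel. inner_O2 (D1 u x) (v x)) =
        (LINT x:\<Omega>|lborel. inner_H2 (u x) (D1_adj v x)))}"

text \<open>Here \<open>u\<^sub>0\<close> and \<open>u\<^sub>1\<close> are the smooth extensions, to the neighbourhood \<open>U\<close> of the boundary,
  of the two boundary functions.\<close>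

definition tangentially_OPH ::
  "(oct^2) set \<Rightarrow> (oct^2 \<Rightarrow> real) \<Rightarrow> (oct^2) set \<Rightarrow>
   (oct^2 \<Rightarrow> real) \<Rightarrow> (oct^2 \<Rightarrow> real) \<Rightarrow> bool" where
  "tangentially_OPH \<Omega> \<rho> U u0 u1 \<longleftrightarrow> D0 (\<lambda>x. u0 x + \<rho> x * u1 x) \<in> J1 \<Omega> U"

text \<open>\<open>f = g + O(\<rho>\<^sup>2)\<close> at the boundary, from inside \<open>\<Omega>\<close>.\<close>

definition eq_mod_rho2 ::
  "'a::euclidean_space set \<Rightarrow> ('a \<Rightarrow> real) \<Rightarrow> ('a \<Rightarrow> real) \<Rightarrow> ('a \<Rightarrow> real) \<Rightarrow> bool" where
  "eq_mod_rho2 \<Omega> \<rho> f g \<longleftrightarrow>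
     (\<exists>V C. open V \<and> frontier \<Omega> \<subseteq> V \<and>
        (\<forall>x \<in> V \<inter> closure \<Omega>. \<bar>f x - g x\<bar> \<le> C * (\<rho> x)\<^sup>2))"

end

theory Submission
  imports Defs "HOL-Complex_Analysis.Conformal_Mappings"
begin

text \<open>Write \<open>F = u\<^sub>0 + \<rho> u\<^sub>1\<close>, \<open>\<Gamma> = \<partial>\<Omega>\<close>, and let \<open>M(\<xi>,\<xi>)\<close> and \<open>N(\<xi>,\<cdot>)\<close> be the symbols of
  \<open>D\<^sub>0\<close> and \<open>D\<^sub>1\<close>.  They satisfy \<open>N(\<xi>, M(\<xi>,\<xi>)) = 0\<close>, so that \<open>D\<^sub>1 D\<^sub>0 = 0\<close>, and they are exact in the
  strong form \<open>\<bar>\<xi>\<bar>\<^sup>2 v = tr(v) M(\<xi>,\<xi>) + P(\<xi>, N(\<xi>,v))\<close> with a bilinear \<open>P\<close> (\<open>symbol_complex\<close>).  This one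
  identity is used twice: pointwise at the boundary, and as the operator identity
  \<open>\<Delta> = D\<^sub>0 tr + P(\<partial>) D\<^sub>1\<close>.

  At the boundary.  Testing the tangential equation with bumps that shrink to a point \<open>p \<in> \<Gamma>\<close> shows
  that \<open>N(\<nabla>\<rho>, D\<^sub>0 F) = 0\<close> on \<open>\<Gamma>\<close> (\<open>weak_normal_component_zero\<close>).  By exactness \<open>D\<^sub>0 F\<close> is there a
  multiple of \<open>M(\<nabla>\<rho>,\<nabla>\<rho>)\<close>, which a correction of \<open>F\<close> by a multiple of \<open>\<rho>\<^sup>2\<close> cancels.  Since
  \<open>D\<^sub>1 D\<^sub>0 = 0\<close>, the leading Taylor coefficient of the remaining \<open>D\<^sub>0 F\<close> again lies in the kernel of
  \<open>N(\<nabla>\<rho>,\<cdot>)\<close>, so the correction can be repeated at every order (\<open>jet_step\<close>).  Borel's lemma sums the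
  corrections to a smooth \<open>G = F + O(\<rho>\<^sup>2)\<close> such that \<open>D\<^sub>0 G\<close> vanishes to infinite order on \<open>\<Gamma>\<close>
  (\<open>formal_solution\<close>).

  In the interior.  Let \<open>H\<close> be \<open>D\<^sub>0 G\<close> in \<open>\<Omega>\<close> and zero elsewhere.  It is smooth with compact support,
  because \<open>D\<^sub>0 G\<close> is flat on \<open>\<Gamma>\<close>, and \<open>D\<^sub>1 H = 0\<close>.  Let \<open>g\<close> be the Newton potential of \<open>tr H\<close>.  By the
  operator identity \<open>D\<^sub>0 g - H\<close> is harmonic; it decays, so \<open>D\<^sub>0 g = H\<close> (\<open>compact_solution\<close>).  On a slice
  \<open>x\<^sub>2 = const\<close> that misses \<open>\<Omega>\<close>, \<open>g\<close> is harmonic in \<open>x\<^sub>1\<close> on all of \<open>\<real>\<^sup>8\<close> and decays, hence vanishes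
  (\<open>slice_vanishing\<close>); this is where the overdetermination of \<open>D\<^sub>0\<close> enters, as in Hartogs' theorem for
  holomorphic functions.  A Newton potential is real analytic off its source and the exterior of
  \<open>\<Omega>\<close> is connected, so \<open>g\<close> vanishes on the whole exterior
  (\<open>newton_potential_unique_continuation\<close>), and \<open>g = O(\<rho>\<^sup>2)\<close> at \<open>\<Gamma>\<close>.  The extension is \<open>G - g\<close>.

  The infinite order of the correction makes \<open>H\<close> smooth across \<open>\<Gamma>\<close>, so that \<open>g\<close> and the extension
  are smooth on the whole space and elliptic regularity up to the boundary never arises.\<close>

section \<open>Smooth functions\<close>

lemma dderiv_eq:
  assumes "(f has_derivative f') (at x)"
  shows "dderiv v f x = f' v"
proof -
  have l: "bounded_linear f'" using assms by (rule has_derivative_bounded_linear)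
  have "((\<lambda>t. x + t *\<^sub>R v) has_derivative (\<lambda>t. t *\<^sub>R v)) (at 0)"
    by (auto intro!: derivative_eq_intros)
  moreover have "(f has_derivative f') (at (x + 0 *\<^sub>R v))" using assms by simp
  ultimately have "((\<lambda>t. f (x + t *\<^sub>R v)) has_derivative (\<lambda>t. f' (t *\<^sub>R v))) (at 0)"
    by (rule has_derivative_compose)
  then have "((\<lambda>t. f (x + t *\<^sub>R v)) has_vector_derivative f' v) (at 0)"
    by (simp add: has_vector_derivative_def linear_simps(5)[OF l])
  then show ?thesis unfolding dderiv_def by (rule vector_derivative_at)
qed

lemma has_derivative_dderiv:
  assumes "f differentiable (at x)"
  shows "(f has_derivative (\<lambda>v. dderiv v f x)) (at x)"
proof -
  obtain f' where f': "(f has_derivative f') (at x)"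
    using assms unfolding differentiable_def by blast
  then have "f' = (\<lambda>v. dderiv v f x)" using dderiv_eq[OF f'] by auto
  then show ?thesis using f' by simp
qed

lemma dderiv_bounded_linear:
  "f differentiable (at x) \<Longrightarrow> bounded_linear (\<lambda>v. dderiv v f x)"
  by (rule has_derivative_bounded_linear[OF has_derivative_dderiv])

lemma dderiv_scale:
  assumes "f differentiable (at x)"
  shows "dderiv (s *\<^sub>R v) f x = s *\<^sub>R dderiv v f x"
  using linear_cmul[OF bounded_linear.linear[OF dderiv_bounded_linear[OF assms]]] by simp

lemma dderiv_expand:
  assumes "f differentiable (at x)"
  shows "dderiv v f x = (\<Sum>b\<in>Basis. (v \<bullet> b) *\<^sub>R dderiv b f x)"
proof -
  have l: "linear (\<lambda>v. dderiv v f x)"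
    using dderiv_bounded_linear[OF assms] by (rule bounded_linear.linear)
  have "dderiv v f x = dderiv (\<Sum>b\<in>Basis. (v \<bullet> b) *\<^sub>R b) f x"
    by (simp add: euclidean_representation)
  also have "\<dots> = (\<Sum>b\<in>Basis. (v \<bullet> b) *\<^sub>R dderiv b f x)"
    by (simp add: linear_sum[OF l] linear_cmul[OF l])
  finally show ?thesis .
qed

text \<open>Only values near \<open>x\<close> enter the definition, so this also holds where the functions are not
  differentiable.\<close>

lemma dderiv_cong:
  assumes "open W" "x \<in> W" "\<And>y. y \<in> W \<Longrightarrow> f y = g y"
  shows "dderiv v f x = dderiv v g x"
proof -
  have "open ((\<lambda>t::real. x + t *\<^sub>R v) -` W)"
    by (intro open_vimage assms continuous_intros)
  then have "\<forall>\<^sub>F t in nhds 0. x + t *\<^sub>R v \<in> W"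
    using eventually_nhds_in_open[of _ "0::real"] assms(2) by fastforce
  then show ?thesis unfolding dderiv_def
    by (intro vector_derivative_cong_eq) (auto elim!: eventually_mono intro: assms(3))
qed

lemma differentiable_cong_open:
  assumes "open W" "x \<in> W" "\<And>y. y \<in> W \<Longrightarrow> f y = g y" "f differentiable (at x)"
  shows "g differentiable (at x)"
  using assms unfolding differentiable_def
  by (metis has_derivative_transform_within_open)

text \<open>Unlike iterated partial derivatives indexed by lists, this recursion peels off the
  innermost derivative, which makes closure properties provable by induction on the order.\<close>

primrec diff_times :: "nat \<Rightarrow> 'a::euclidean_space set \<Rightarrow> ('a \<Rightarrow> 'b::real_normed_vector) \<Rightarrow> bool" where
  "diff_times 0 W f \<longleftrightarrow> (\<forall>x\<in>W. f differentiable (at x))"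
| "diff_times (Suc n) W f \<longleftrightarrow> (\<forall>x\<in>W. f differentiable (at x)) \<and>
     (\<forall>b\<in>Basis. diff_times n W (dderiv b f))"

lemma iter_dderiv_append: "iter_dderiv (us @ vs) f = iter_dderiv us (iter_dderiv vs f)"
  by (induction us) auto

lemma diff_times_iff:
  "diff_times n W f \<longleftrightarrow>
     (\<forall>vs. set vs \<subseteq> Basis \<and> length vs \<le> n \<longrightarrow> (\<forall>x\<in>W. iter_dderiv vs f differentiable (at x)))"
proof (induction n arbitrary: f)
  case 0
  then show ?case by auto
next
  case (Suc n)
  show ?case
  proof (intro iffI allI impI)
    fix vs :: "'a list"
    assume d: "diff_times (Suc n) W f" and vs: "set vs \<subseteq> Basis \<and> length vs \<le> Suc n"
    show "\<forall>x\<in>W. iter_dderiv vs f differentiable (at x)"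
    proof (cases vs rule: rev_cases)
      case Nil
      then show ?thesis using d by simp
    next
      case (snoc us b)
      then have "diff_times n W (dderiv b f)" using d vs by simp
      then show ?thesis using Suc.IH[of "dderiv b f"] snoc vs by (simp add: iter_dderiv_append)
    qed
  next
    assume a: "\<forall>vs. set vs \<subseteq> Basis \<and> length vs \<le> Suc n \<longrightarrow>
        (\<forall>x\<in>W. iter_dderiv vs f differentiable (at x))"
    have "\<forall>x\<in>W. f differentiable (at x)" using a[rule_format, of "[]"] by simp
    moreover have "diff_times n W (dderiv b f)" if b: "b \<in> Basis" for b
      unfolding Suc.IH
    proof (intro allI impI)
      fix us :: "'a list" assume "set us \<subseteq> Basis \<and> length us \<le> n"
      then show "\<forall>x\<in>W. iter_dderiv us (dderiv b f) differentiable (at x)"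
        using a[rule_format, of "us @ [b]"] b by (simp add: iter_dderiv_append)
    qed
    ultimately show "diff_times (Suc n) W f" by simp
  qed
qed

lemma C_infinity_iff_diff_times: "C_infinity W f \<longleftrightarrow> open W \<and> (\<forall>n. diff_times n W f)"
  unfolding C_infinity_def diff_times_iff by blast

lemma diff_times_0: "diff_times n W f \<Longrightarrow> x \<in> W \<Longrightarrow> f differentiable (at x)"
  by (cases n) auto

lemma diff_times_mono: "diff_times n W f \<Longrightarrow> m \<le> n \<Longrightarrow> diff_times m W f"
  unfolding diff_times_iff by auto

lemma diff_times_cong:
  assumes "open W" "\<And>y. y \<in> W \<Longrightarrow> f y = g y" "diff_times n W f"
  shows "diff_times n W g"
  using assms(2,3)
proof (induction n arbitrary: f g)
  case 0
  then show ?case using differentiable_cong_open[OF assms(1)] by (metis diff_times.simps(1))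
next
  case (Suc n)
  have "\<forall>x\<in>W. g differentiable (at x)"
    using Suc.prems differentiable_cong_open[OF assms(1)] by (metis diff_times.simps(2))
  moreover have "diff_times n W (dderiv b g)" if b: "b \<in> Basis" for b
  proof (rule Suc.IH[of "dderiv b f"])
    show "dderiv b f y = dderiv b g y" if "y \<in> W" for y
      using Suc.prems(1) by (intro dderiv_cong[OF assms(1) that])
  qed (use Suc.prems b in auto)
  ultimately show ?case by simp
qed

lemma diff_times_const: "diff_times n W (\<lambda>x. c)"
proof (induction n arbitrary: c)
  case (Suc n)
  have "dderiv b (\<lambda>x. c) = (\<lambda>x. 0)" for b :: 'a
    by (rule ext, rule dderiv_eq) simp
  then show ?case using Suc by simp
qed simp

lemma diff_times_linear:
  assumes "open W" "bounded_linear h" "diff_times n W f"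
  shows "diff_times n W (\<lambda>x. h (f x))"
  using assms(3)
proof (induction n arbitrary: f)
  case 0
  then show ?case
    by (auto simp: differentiable_def intro: bounded_linear.has_derivative[OF assms(2)])
next
  case (Suc n)
  have d: "f differentiable (at x)" if "x \<in> W" for x using Suc.prems that by simp
  have hd: "((\<lambda>x. h (f x)) has_derivative (\<lambda>v. h (dderiv v f x))) (at x)" if "x \<in> W" for x
    by (rule bounded_linear.has_derivative[OF assms(2) has_derivative_dderiv[OF d[OF that]]])
  have "diff_times n W (dderiv b (\<lambda>x. h (f x)))" if b: "b \<in> Basis" for b
    by (rule diff_times_cong[OF assms(1) _ Suc.IH[of "dderiv b f"]])
       (use Suc.prems b dderiv_eq[OF hd] in auto)
  then show ?case using hd by (auto simp: differentiable_def)
qed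

lemma diff_times_add:
  assumes "open W" "diff_times n W f" "diff_times n W g"
  shows "diff_times n W (\<lambda>x. f x + g x)"
  using assms(2,3)
proof (induction n arbitrary: f g)
  case 0
  then show ?case by auto
next
  case (Suc n)
  have hd: "((\<lambda>x. f x + g x) has_derivative (\<lambda>v. dderiv v f x + dderiv v g x)) (at x)"
    if "x \<in> W" for x
    using Suc.prems that by (intro has_derivative_add has_derivative_dderiv) auto
  have "diff_times n W (dderiv b (\<lambda>x. f x + g x))" if b: "b \<in> Basis" for b
    by (rule diff_times_cong[OF assms(1) _ Suc.IH[of "dderiv b f" "dderiv b g"]])
       (use Suc.prems b dderiv_eq[OF hd] in auto)
  then show ?case using hd by (auto simp: differentiable_def)
qed

text \<open>By the product rule a derivative of the product is a sum of two products of functions that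
  are differentiable one time less, so induction on the order applies.\<close>

lemma diff_times_bilinear:
  assumes "open W" "bounded_bilinear p" "diff_times n W f" "diff_times n W g"
  shows "diff_times n W (\<lambda>x. p (f x) (g x))"
  using assms(3,4)
proof (induction n arbitrary: f g)
  case 0
  then show ?case
    using bounded_bilinear.FDERIV[OF assms(2)] by (fastforce simp: differentiable_def)
next
  case (Suc n)
  have hd: "((\<lambda>x. p (f x) (g x)) has_derivative
      (\<lambda>v. p (f x) (dderiv v g x) + p (dderiv v f x) (g x))) (at x)"
    if "x \<in> W" for x
    using Suc.prems that by (intro bounded_bilinear.FDERIV[OF assms(2)] has_derivative_dderiv) auto
  have m: "diff_times n W f" "diff_times n W g"
    using Suc.prems diff_times_mono[of "Suc n" W f n] diff_times_mono[of "Suc n" W g n] by simp_all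
  have "diff_times n W (dderiv b (\<lambda>x. p (f x) (g x)))" if b: "b \<in> Basis" for b
    by (rule diff_times_cong[OF assms(1) _
         diff_times_add[OF assms(1) Suc.IH[of f "dderiv b g"] Suc.IH[of "dderiv b f" g]]])
       (use Suc.prems b dderiv_eq[OF hd] m in auto)
  then show ?case using hd by (auto simp: differentiable_def)
qed

lemma has_derivative_compose_real:
  fixes f :: "'a::euclidean_space \<Rightarrow> real" and \<psi> :: "real \<Rightarrow> 'b::real_normed_vector"
  assumes "f differentiable (at x)" "\<psi> differentiable (at (f x))"
  shows "((\<lambda>x. \<psi> (f x)) has_derivative (\<lambda>v. dderiv v f x *\<^sub>R dderiv 1 \<psi> (f x))) (at x)"
proof -
  have "((\<lambda>x. \<psi> (f x)) has_derivative (\<lambda>v. dderiv (dderiv v f x) \<psi> (f x))) (at x)"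
    by (rule has_derivative_compose[OF has_derivative_dderiv[OF assms(1)] has_derivative_dderiv[OF assms(2)]])
  moreover have "(\<lambda>v. dderiv (dderiv v f x) \<psi> (f x)) = (\<lambda>v. dderiv v f x *\<^sub>R dderiv 1 \<psi> (f x))"
  proof
    fix v
    show "dderiv (dderiv v f x) \<psi> (f x) = dderiv v f x *\<^sub>R dderiv 1 \<psi> (f x)"
      using dderiv_expand[OF assms(2), of "dderiv v f x"] unfolding Basis_real_def by simp
  qed
  ultimately show ?thesis by (simp only:)
qed

lemma diff_times_compose_real:
  fixes f :: "'a::euclidean_space \<Rightarrow> real" and \<psi> :: "real \<Rightarrow> 'b::real_normed_vector"
  assumes "open W" "diff_times n I \<psi>" "diff_times n W f" "\<And>x. x \<in> W \<Longrightarrow> f x \<in> I"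
  shows "diff_times n W (\<lambda>x. \<psi> (f x))"
  using assms(2,3)
proof (induction n arbitrary: \<psi>)
  case 0
  show ?case unfolding diff_times.simps
  proof
    fix x assume "x \<in> W"
    then have "f differentiable (at x)" "\<psi> differentiable (at (f x))" using 0 assms(4) by auto
    from has_derivative_compose_real[OF this] show "(\<lambda>x. \<psi> (f x)) differentiable (at x)"
      unfolding differentiable_def by blast
  qed
next
  case (Suc n)
  have hd: "((\<lambda>x. \<psi> (f x)) has_derivative (\<lambda>v. dderiv v f x *\<^sub>R dderiv 1 \<psi> (f x))) (at x)"
    if "x \<in> W" for x
    using Suc.prems that assms(4) by (intro has_derivative_compose_real) auto
  have m: "diff_times n W f" "diff_times n I (dderiv 1 \<psi>)"
    using Suc.prems diff_times_mono[of "Suc n" W f n] by simp_all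
  have "diff_times n W (dderiv b (\<lambda>x. \<psi> (f x)))" if b: "b \<in> Basis" for b
    by (rule diff_times_cong[OF assms(1) _
         diff_times_bilinear[OF assms(1) bounded_bilinear_scaleR, of _ "dderiv b f" "\<lambda>x. dderiv 1 \<psi> (f x)"]])
       (use Suc.prems Suc.IH b dderiv_eq[OF hd] m in auto)
  then show ?case using hd by (auto simp: differentiable_def)
qed

lemma has_derivative_affine:
  assumes "f differentiable (at (c + s *\<^sub>R x))"
  shows "((\<lambda>x. f (c + s *\<^sub>R x)) has_derivative (\<lambda>v. dderiv (s *\<^sub>R v) f (c + s *\<^sub>R x))) (at x)"
proof -
  have "((\<lambda>x. c + s *\<^sub>R x) has_derivative (\<lambda>v. s *\<^sub>R v)) (at x)"
    by (auto intro!: derivative_eq_intros)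
  from has_derivative_compose[OF this has_derivative_dderiv[OF assms]] show ?thesis .
qed

lemma diff_times_affine:
  assumes "open W" "open W'" "diff_times n W f" "\<And>x. x \<in> W' \<Longrightarrow> c + s *\<^sub>R x \<in> W"
  shows "diff_times n W' (\<lambda>x. f (c + s *\<^sub>R x))"
  using assms(3)
proof (induction n arbitrary: f)
  case 0
  have "((\<lambda>x. f (c + s *\<^sub>R x)) has_derivative (\<lambda>v. dderiv (s *\<^sub>R v) f (c + s *\<^sub>R x))) (at x)"
    if "x \<in> W'" for x
    using 0 assms(4)[OF that]
    by (intro has_derivative_affine) auto
  then show ?case by (auto simp: differentiable_def)
next
  case (Suc n)
  have hd: "((\<lambda>x. f (c + s *\<^sub>R x)) has_derivative (\<lambda>v. dderiv (s *\<^sub>R v) f (c + s *\<^sub>R x))) (at x)"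
    if "x \<in> W'" for x
    using Suc.prems assms(4)[OF that]
    by (intro has_derivative_affine) auto
  have sc: "dderiv (s *\<^sub>R b) f (c + s *\<^sub>R x) = s *\<^sub>R dderiv b f (c + s *\<^sub>R x)" if "x \<in> W'" for x b
    by (rule dderiv_scale) (use Suc.prems assms(4)[OF that] in auto)
  have "diff_times n W' (dderiv b (\<lambda>x. f (c + s *\<^sub>R x)))" if b: "b \<in> Basis" for b
    by (rule diff_times_cong[OF assms(2) _
         diff_times_linear[OF assms(2) bounded_linear_scaleR_right[of s] Suc.IH[of "dderiv b f"]]])
       (use Suc.prems b dderiv_eq[OF hd] sc in auto)
  then show ?case using hd by (auto simp: differentiable_def)
qed

lemma C_infinity_open: "C_infinity W f \<Longrightarrow> open W"
  by (simp add: C_infinity_def)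

lemma C_infinity_differentiable: "C_infinity W f \<Longrightarrow> x \<in> W \<Longrightarrow> f differentiable (at x)"
  using diff_times_0 C_infinity_iff_diff_times by blast

lemma C_infinity_continuous_on: "C_infinity W f \<Longrightarrow> continuous_on W f"
  by (meson C_infinity_differentiable continuous_at_imp_continuous_on differentiable_imp_continuous_within)

lemma C_infinity_dderiv_Basis: "C_infinity W f \<Longrightarrow> b \<in> Basis \<Longrightarrow> C_infinity W (dderiv b f)"
  unfolding C_infinity_iff_diff_times using diff_times.simps(2) by blast

lemma C_infinity_cong:
  "C_infinity W f \<Longrightarrow> (\<And>y. y \<in> W \<Longrightarrow> f y = g y) \<Longrightarrow> C_infinity W g"
  unfolding C_infinity_iff_diff_times using diff_times_cong by blast

lemma C_infinity_subset: "C_infinity W f \<Longrightarrow> open V \<Longrightarrow> V \<subseteq> W \<Longrightarrow> C_infinity V f"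
  unfolding C_infinity_def by blast

lemma C_infinity_Un: "C_infinity W f \<Longrightarrow> C_infinity V f \<Longrightarrow> C_infinity (W \<union> V) f"
  unfolding C_infinity_def by blast

lemma smooth_on_open_iff: "open X \<Longrightarrow> smooth_on X f \<longleftrightarrow> C_infinity X f"
  unfolding smooth_on_def
  by (metis C_infinity_cong C_infinity_subset order_refl)

lemma C_infinity_const: "open W \<Longrightarrow> C_infinity W (\<lambda>x. c)"
  by (simp add: C_infinity_iff_diff_times diff_times_const)

lemma C_infinity_linear: "bounded_linear h \<Longrightarrow> C_infinity W f \<Longrightarrow> C_infinity W (\<lambda>x. h (f x))"
  by (simp add: C_infinity_iff_diff_times diff_times_linear)

lemma C_infinity_add: "C_infinity W f \<Longrightarrow> C_infinity W g \<Longrightarrow> C_infinity W (\<lambda>x. f x + g x)"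
  by (simp add: C_infinity_iff_diff_times diff_times_add)

lemma C_infinity_bilinear:
  "bounded_bilinear p \<Longrightarrow> C_infinity W f \<Longrightarrow> C_infinity W g \<Longrightarrow> C_infinity W (\<lambda>x. p (f x) (g x))"
  by (simp add: C_infinity_iff_diff_times diff_times_bilinear)

lemma C_infinity_scaleR:
  "C_infinity W f \<Longrightarrow> C_infinity W g \<Longrightarrow> C_infinity W (\<lambda>x. f x *\<^sub>R g x)"
  by (rule C_infinity_bilinear[OF bounded_bilinear_scaleR])

lemma C_infinity_mult:
  fixes f g :: "'a::euclidean_space \<Rightarrow> real"
  shows "C_infinity W f \<Longrightarrow> C_infinity W g \<Longrightarrow> C_infinity W (\<lambda>x. f x * g x)"
  by (rule C_infinity_bilinear[OF bounded_bilinear_mult])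

lemma C_infinity_minus: "C_infinity W f \<Longrightarrow> C_infinity W (\<lambda>x. - f x)"
  by (rule C_infinity_linear[OF bounded_linear_minus[OF bounded_linear_ident]])

lemma C_infinity_diff:
  "C_infinity W f \<Longrightarrow> C_infinity W g \<Longrightarrow> C_infinity W (\<lambda>x. f x - g x)"
  using C_infinity_add[of W f "\<lambda>x. - g x"] C_infinity_minus[of W g] by simp

lemma C_infinity_sum:
  assumes "open W" "\<And>i. i \<in> I \<Longrightarrow> C_infinity W (f i)"
  shows "C_infinity W (\<lambda>x. \<Sum>i\<in>I. f i x)"
  using assms(2)
  by (induction I rule: infinite_finite_induct) (auto intro: C_infinity_add C_infinity_const assms(1))

lemma C_infinity_power:
  fixes f :: "'a::euclidean_space \<Rightarrow> real"
  shows "C_infinity W f \<Longrightarrow> C_infinity W (\<lambda>x. f x ^ n)"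
  by (induction n) (auto intro: C_infinity_mult C_infinity_const dest: C_infinity_open)

lemma C_infinity_prod:
  fixes f :: "'i \<Rightarrow> 'a::euclidean_space \<Rightarrow> real"
  assumes "open W" "\<And>i. i \<in> I \<Longrightarrow> C_infinity W (f i)"
  shows "C_infinity W (\<lambda>x. \<Prod>i\<in>I. f i x)"
  using assms(2)
  by (induction I rule: infinite_finite_induct) (auto intro: C_infinity_mult C_infinity_const assms(1))

lemma C_infinity_ident: "C_infinity W (\<lambda>x. x)" if "open W"
proof -
  have "diff_times n W (\<lambda>x::'a. x)" for n
  proof (cases n)
    case (Suc m)
    have "dderiv b (\<lambda>x::'a. x) = (\<lambda>x. b)" for b
      by (rule ext, rule dderiv_eq) (rule has_derivative_ident)
    then show ?thesis using Suc by (simp add: diff_times_const)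
  qed simp
  then show ?thesis using that by (simp add: C_infinity_iff_diff_times)
qed

lemma C_infinity_compose_real:
  fixes f :: "'a::euclidean_space \<Rightarrow> real" and \<psi> :: "real \<Rightarrow> 'b::real_normed_vector"
  assumes "C_infinity I \<psi>" "C_infinity W f" "\<And>x. x \<in> W \<Longrightarrow> f x \<in> I"
  shows "C_infinity W (\<lambda>x. \<psi> (f x))"
  using assms by (auto simp: C_infinity_iff_diff_times intro: diff_times_compose_real)

lemma C_infinity_affine:
  assumes "C_infinity W f" "open W'" "\<And>x. x \<in> W' \<Longrightarrow> c + s *\<^sub>R x \<in> W"
  shows "C_infinity W' (\<lambda>x. f (c + s *\<^sub>R x))"
  using assms by (auto simp: C_infinity_iff_diff_times intro: diff_times_affine)

lemma C_infinity_inverse: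
  fixes f :: "'a::euclidean_space \<Rightarrow> real"
  assumes "C_infinity W f" "\<And>x. x \<in> W \<Longrightarrow> f x \<noteq> 0"
  shows "C_infinity W (\<lambda>x. inverse (f x))"
proof -
  have o: "open (- {0::real})" by auto
  have hd: "(inverse has_derivative (\<lambda>h. - (inverse x * h * inverse x))) (at x)" if "x \<noteq> 0" for x :: real
    using that by (rule has_derivative_inverse')
  have "diff_times n (- {0}) (inverse :: real \<Rightarrow> real)" for n
  proof (induction n)
    case 0
    then show ?case using hd by (auto simp: differentiable_def)
  next
    case (Suc n)
    have "diff_times n (- {0}) (dderiv 1 (inverse :: real \<Rightarrow> real))"
      by (rule diff_times_cong[OF o _ diff_times_linear[OF o bounded_linear_minus[OF bounded_linear_ident]
            diff_times_bilinear[OF o bounded_bilinear_mult Suc Suc]]])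
         (use dderiv_eq[OF hd] in auto)
    then show ?case using hd by (auto simp: differentiable_def)
  qed
  then have "C_infinity (- {0}) (inverse :: real \<Rightarrow> real)"
    using o by (simp add: C_infinity_iff_diff_times)
  from C_infinity_compose_real[OF this assms(1)] show ?thesis using assms(2) by simp
qed

lemma C_infinity_dderiv: "C_infinity W f \<Longrightarrow> C_infinity W (dderiv v f)"
  by (rule C_infinity_cong[of W "\<lambda>x. \<Sum>b\<in>Basis. (v \<bullet> b) *\<^sub>R dderiv b f x"])
     (auto intro!: C_infinity_sum C_infinity_linear[OF bounded_linear_scaleR_right]
        C_infinity_dderiv_Basis dderiv_expand[symmetric] C_infinity_differentiable dest: C_infinity_open)

text \<open>Smoothness of series, of integrals with a parameter and of extensions by zero is proved by
  exhibiting such a class \<open>P\<close>.\<close>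

lemma C_infinity_coinduct:
  assumes "open W" "P f"
    and "\<And>f x. P f \<Longrightarrow> x \<in> W \<Longrightarrow> f differentiable (at x)"
    and "\<And>f b. P f \<Longrightarrow> b \<in> Basis \<Longrightarrow> \<exists>g. P g \<and> (\<forall>x\<in>W. dderiv b f x = g x)"
  shows "C_infinity W f"
proof -
  have "diff_times n W f" if "P f" for n f using that
  proof (induction n arbitrary: f)
    case (Suc n)
    have "diff_times n W (dderiv b f)" if b: "b \<in> Basis" for b
    proof -
      obtain g where "P g \<and> (\<forall>x\<in>W. dderiv b f x = g x)"
        using assms(4)[OF Suc.prems b] by (rule exE)
      then show ?thesis using diff_times_cong[OF assms(1) _ Suc.IH[of g], of "dderiv b f"] by simp
    qed
    then show ?case using assms(3) Suc.prems by simp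
  qed (use assms(3) in auto)
  then show ?thesis using assms(1,2) by (simp add: C_infinity_iff_diff_times)
qed

lemma dderiv_const [simp]: "dderiv v (\<lambda>x. c) x = 0"
  by (rule dderiv_eq) simp

lemma dderiv_linear:
  "bounded_linear h \<Longrightarrow> f differentiable (at x) \<Longrightarrow> dderiv v (\<lambda>x. h (f x)) x = h (dderiv v f x)"
  by (rule dderiv_eq) (rule bounded_linear.has_derivative[OF _ has_derivative_dderiv])

lemma dderiv_add:
  "f differentiable (at x) \<Longrightarrow> g differentiable (at x) \<Longrightarrow>
    dderiv v (\<lambda>x. f x + g x) x = dderiv v f x + dderiv v g x"
  by (rule dderiv_eq) (intro has_derivative_add has_derivative_dderiv)

lemma dderiv_diff:
  "f differentiable (at x) \<Longrightarrow> g differentiable (at x) \<Longrightarrow>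
    dderiv v (\<lambda>x. f x - g x) x = dderiv v f x - dderiv v g x"
  by (rule dderiv_eq) (intro has_derivative_diff has_derivative_dderiv)

lemma dderiv_sum:
  "(\<And>i. i \<in> I \<Longrightarrow> f i differentiable (at x)) \<Longrightarrow>
    dderiv v (\<lambda>x. \<Sum>i\<in>I. f i x) x = (\<Sum>i\<in>I. dderiv v (f i) x)"
  by (rule dderiv_eq) (intro has_derivative_sum has_derivative_dderiv)

lemma dderiv_bilinear:
  "bounded_bilinear p \<Longrightarrow> f differentiable (at x) \<Longrightarrow> g differentiable (at x) \<Longrightarrow>
    dderiv v (\<lambda>x. p (f x) (g x)) x = p (f x) (dderiv v g x) + p (dderiv v f x) (g x)"
  by (rule dderiv_eq) (intro bounded_bilinear.FDERIV has_derivative_dderiv)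

lemmas dderiv_scaleR = dderiv_bilinear[OF bounded_bilinear_scaleR]
lemmas dderiv_mult = dderiv_bilinear[OF bounded_bilinear_mult]

lemma dderiv_affine:
  assumes "f differentiable (at (c + s *\<^sub>R x))"
  shows "dderiv v (\<lambda>x. f (c + s *\<^sub>R x)) x = s *\<^sub>R dderiv v f (c + s *\<^sub>R x)"
  using dderiv_eq[OF has_derivative_affine[OF assms]]
    dderiv_scale[OF assms] by metis

lemma DERIV_along_line:
  fixes f :: "'a::euclidean_space \<Rightarrow> real"
  assumes "f differentiable (at (x + t *\<^sub>R v))"
  shows "((\<lambda>t. f (x + t *\<^sub>R v)) has_real_derivative dderiv v f (x + t *\<^sub>R v)) (at t)"
proof -
  have "((\<lambda>t. x + t *\<^sub>R v) has_derivative (\<lambda>s. s *\<^sub>R v)) (at t)"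
    by (auto intro!: derivative_eq_intros)
  from has_derivative_compose[OF this has_derivative_dderiv[OF assms]]
  have "((\<lambda>t. f (x + t *\<^sub>R v)) has_derivative (\<lambda>s. dderiv (s *\<^sub>R v) f (x + t *\<^sub>R v))) (at t)" .
  moreover have "(\<lambda>s. dderiv (s *\<^sub>R v) f (x + t *\<^sub>R v)) = (*) (dderiv v f (x + t *\<^sub>R v))"
    using dderiv_scale[OF assms] by (auto simp: mult.commute)
  ultimately show ?thesis by (simp add: has_field_derivative_def)
qed

text \<open>Two applications of the mean value theorem, first along \<open>a\<close> to the difference in direction
  \<open>b\<close>, then along \<open>b\<close>.\<close>

lemma second_difference:
  fixes f :: "'a::euclidean_space \<Rightarrow> real"
  assumes "C_infinity W f" "h > 0"
    and box: "\<And>s t. 0 \<le> s \<Longrightarrow> s \<le> h \<Longrightarrow> 0 \<le> t \<Longrightarrow> t \<le> h \<Longrightarrow> x + s *\<^sub>R a + t *\<^sub>R b \<in> W"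
  shows "\<exists>s t. 0 < s \<and> s < h \<and> 0 < t \<and> t < h \<and>
    f (x + h *\<^sub>R a + h *\<^sub>R b) - f (x + h *\<^sub>R a) - f (x + h *\<^sub>R b) + f x
      = h * h * dderiv b (dderiv a f) (x + s *\<^sub>R a + t *\<^sub>R b)"
proof -
  have d: "f differentiable (at y)" if "y \<in> W" for y
    using C_infinity_differentiable[OF assms(1) that] .
  have d2: "dderiv a f differentiable (at y)" if "y \<in> W" for y
    using C_infinity_differentiable[OF C_infinity_dderiv[OF assms(1)] that] .
  \<comment> \<open>The terms with factor zero bring the difference into the syntactic form of the mean value
    theorem.\<close>
  have "\<exists>s. 0 < s \<and> s < h \<and> (f ((x + h *\<^sub>R b) + h *\<^sub>R a) - f (x + h *\<^sub>R a)) -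
       (f ((x + h *\<^sub>R b) + 0 *\<^sub>R a) - f (x + 0 *\<^sub>R a)) =
      (h - 0) * (dderiv a f ((x + h *\<^sub>R b) + s *\<^sub>R a) - dderiv a f (x + s *\<^sub>R a))"
  proof (rule MVT2[OF assms(2)])
    fix s assume s: "0 \<le> s" "s \<le> h"
    have "x + h *\<^sub>R b + s *\<^sub>R a \<in> W" "x + s *\<^sub>R a \<in> W"
      using box[of s h] box[of s 0] s assms(2) by (auto simp: add_ac)
    then show "((\<lambda>s. f (x + h *\<^sub>R b + s *\<^sub>R a) - f (x + s *\<^sub>R a)) has_real_derivative
       dderiv a f (x + h *\<^sub>R b + s *\<^sub>R a) - dderiv a f (x + s *\<^sub>R a)) (at s)"
      by (intro DERIV_diff DERIV_along_line d)
  qed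
  then obtain s where s: "0 < s" "s < h" and e1: "f (x + h *\<^sub>R a + h *\<^sub>R b) - f (x + h *\<^sub>R a) -
       f (x + h *\<^sub>R b) + f x =
      h * (dderiv a f (x + s *\<^sub>R a + h *\<^sub>R b) - dderiv a f (x + s *\<^sub>R a))"
    by (auto simp: algebra_simps)
  have "\<exists>t. 0 < t \<and> t < h \<and> dderiv a f ((x + s *\<^sub>R a) + h *\<^sub>R b) - dderiv a f ((x + s *\<^sub>R a) + 0 *\<^sub>R b) =
      (h - 0) * dderiv b (dderiv a f) ((x + s *\<^sub>R a) + t *\<^sub>R b)"
    by (rule MVT2[OF assms(2)], rule DERIV_along_line, rule d2) (use box s in auto)
  then obtain t where "0 < t" "t < h" "dderiv a f (x + s *\<^sub>R a + h *\<^sub>R b) - dderiv a f (x + s *\<^sub>R a) =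
      h * dderiv b (dderiv a f) (x + s *\<^sub>R a + t *\<^sub>R b)" by auto
  then show ?thesis using s e1 by (metis mult.assoc)
qed

text \<open>The second difference over a small parallelogram is symmetric in \<open>a\<close> and \<open>b\<close> and is a
  value of either mixed derivative near \<open>x\<close>.\<close>

lemma dderiv_commute_real:
  fixes f :: "'a::euclidean_space \<Rightarrow> real"
  assumes "C_infinity W f" "x \<in> W"
  shows "dderiv a (dderiv b f) x = dderiv b (dderiv a f) x"
proof (rule ccontr)
  assume ne: "dderiv a (dderiv b f) x \<noteq> dderiv b (dderiv a f) x"
  define e where "e = \<bar>dderiv a (dderiv b f) x - dderiv b (dderiv a f) x\<bar> / 2"
  have e: "e > 0" using ne by (simp add: e_def)
  have op: "open W" using assms(1) by (rule C_infinity_open)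
  have c: "isCont (dderiv a (dderiv b f)) x" "isCont (dderiv b (dderiv a f)) x"
    using assms C_infinity_dderiv C_infinity_differentiable differentiable_imp_continuous_within by blast+
  obtain d0 where d0: "d0 > 0" "ball x d0 \<subseteq> W" using op assms(2) openE by blast
  obtain d1 where d1: "d1 > 0" "\<And>y. dist y x < d1 \<Longrightarrow> \<bar>dderiv a (dderiv b f) y - dderiv a (dderiv b f) x\<bar> < e"
    using c(1) e unfolding continuous_at_eps_delta dist_real_def by blast
  obtain d2 where d2: "d2 > 0" "\<And>y. dist y x < d2 \<Longrightarrow> \<bar>dderiv b (dderiv a f) y - dderiv b (dderiv a f) x\<bar> < e"
    using c(2) e unfolding continuous_at_eps_delta dist_real_def by blast
  define d where "d = min d0 (min d1 d2)"
  have dpos: "d > 0" using d0 d1 d2 by (simp add: d_def)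
  define D where "D = norm a + norm b + 1"
  define h where "h = d / (2 * D)"
  have den: "D > 0" unfolding D_def by (smt (verit) norm_ge_zero)
  have h: "h > 0" using dpos den by (simp add: h_def)
  have small: "dist (x + s *\<^sub>R a + t *\<^sub>R b) x < d" if "0 \<le> s" "s \<le> h" "0 \<le> t" "t \<le> h" for s t
  proof -
    have "dist (x + s *\<^sub>R a + t *\<^sub>R b) x = norm (s *\<^sub>R a + t *\<^sub>R b)" by (simp add: dist_norm)
    also have "\<dots> \<le> s * norm a + t * norm b"
      using norm_triangle_ineq[of "s *\<^sub>R a" "t *\<^sub>R b"] that by simp
    also have "\<dots> \<le> h * norm a + h * norm b"
      using that by (intro add_mono mult_right_mono) auto
    also have "\<dots> \<le> h * D" using h by (simp add: algebra_simps D_def)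
    also have "\<dots> = d / 2" using den by (simp add: h_def)
    also have "\<dots> < d" using dpos by simp
    finally show ?thesis .
  qed
  have W: "x + s *\<^sub>R a + t *\<^sub>R b \<in> W" if "0 \<le> s" "s \<le> h" "0 \<le> t" "t \<le> h" for s t
    using small[OF that] d0 by (auto simp: d_def dist_commute subset_iff)
  have W': "x + s *\<^sub>R b + t *\<^sub>R a \<in> W" if "0 \<le> s" "s \<le> h" "0 \<le> t" "t \<le> h" for s t
    using W[of t s] that by (simp add: add_ac)
  obtain s t where st: "0 < s" "s < h" "0 < t" "t < h"
    "f (x + h *\<^sub>R a + h *\<^sub>R b) - f (x + h *\<^sub>R a) - f (x + h *\<^sub>R b) + f x
      = h * h * dderiv b (dderiv a f) (x + s *\<^sub>R a + t *\<^sub>R b)"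
    using second_difference[OF assms(1) h W] by blast
  obtain s' t' where st': "0 < s'" "s' < h" "0 < t'" "t' < h"
    "f (x + h *\<^sub>R b + h *\<^sub>R a) - f (x + h *\<^sub>R b) - f (x + h *\<^sub>R a) + f x
      = h * h * dderiv a (dderiv b f) (x + s' *\<^sub>R b + t' *\<^sub>R a)"
    using second_difference[OF assms(1) h W'] by blast
  have "h * h * dderiv b (dderiv a f) (x + s *\<^sub>R a + t *\<^sub>R b) =
      h * h * dderiv a (dderiv b f) (x + s' *\<^sub>R b + t' *\<^sub>R a)"
    using st(5) st'(5) unfolding add.assoc[of x] add.commute[of "h *\<^sub>R b" "h *\<^sub>R a"] by linarith
  then have eq: "dderiv b (dderiv a f) (x + s *\<^sub>R a + t *\<^sub>R b) =
      dderiv a (dderiv b f) (x + s' *\<^sub>R b + t' *\<^sub>R a)" using h by simp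
  have "\<bar>dderiv b (dderiv a f) (x + s *\<^sub>R a + t *\<^sub>R b) - dderiv b (dderiv a f) x\<bar> < e"
    by (rule d2(2)) (use small[of s t] st d_def in auto)
  moreover have "\<bar>dderiv a (dderiv b f) (x + s' *\<^sub>R b + t' *\<^sub>R a) - dderiv a (dderiv b f) x\<bar> < e"
    by (rule d1(2)) (use small[of t' s'] st' d_def in \<open>auto simp: add_ac\<close>)
  ultimately show False using eq e_def by argo
qed

lemma dderiv_commute:
  fixes f :: "'a::euclidean_space \<Rightarrow> 'b::real_inner"
  assumes f: "C_infinity W f" and x: "x \<in> W"
  shows "dderiv a (dderiv b f) x = dderiv b (dderiv a f) x"
proof -
  have op: "open W" using f by (rule C_infinity_open)
  have *: "dderiv a (dderiv b f) x \<bullet> c = dderiv a (dderiv b (\<lambda>x. f x \<bullet> c)) x" for a b c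
  proof -
    have "dderiv a (dderiv b f) x \<bullet> c = dderiv a (\<lambda>x. dderiv b f x \<bullet> c) x"
      by (rule dderiv_linear[OF bounded_linear_inner_left, symmetric])
         (rule C_infinity_differentiable[OF C_infinity_dderiv[OF f] x])
    also have "\<dots> = dderiv a (dderiv b (\<lambda>x. f x \<bullet> c)) x"
      by (rule dderiv_cong[OF op x])
         (rule dderiv_linear[OF bounded_linear_inner_left, symmetric], rule C_infinity_differentiable[OF f])
    finally show ?thesis .
  qed
  have "C_infinity W (\<lambda>x. f x \<bullet> c)" for c
    by (rule C_infinity_linear[OF bounded_linear_inner_left f])
  then have "dderiv a (dderiv b f) x \<bullet> c = dderiv b (dderiv a f) x \<bullet> c" for c
    unfolding * using dderiv_commute_real[OF _ x] by blast
  then show ?thesis using vector_eq_rdot by blast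
qed

section \<open>Cutoff functions\<close>

text \<open>With \<open>p = 1\<close> this is the classical flat function \<open>exp(-1/t)\<close>; the polynomial factor closes
  the class under differentiation.\<close>

definition exp_poly :: "real poly \<Rightarrow> real \<Rightarrow> real" where
  "exp_poly p t = (if t > 0 then poly p (1 / t) * exp (- (1 / t)) else 0)"

lemma poly_times_exp_tendsto_0: "((\<lambda>y::real. poly q y * exp (- y)) \<longlongrightarrow> 0) at_top"
proof -
  have "((\<lambda>y::real. \<Sum>i\<le>degree q. coeff q i * (y ^ i / exp y)) \<longlongrightarrow> (\<Sum>i\<le>degree q. coeff q i * 0)) at_top"
    by (intro tendsto_sum tendsto_mult tendsto_const tendsto_power_div_exp_0)
  then show ?thesis
    by (simp add: poly_altdef exp_minus sum_divide_distrib field_simps)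
qed

lemma exp_poly_tendsto_0: "((\<lambda>t. exp_poly q t) \<longlongrightarrow> 0) (at 0)"
proof -
  have "((\<lambda>t. poly q (inverse t) * exp (- inverse t)) \<longlongrightarrow> 0) (at_right 0)"
    by (rule filterlim_compose[OF poly_times_exp_tendsto_0 filterlim_inverse_at_top_right])
  moreover have "\<forall>\<^sub>F t in at_right (0::real). poly q (inverse t) * exp (- inverse t) = exp_poly q t"
    by (auto simp: eventually_at_filter exp_poly_def inverse_eq_divide)
  ultimately have r: "((\<lambda>t. exp_poly q t) \<longlongrightarrow> 0) (at_right 0)"
    by (rule Lim_transform_eventually)
  have "\<forall>\<^sub>F t in at_left (0::real). 0 = exp_poly q t"
    by (auto simp: eventually_at_filter exp_poly_def)
  then have l: "((\<lambda>t. exp_poly q t) \<longlongrightarrow> 0) (at_left 0)"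
    by (rule Lim_transform_eventually[OF tendsto_const])
  show ?thesis using l r by (rule filterlim_split_at_real)
qed

text \<open>At the origin the difference quotient is again of the form \<open>exp_poly\<close> and tends to zero.\<close>

lemma exp_poly_deriv:
  "(exp_poly p has_real_derivative exp_poly ([:0, 0, 1:] * (p - pderiv p)) t) (at t)"
proof (cases "t = 0")
  case True
  have "((\<lambda>y. exp_poly ([:0, 1:] * p) y) \<longlongrightarrow> 0) (at 0)" by (rule exp_poly_tendsto_0)
  moreover have "exp_poly ([:0, 1:] * p) y = (exp_poly p y - exp_poly p 0) / (y - 0)" for y
    by (simp add: exp_poly_def)
  ultimately have "((\<lambda>y. (exp_poly p y - exp_poly p 0) / (y - 0)) \<longlongrightarrow> 0) (at 0)" by simp
  then show ?thesis using True by (simp add: has_field_derivative_iff exp_poly_def)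
next
  case False
  show ?thesis
  proof (cases "t > 0")
    case True
    have "((\<lambda>t. poly p (1 / t) * exp (- (1 / t))) has_real_derivative
        exp_poly ([:0, 0, 1:] * (p - pderiv p)) t) (at t)"
      using True
      by (auto intro!: derivative_eq_intros DERIV_chain2[where f="poly p"] poly_DERIV
          simp: exp_poly_def field_simps power2_eq_square)
    then show ?thesis
      by (rule has_field_derivative_transform_within_open[where S="{0<..}"])
         (use True in \<open>auto simp: exp_poly_def\<close>)
  next
    case f: False
    have "((\<lambda>t. 0) has_real_derivative exp_poly ([:0, 0, 1:] * (p - pderiv p)) t) (at t)"
      using f by (simp add: exp_poly_def)
    then show ?thesis
      by (rule has_field_derivative_transform_within_open[where S="{..<0}"])
         (use f False in \<open>auto simp: exp_poly_def\<close>)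
  qed
qed

lemma dderiv_DERIV: "(f has_real_derivative D) (at x) \<Longrightarrow> dderiv 1 f x = D"
  using dderiv_eq[of f "(*) D" x 1] by (simp add: has_field_derivative_def)

lemma C_infinity_exp_poly: "C_infinity UNIV (exp_poly p)"
proof (rule C_infinity_coinduct[where P="\<lambda>f. \<exists>p. f = exp_poly p"])
  show "f differentiable (at x)" if "\<exists>p. f = exp_poly p" for f and x :: real
    using that exp_poly_deriv real_differentiable_def by blast
  show "\<exists>g. (\<exists>p. g = exp_poly p) \<and> (\<forall>x\<in>UNIV. dderiv b f x = g x)"
    if "\<exists>p. f = exp_poly p" "b \<in> Basis" for f and b :: real
    using that dderiv_DERIV[OF exp_poly_deriv] by auto
qed auto

definition smooth_step :: "real \<Rightarrow> real" where
  "smooth_step t = exp_poly [:1:] (2 - t) * inverse (exp_poly [:1:] (2 - t) + exp_poly [:1:] (t - 1))"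

lemma exp_poly_1_nonneg: "exp_poly [:1:] t \<ge> 0"
  by (simp add: exp_poly_def)

lemma exp_poly_1_pos: "t > 0 \<Longrightarrow> exp_poly [:1:] t > 0"
  by (simp add: exp_poly_def)

lemma smooth_step_denom: "exp_poly [:1:] (2 - t) + exp_poly [:1:] (t - 1) > 0"
proof (cases "t < 2")
  case True
  then show ?thesis using exp_poly_1_pos[of "2 - t"] exp_poly_1_nonneg[of "t - 1"] by simp
next
  case False
  then show ?thesis using exp_poly_1_pos[of "t - 1"] exp_poly_1_nonneg[of "2 - t"] by simp
qed

lemma C_infinity_smooth_step: "C_infinity UNIV smooth_step"
proof -
  have 1: "C_infinity UNIV (\<lambda>t. exp_poly [:1:] (2 - t))"
    using C_infinity_affine[OF C_infinity_exp_poly, of UNIV 2 "-1" "[:1:]"] by simp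
  have 2: "C_infinity UNIV (\<lambda>t. exp_poly [:1:] (t - 1))"
    using C_infinity_affine[OF C_infinity_exp_poly, of UNIV "-1" 1 "[:1:]"] by simp
  have "C_infinity UNIV (\<lambda>t. exp_poly [:1:] (2 - t) * inverse (exp_poly [:1:] (2 - t) + exp_poly [:1:] (t - 1)))"
    by (intro C_infinity_mult C_infinity_inverse C_infinity_add 1 2)
       (metis less_irrefl smooth_step_denom)
  then show ?thesis by (simp add: smooth_step_def[abs_def])
qed

lemma smooth_step_eq_1: "t \<le> 1 \<Longrightarrow> smooth_step t = 1"
  using smooth_step_denom[of t] by (simp add: smooth_step_def exp_poly_def)

lemma smooth_step_eq_0: "t \<ge> 2 \<Longrightarrow> smooth_step t = 0"
  by (simp add: smooth_step_def exp_poly_def)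

lemma smooth_step_nonneg: "smooth_step t \<ge> 0"
  unfolding smooth_step_def
  using smooth_step_denom[of t] exp_poly_1_nonneg[of "2 - t"] by simp

lemma smooth_step_le_1: "smooth_step t \<le> 1"
  unfolding smooth_step_def
  using smooth_step_denom[of t] exp_poly_1_nonneg[of "t - 1"] by (simp add: field_simps)

definition ball_bump :: "'a::euclidean_space \<Rightarrow> real \<Rightarrow> 'a \<Rightarrow> real" where
  "ball_bump p r x = smooth_step ((x - p) \<bullet> (x - p) * inverse (r\<^sup>2))"

lemma C_infinity_ball_bump: "C_infinity UNIV (ball_bump p r)"
  unfolding ball_bump_def[abs_def]
  by (intro C_infinity_compose_real[OF C_infinity_smooth_step] C_infinity_mult C_infinity_const
      C_infinity_bilinear[OF bounded_bilinear_inner] C_infinity_diff C_infinity_ident) auto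

lemma ball_bump_eq_1: "r > 0 \<Longrightarrow> dist x p \<le> r \<Longrightarrow> ball_bump p r x = 1"
  unfolding ball_bump_def
  by (rule smooth_step_eq_1) (simp add: dist_norm power2_norm_eq_inner[symmetric] field_simps power_mono)

lemma ball_bump_eq_0: "r > 0 \<Longrightarrow> dist x p \<ge> 2 * r \<Longrightarrow> ball_bump p r x = 0"
  unfolding ball_bump_def
proof (rule smooth_step_eq_0)
  assume a: "r > 0" "dist x p \<ge> 2 * r"
  have "(2 * r)\<^sup>2 \<le> (dist x p)\<^sup>2" using a by (intro power_mono) auto
  moreover have "2 * r\<^sup>2 \<le> (2 * r)\<^sup>2" by (simp add: power_mult_distrib)
  ultimately have "2 * r\<^sup>2 \<le> (dist x p)\<^sup>2" by linarith
  then show "2 \<le> (x - p) \<bullet> (x - p) * inverse (r\<^sup>2)" using a(1)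
    by (simp add: dist_norm power2_norm_eq_inner[symmetric] field_simps)
qed

lemma ball_bump_nonneg: "ball_bump p r x \<ge> 0" and ball_bump_le_1: "ball_bump p r x \<le> 1"
  by (auto simp: ball_bump_def smooth_step_nonneg smooth_step_le_1)

text \<open>One minus the product of \<open>1 - b\<close> over finitely many ball bumps \<open>b\<close> that cover \<open>K\<close>: the
  product vanishes as soon as one bump equals one.\<close>

lemma smooth_cutoff_exists:
  fixes K U :: "'a::euclidean_space set"
  assumes "compact K" "open U" "K \<subseteq> U"
  shows "\<exists>\<eta> V C. C_infinity UNIV \<eta> \<and> open V \<and> K \<subseteq> V \<and> compact C \<and> V \<subseteq> C \<and> C \<subseteq> U \<and>
    (\<forall>x\<in>V. \<eta> x = (1::real)) \<and> (\<forall>x. x \<notin> C \<longrightarrow> \<eta> x = 0)"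
proof -
  have "\<exists>r. r > 0 \<and> cball p (2 * r) \<subseteq> U" if "p \<in> K" for p
  proof -
    have "p \<in> U" using assms(3) that by blast
    then obtain e where "e > 0" "cball p e \<subseteq> U" using assms(2) open_contains_cball_eq by metis
    then show ?thesis by (intro exI[of _ "e / 2"]) auto
  qed
  then obtain r where r: "\<And>p. p \<in> K \<Longrightarrow> r p > 0 \<and> cball p (2 * r p) \<subseteq> U" by metis
  obtain D where D: "D \<subseteq> K" "finite D" "K \<subseteq> (\<Union>p\<in>D. ball p (r p))"
    by (rule compactE_image[OF assms(1), of K "\<lambda>p. ball p (r p)"]) (use r in auto)
  define \<eta> where "\<eta> x = 1 - (\<Prod>p\<in>D. 1 - ball_bump p (r p) x)" for x
  define V where "V = (\<Union>p\<in>D. ball p (r p))"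
  define C where "C = (\<Union>p\<in>D. cball p (2 * r p))"
  have "C_infinity UNIV \<eta>" unfolding \<eta>_def[abs_def]
    by (intro C_infinity_diff C_infinity_const C_infinity_prod C_infinity_ball_bump) auto
  moreover have "compact C" unfolding C_def using D(2) by (intro compact_UN) auto
  moreover have "C \<subseteq> U" unfolding C_def using r D(1) by blast
  moreover have "V \<subseteq> C" unfolding C_def V_def using r D(1) by (force simp: less_imp_le)
  moreover have "\<eta> x = 1" if xV: "x \<in> V" for x
  proof -
    obtain p where "p \<in> D" "dist p x < r p" using xV unfolding V_def by auto
    then have "dist x p \<le> r p" by (simp add: dist_commute)
    then have "1 - ball_bump p (r p) x = 0" 
      using ball_bump_eq_1[of "r p" x p] r[of p] D(1) \<open>p \<in> D\<close> by (simp add: subset_iff)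
    then show ?thesis using \<open>p \<in> D\<close> D(2) unfolding \<eta>_def by (simp add: prod_zero_iff) blast
  qed
  moreover have "\<eta> x = 0" if "x \<notin> C" for x
  proof -
    have "ball_bump p (r p) x = 0" if "p \<in> D" for p
      using that \<open>x \<notin> C\<close> r D(1) by (intro ball_bump_eq_0) (auto simp: C_def dist_commute)
    then show ?thesis by (simp add: \<eta>_def)
  qed
  ultimately show ?thesis using D(3) unfolding V_def[symmetric]
    by (intro exI[of _ \<eta>] exI[of _ V] exI[of _ C]) (auto simp: V_def)
qed

lemma C_infinity_extend_zero:
  assumes "C_infinity U g" "C_infinity UNIV \<eta>" "closed C" "C \<subseteq> U" "\<And>x. x \<notin> C \<Longrightarrow> \<eta> x = 0"
  shows "C_infinity UNIV (\<lambda>x. \<eta> x *\<^sub>R g x)"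
proof -
  have "C_infinity U (\<lambda>x. \<eta> x *\<^sub>R g x)"
    using assms(1) C_infinity_subset[OF assms(2) C_infinity_open[OF assms(1)]]
    by (intro C_infinity_scaleR) auto
  moreover have "C_infinity (- C) (\<lambda>x. \<eta> x *\<^sub>R g x)"
    by (rule C_infinity_cong[OF C_infinity_const[of _ 0]]) (use assms in \<open>auto simp: open_Compl\<close>)
  ultimately have "C_infinity (U \<union> - C) (\<lambda>x. \<eta> x *\<^sub>R g x)" by (rule C_infinity_Un)
  moreover have "U \<union> - C = UNIV" using assms(4) by auto
  ultimately show ?thesis by simp
qed

section \<open>Smooth functions with bounded support\<close>

definition smooth_cpt :: "('a::euclidean_space \<Rightarrow> 'b::real_normed_vector) \<Rightarrow> bool" where
  "smooth_cpt f \<longleftrightarrow> C_infinity UNIV f \<and> (\<exists>R. \<forall>x. norm x > R \<longrightarrow> f x = 0)"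

lemma smooth_cpt_C_infinity: "smooth_cpt f \<Longrightarrow> C_infinity UNIV f"
  by (simp add: smooth_cpt_def)

lemma smooth_cpt_differentiable: "smooth_cpt f \<Longrightarrow> f differentiable (at x)"
  using C_infinity_differentiable[OF smooth_cpt_C_infinity UNIV_I] .

lemma smooth_cpt_dderiv:
  assumes "smooth_cpt f"
  shows "smooth_cpt (dderiv v f)"
proof -
  obtain R where R: "\<And>x. norm x > R \<Longrightarrow> f x = 0" using assms unfolding smooth_cpt_def by blast
  have o: "open {x::'a. norm x > R}" by (intro open_Collect_less continuous_intros)
  have "dderiv v f x = dderiv v (\<lambda>x. 0) x" if "norm x > R" for x
    by (rule dderiv_cong[OF o]) (use that R in auto)
  then show ?thesis using assms C_infinity_dderiv unfolding smooth_cpt_def dderiv_const by blast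
qed

lemma smooth_cpt_linear:
  assumes "bounded_linear h" "smooth_cpt f"
  shows "smooth_cpt (\<lambda>x. h (f x))"
  using assms C_infinity_linear linear_simps(3)[OF assms(1)] unfolding smooth_cpt_def by metis

lemma smooth_cpt_add:
  assumes "smooth_cpt f" "smooth_cpt g"
  shows "smooth_cpt (\<lambda>x. f x + g x)"
proof -
  obtain R S where "\<And>x. norm x > R \<Longrightarrow> f x = 0" "\<And>x. norm x > S \<Longrightarrow> g x = 0"
    using assms unfolding smooth_cpt_def by metis
  then have "norm x > max R S \<longrightarrow> f x + g x = 0" for x by simp
  then show ?thesis using assms C_infinity_add unfolding smooth_cpt_def by blast
qed

lemma smooth_cpt_zero: "smooth_cpt (\<lambda>x. 0)"
  by (simp add: smooth_cpt_def C_infinity_const)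

lemma smooth_cpt_sum: "(\<And>i. i \<in> I \<Longrightarrow> smooth_cpt (f i)) \<Longrightarrow> smooth_cpt (\<lambda>x. \<Sum>i\<in>I. f i x)"
  by (induction I rule: infinite_finite_induct) (auto intro: smooth_cpt_add smooth_cpt_zero)

lemma smooth_cpt_diff: "smooth_cpt f \<Longrightarrow> smooth_cpt g \<Longrightarrow> smooth_cpt (\<lambda>x. f x - g x)"
  using smooth_cpt_add[of f "\<lambda>x. - g x"]
    smooth_cpt_linear[OF bounded_linear_minus[OF bounded_linear_ident], of g] by simp

lemma smooth_cpt_bilinear_left:
  assumes "bounded_bilinear p" "smooth_cpt f" "C_infinity UNIV g"
  shows "smooth_cpt (\<lambda>x. p (f x) (g x))"
  using assms C_infinity_bilinear[OF assms(1)] bounded_bilinear.zero_left[OF assms(1)]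
  unfolding smooth_cpt_def by metis

lemma smooth_cpt_bilinear_right:
  assumes "bounded_bilinear p" "C_infinity UNIV f" "smooth_cpt g"
  shows "smooth_cpt (\<lambda>x. p (f x) (g x))"
  using assms C_infinity_bilinear[OF assms(1)] bounded_bilinear.zero_right[OF assms(1)]
  unfolding smooth_cpt_def by metis

lemma smooth_cpt_bounded:
  assumes "smooth_cpt f"
  shows "\<exists>B\<ge>0. \<forall>x. norm (f x) \<le> B"
proof -
  obtain R where R: "\<And>x. norm x > R \<Longrightarrow> f x = 0" using assms unfolding smooth_cpt_def by blast
  have "continuous_on (cball 0 R) f"
    using assms C_infinity_continuous_on continuous_on_subset unfolding smooth_cpt_def by blast
  then have "bounded (f ` cball 0 R)"
    using compact_continuous_image compact_cball compact_imp_bounded by blast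
  then obtain B where B: "\<forall>y\<in>f ` cball 0 R. norm y \<le> B" unfolding bounded_iff by blast
  have "norm (f x) \<le> max B 0" for x
  proof (cases "norm x > R")
    case False
    then have "f x \<in> f ` cball 0 R" by auto
    then show ?thesis using B by (meson le_max_iff_disj)
  qed (simp add: R)
  then show ?thesis by (intro exI[of _ "max B 0"]) auto
qed

lemma smooth_cpt_dderiv_bound:
  assumes "smooth_cpt f"
  shows "\<exists>C\<ge>0. \<forall>v x. norm (dderiv v f x) \<le> C * norm v"
proof -
  have "\<exists>B. B \<ge> 0 \<and> (\<forall>x. norm (dderiv b f x) \<le> B)" for b
    using smooth_cpt_bounded[OF smooth_cpt_dderiv[OF assms]] by blast
  then obtain B where B: "\<And>b. B b \<ge> 0" "\<And>b x. norm (dderiv b f x) \<le> B b" by metis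
  define C where "C = (\<Sum>b\<in>(Basis::'a set). B b)"
  have C: "C \<ge> 0" unfolding C_def using B by (intro sum_nonneg) auto
  have "norm (dderiv v f x) \<le> C * norm v" for v x
  proof -
    have "norm (dderiv v f x) \<le> (\<Sum>b\<in>Basis. norm ((v \<bullet> b) *\<^sub>R dderiv b f x))"
      unfolding dderiv_expand[OF smooth_cpt_differentiable[OF assms], where v=v] by (rule norm_sum)
    also have "\<dots> \<le> (\<Sum>b\<in>Basis. norm v * B b)"
      by (intro sum_mono) (auto intro!: mult_mono B simp: Basis_le_norm)
    finally show ?thesis by (simp add: C_def sum_distrib_left mult.commute)
  qed
  then show ?thesis using C by blast
qed

lemma smooth_cpt_Lipschitz:
  assumes "smooth_cpt f"
  shows "\<exists>C\<ge>0. \<forall>x y. norm (f x - f y) \<le> C * norm (x - y)"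
proof -
  obtain C where C: "C \<ge> 0" "\<And>v x. norm (dderiv v f x) \<le> C * norm v"
    using smooth_cpt_dderiv_bound[OF assms] by blast
  have "onorm (\<lambda>v. dderiv v f x) \<le> C" for x
    by (rule onorm_bound[OF C])
  then have "norm (f x - f y) \<le> C * norm (x - y)" for x y
    by (intro differentiable_bound[where S=UNIV and f'="\<lambda>x v. dderiv v f x"])
       (auto intro: has_derivative_dderiv smooth_cpt_differentiable assms)
  then show ?thesis using C(1) by blast
qed

text \<open>The quadratic error is uniform in the base point; both differentiation under the integral
  sign and the boundary estimate rely on this.\<close>

lemma smooth_cpt_Taylor2:
  assumes "smooth_cpt f"
  shows "\<exists>C\<ge>0. \<forall>x v. norm (f (x + v) - f x - dderiv v f x) \<le> C * (norm v)\<^sup>2"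
proof -
  have "\<exists>B. B \<ge> 0 \<and> (\<forall>x y. norm (dderiv b f x - dderiv b f y) \<le> B * norm (x - y))" for b
    using smooth_cpt_Lipschitz[OF smooth_cpt_dderiv[OF assms]] by blast
  then obtain B where B: "\<And>b. B b \<ge> 0"
    "\<And>b x y. norm (dderiv b f x - dderiv b f y) \<le> B b * norm (x - y)" by metis
  define C where "C = (\<Sum>b\<in>(Basis::'a set). B b)"
  have C: "C \<ge> 0" unfolding C_def using B by (intro sum_nonneg) auto
  have d: "f differentiable (at x)" for x by (rule smooth_cpt_differentiable[OF assms])
  have "norm (f (x + v) - f x - dderiv v f x) \<le> C * (norm v)\<^sup>2" for x v
  proof -
    define \<phi> where "\<phi> w = f (x + w) - dderiv w f x" for w
    have hd: "(\<phi> has_derivative (\<lambda>u. dderiv u f (x + w) - dderiv u f x)) (at w)" for w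
      unfolding \<phi>_def[abs_def]
      using has_derivative_affine[OF d, of x 1 w]
      by (intro has_derivative_diff bounded_linear_imp_has_derivative dderiv_bounded_linear d) simp
    have "onorm (\<lambda>u. dderiv u f (x + w) - dderiv u f x) \<le> C * norm v" if "w \<in> cball 0 (norm v)" for w
    proof (rule onorm_bound)
      fix u
      have "dderiv u f (x + w) - dderiv u f x = (\<Sum>b\<in>Basis. (u \<bullet> b) *\<^sub>R (dderiv b f (x + w) - dderiv b f x))"
        unfolding dderiv_expand[OF d, where v=u] by (simp add: sum_subtractf scaleR_diff_right)
      also have "norm \<dots> \<le> (\<Sum>b\<in>Basis. norm ((u \<bullet> b) *\<^sub>R (dderiv b f (x + w) - dderiv b f x)))"
        by (rule norm_sum)
      also have "\<dots> \<le> (\<Sum>b\<in>Basis. norm u * (B b * norm v))"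
      proof (rule sum_mono)
        fix b :: 'a assume b: "b \<in> Basis"
        have "norm (dderiv b f (x + w) - dderiv b f x) \<le> B b * norm w" using B(2)[of b "x + w" x] by simp
        also have "\<dots> \<le> B b * norm v" using that B(1) by (intro mult_left_mono) auto
        finally show "norm ((u \<bullet> b) *\<^sub>R (dderiv b f (x + w) - dderiv b f x)) \<le> norm u * (B b * norm v)"
          using b by (auto intro!: mult_mono simp: Basis_le_norm)
      qed
      finally show "norm (dderiv u f (x + w) - dderiv u f x) \<le> C * norm v * norm u"
        by (simp add: C_def sum_distrib_left sum_distrib_right mult_ac)
    qed (use C in auto)
    then have "norm (\<phi> v - \<phi> 0) \<le> C * norm v * norm (v - 0)"
      by (intro differentiable_bound[where S="cball 0 (norm v)"
            and f'="\<lambda>w u. dderiv u f (x + w) - dderiv u f x"] has_derivative_at_withinI[OF hd]) auto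
    moreover have "dderiv 0 f x = 0" by (rule linear_simps(3)[OF dderiv_bounded_linear[OF d]])
    ultimately show ?thesis by (simp add: \<phi>_def power2_eq_square algebra_simps)
  qed
  then show ?thesis using C by blast
qed

section \<open>Integration against a locally integrable kernel\<close>

lemma lebesgue_integral_affine:
  fixes f :: "'a::euclidean_space \<Rightarrow> real"
  assumes [measurable]: "f \<in> borel_measurable borel" and c: "c \<noteq> 0"
  shows "(\<integral>x. f x \<partial>lborel) = \<bar>c\<bar> ^ DIM('a) * (\<integral>x. f (t + c *\<^sub>R x) \<partial>lborel)"
  using c
  by (subst lborel_affine[OF c, of t])
     (simp add: integral_density integral_distr)

lemma lebesgue_integrable_affine:
  fixes f :: "'a::euclidean_space \<Rightarrow> real"
  assumes [measurable]: "f \<in> borel_measurable borel" and c: "c \<noteq> 0"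
    and i: "integrable lborel f"
  shows "integrable lborel (\<lambda>x. f (t + c *\<^sub>R x))"
  using i c
  by (subst (asm) lborel_affine[OF c, of t])
     (simp add: integrable_density integrable_distr_eq)

definition loc_integrable :: "('a::euclidean_space \<Rightarrow> real) \<Rightarrow> bool" where
  "loc_integrable k \<longleftrightarrow> k \<in> borel_measurable borel \<and>
     (\<forall>R. integrable lborel (\<lambda>y. indicator (cball 0 R) y * k y))"

text \<open>Correlation instead of convolution: the argument of \<open>h\<close> is \<open>x + y\<close>, so that
  differentiation in \<open>x\<close> involves no sign.\<close>

definition corr :: "('a::euclidean_space \<Rightarrow> real) \<Rightarrow> ('a \<Rightarrow> real) \<Rightarrow> 'a \<Rightarrow> real" where
  "corr k h x = (\<integral>y. k y * h (x + y) \<partial>lborel)"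

lemma smooth_cpt_measurable: "smooth_cpt h \<Longrightarrow> (\<lambda>y. h (x + y)) \<in> borel_measurable borel"
  for h :: "'a::euclidean_space \<Rightarrow> real"
  using C_infinity_affine[of UNIV h UNIV x 1]
  by (intro borel_measurable_continuous_onI C_infinity_continuous_on) (auto simp: smooth_cpt_def)

lemma corr_bound:
  assumes k: "loc_integrable k" and g[measurable]: "g \<in> borel_measurable borel"
    and B: "\<And>y. \<bar>g y\<bar> \<le> B" and R: "\<And>y. norm y > R \<Longrightarrow> g y = 0"
  shows "integrable lborel (\<lambda>y. k y * g y)"
    and "\<bar>\<integral>y. k y * g y \<partial>lborel\<bar> \<le> B * (\<integral>y. \<bar>indicator (cball 0 R) y * k y\<bar> \<partial>lborel)"
proof -
  have km[measurable]: "k \<in> borel_measurable borel" using k by (simp add: loc_integrable_def)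
  have ki: "integrable lborel (\<lambda>y. B * \<bar>indicator (cball 0 R) y * k y\<bar>)"
    using k by (simp add: loc_integrable_def)
  have le: "\<bar>k y * g y\<bar> \<le> B * \<bar>indicator (cball 0 R) y * k y\<bar>" for y
  proof (cases "norm y > R")
    case True
    then show ?thesis using R by simp
  next
    case False
    then show ?thesis using mult_left_mono[OF B[of y], of "\<bar>k y\<bar>"]
      by (simp add: abs_mult mult.commute)
  qed
  show i: "integrable lborel (\<lambda>y. k y * g y)"
    by (rule Bochner_Integration.integrable_bound[OF ki]) (use le in \<open>auto intro: AE_I2 order_trans[OF _ abs_ge_self]\<close>)
  have "\<bar>\<integral>y. k y * g y \<partial>lborel\<bar> \<le> (\<integral>y. \<bar>k y * g y\<bar> \<partial>lborel)" by (rule integral_abs_bound)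
  also have "\<dots> \<le> (\<integral>y. B * \<bar>indicator (cball 0 R) y * k y\<bar> \<partial>lborel)"
    by (rule integral_mono) (use i ki le in auto)
  finally show "\<bar>\<integral>y. k y * g y \<partial>lborel\<bar> \<le> B * (\<integral>y. \<bar>indicator (cball 0 R) y * k y\<bar> \<partial>lborel)" by simp
qed

lemma corr_integrable:
  assumes k: "loc_integrable k" and h: "smooth_cpt h"
  shows "integrable lborel (\<lambda>y. k y * h (x + y))"
proof -
  obtain B where B: "\<forall>x. norm (h x) \<le> B" using smooth_cpt_bounded[OF h] by blast
  obtain R where R: "\<forall>x. norm x > R \<longrightarrow> h x = 0" using h unfolding smooth_cpt_def by blast
  have "h (x + y) = 0" if "norm y > R + norm x" for y
    using that R norm_triangle_ineq4[of "x + y" x] by (smt (verit) add_diff_cancel_left')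
  then show ?thesis
    using B by (intro corr_bound(1)[OF k smooth_cpt_measurable[OF h], of _ B "R + norm x"]) auto
qed

text \<open>The Taylor remainder of \<open>h\<close> is bounded by a multiple of \<open>\<bar>v\<bar>\<^sup>2\<close> and supported in a fixed
  ball for \<open>\<bar>v\<bar> \<le> 1\<close>, where the kernel is integrable.\<close>

lemma corr_has_derivative:
  assumes k: "loc_integrable k" and h: "smooth_cpt h"
  shows "(corr k h has_derivative (\<lambda>v. corr k (dderiv v h) x)) (at x)"
proof -
  have d: "h differentiable (at x)" for x by (rule smooth_cpt_differentiable[OF h])
  have ints: "integrable lborel (\<lambda>y. k y * h (x + y))" "integrable lborel (\<lambda>y. k y * dderiv v h (x + y))" for x v
    by (intro corr_integrable k h smooth_cpt_dderiv)+
  have "linear (\<lambda>v. corr k (dderiv v h) x)"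
  proof (rule linearI)
    fix u v
    have "dderiv (u + v) h y = dderiv u h y + dderiv v h y" for y
      using linear_simps(1)[OF dderiv_bounded_linear[OF d]] .
    then show "corr k (dderiv (u + v) h) x = corr k (dderiv u h) x + corr k (dderiv v h) x"
      unfolding corr_def by (simp add: distrib_left ints)
  next
    fix r v
    show "corr k (dderiv (r *\<^sub>R v) h) x = r *\<^sub>R corr k (dderiv v h) x"
      unfolding corr_def dderiv_scale[OF d] by (simp add: mult.left_commute)
  qed
  then have lin: "bounded_linear (\<lambda>v. corr k (dderiv v h) x)" by (simp add: linear_conv_bounded_linear)
  obtain C where C: "C \<ge> 0" "\<And>x v. norm (h (x + v) - h x - dderiv v h x) \<le> C * (norm v)\<^sup>2"
    using smooth_cpt_Taylor2[OF h] by blast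
  obtain R where R: "\<And>x. norm x > R \<Longrightarrow> h x = 0" using h unfolding smooth_cpt_def by blast
  have o: "open {x::'a. norm x > R}" by (intro open_Collect_less continuous_intros)
  have R': "dderiv v h x = 0" if "norm x > R" for v x
    using dderiv_cong[OF o, of x h "\<lambda>x. 0" v] that R by simp
  define K where "K = (\<integral>y. \<bar>indicator (cball 0 (R + norm x + 1)) y * k y\<bar> \<partial>lborel)"
  have K: "K \<ge> 0" unfolding K_def by (rule integral_nonneg_AE) auto
  have est: "\<bar>corr k h (x + v) - corr k h x - corr k (dderiv v h) x\<bar> \<le> C * (norm v)\<^sup>2 * K" if v: "norm v \<le> 1" for v
  proof -
    define g where "g y = h (x + v + y) - h (x + y) - dderiv v h (x + y)" for y
    have eq: "corr k h (x + v) - corr k h x - corr k (dderiv v h) x = (\<integral>y. k y * g y \<partial>lborel)"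
      unfolding corr_def g_def by (simp add: right_diff_distrib ints)
    have "\<bar>\<integral>y. k y * g y \<partial>lborel\<bar> \<le> C * (norm v)\<^sup>2 * (\<integral>y. \<bar>indicator (cball 0 (R + norm x + 1)) y * k y\<bar> \<partial>lborel)"
    proof (rule corr_bound(2)[OF k])
      show "g \<in> borel_measurable borel" unfolding g_def[abs_def]
        by (intro borel_measurable_diff smooth_cpt_measurable h smooth_cpt_dderiv)
      show "\<bar>g y\<bar> \<le> C * (norm v)\<^sup>2" for y
        using C(2)[of "x + y" v] by (simp add: g_def add_ac)
      show "g y = 0" if "norm y > R + norm x + 1" for y
      proof -
        have "norm (x + y) > R" using that norm_triangle_ineq4[of "x + y" x] by simp
        moreover have "norm (x + v + y) > R"
          using that v norm_triangle_ineq4[of "x + v + y" x] norm_triangle_ineq[of v y]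
            norm_triangle_ineq4[of "v + y" v] by (simp add: add_ac)
        ultimately show ?thesis by (simp add: g_def R R')
      qed
    qed
    then show ?thesis unfolding eq K_def .
  qed
  show ?thesis unfolding has_derivative_at_alt
  proof (intro conjI lin allI impI)
    fix e :: real assume e: "e > 0"
    define d where "d = min 1 (e / (C * K + 1))"
    have CK: "C * K + 1 > 0" using C K by (simp add: add_nonneg_pos)
    have "norm (corr k h y - corr k h x - corr k (dderiv (y - x) h) x) \<le> e * norm (y - x)" if "norm (y - x) < d" for y
    proof -
      have "\<bar>corr k h (x + (y - x)) - corr k h x - corr k (dderiv (y - x) h) x\<bar> \<le> C * (norm (y - x))\<^sup>2 * K"
        by (rule est) (use that d_def in auto)
      also have "\<dots> = (C * K * norm (y - x)) * norm (y - x)" by (simp add: power2_eq_square)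
      also have "\<dots> \<le> e * norm (y - x)"
      proof (rule mult_right_mono)
        have "C * K * norm (y - x) \<le> (C * K + 1) * norm (y - x)" by (simp add: mult_right_mono)
        also have "\<dots> \<le> (C * K + 1) * (e / (C * K + 1))"
          using that CK by (intro mult_left_mono) (auto simp: d_def)
        also have "\<dots> = e" using CK by simp
        finally show "C * K * norm (y - x) \<le> e" .
      qed auto
      finally show ?thesis by simp
    qed
    moreover have "d > 0" using e CK by (simp add: d_def)
    ultimately show "\<exists>d>0. \<forall>y. norm (y - x) < d \<longrightarrow>
        norm (corr k h y - corr k h x - corr k (dderiv (y - x) h) x) \<le> e * norm (y - x)" by blast
  qed
qed

lemma dderiv_corr:
  "loc_integrable k \<Longrightarrow> smooth_cpt h \<Longrightarrow> dderiv v (corr k h) x = corr k (dderiv v h) x"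
  by (rule dderiv_eq[OF corr_has_derivative])

lemma C_infinity_corr:
  assumes "loc_integrable k" "smooth_cpt h"
  shows "C_infinity UNIV (corr k h)"
proof (rule C_infinity_coinduct[where P="\<lambda>f. \<exists>h. smooth_cpt h \<and> f = corr k h"])
  show "f differentiable (at x)" if "\<exists>h. smooth_cpt h \<and> f = corr k h" for f x
    using that corr_has_derivative[OF assms(1)] unfolding differentiable_def by blast
  show "\<exists>g. (\<exists>h. smooth_cpt h \<and> g = corr k h) \<and> (\<forall>x\<in>UNIV. dderiv b f x = g x)"
    if "\<exists>h. smooth_cpt h \<and> f = corr k h" "b \<in> Basis" for f b
    using that dderiv_corr[OF assms(1)] smooth_cpt_dderiv by blast
qed (use assms in auto)

lemma loc_integrable_continuous:
  assumes "continuous_on UNIV k"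
  shows "loc_integrable k"
  unfolding loc_integrable_def
proof (intro conjI allI)
  show [measurable]: "k \<in> borel_measurable borel" by (rule borel_measurable_continuous_onI[OF assms])
  fix R
  have "bounded (k ` cball 0 R)"
    by (intro compact_imp_bounded compact_continuous_image continuous_on_subset[OF assms] compact_cball) auto
  then obtain B where B: "\<forall>y\<in>k ` cball 0 R. norm y \<le> B" unfolding bounded_iff by blast
  have "integrable lborel (\<lambda>y. indicator (cball 0 R) y *\<^sub>R k y)"
    by (rule integrableI_bounded_set_indicator[where B=B])
       (use B emeasure_bounded_finite[OF bounded_cball[of 0 R]] in auto)
  then show "integrable lborel (\<lambda>y. indicator (cball 0 R) y * k y)" by simp
qed

text \<open>The integral of \<open>w\<close> does not change when \<open>w\<close> is translated. Integration by parts is this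
  statement for products.\<close>

lemma integral_dderiv_eq_0:
  fixes w :: "'a::euclidean_space \<Rightarrow> real"
  assumes "smooth_cpt w"
  shows "(\<integral>y. dderiv v w y \<partial>lborel) = 0"
proof -
  have k: "loc_integrable (\<lambda>y::'a. 1)" by (rule loc_integrable_continuous) auto
  have m: "w \<in> borel_measurable borel" using smooth_cpt_measurable[OF assms, of 0] by simp
  have "corr (\<lambda>y. 1) w = (\<lambda>x. \<integral>y. w y \<partial>lborel)"
    unfolding corr_def using lebesgue_integral_affine[OF m, of 1] by auto
  then have "dderiv v (corr (\<lambda>y. 1) w) 0 = 0" by simp
  then show ?thesis unfolding dderiv_corr[OF k assms] by (simp add: corr_def)
qed

text \<open>The comparison function is the series of \<open>a k\<close> times the indicator of the ball of radius
  \<open>r k\<close>; with dyadic radii it replaces integration in polar coordinates.\<close>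

lemma integrable_by_balls:
  fixes f :: "'a::euclidean_space \<Rightarrow> real"
  assumes [measurable]: "f \<in> borel_measurable borel"
    and cov: "\<And>y. y \<noteq> 0 \<Longrightarrow> f y \<noteq> 0 \<Longrightarrow> \<exists>k::nat. norm y < r k \<and> \<bar>f y\<bar> \<le> a k"
    and a: "\<And>k. a k \<ge> 0" and r: "\<And>k. r k \<ge> 0"
    and s: "summable (\<lambda>k. a k * r k ^ DIM('a))"
  shows "integrable lborel f"
proof (rule integrableI_bounded)
  let ?V = "unit_ball_vol (real DIM('a))"
  have "(\<integral>\<^sup>+ y. ennreal (norm (f y)) \<partial>lborel) \<le>
      (\<integral>\<^sup>+ y. (\<Sum>k. ennreal (a k) * indicator (ball 0 (r k)) (y::'a)) \<partial>lborel)"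
  proof (rule nn_integral_mono_AE)
    have "AE y in lborel. y \<noteq> (0::'a)" by (rule AE_lborel_singleton)
    then show "AE y in lborel. ennreal (norm (f y)) \<le> (\<Sum>k. ennreal (a k) * indicator (ball 0 (r k)) y)"
    proof eventually_elim
      case (elim y)
      show ?case
      proof (cases "f y = 0")
        case False
        then obtain k where k: "norm y < r k" "\<bar>f y\<bar> \<le> a k" using cov elim by blast
        have "ennreal (norm (f y)) \<le> ennreal (a k) * indicator (ball 0 (r k)) y"
          using k by (simp add: ennreal_leI)
        also have "F k \<le> suminf F" for F :: "nat \<Rightarrow> ennreal"
          using sum_le_suminf[of F "{k}"] by simp
        finally show ?thesis .
      qed simp
    qed
  qed
  also have "\<dots> = (\<Sum>k. \<integral>\<^sup>+ y. ennreal (a k) * indicator (ball 0 (r k)) (y::'a) \<partial>lborel)"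
    by (rule nn_integral_suminf) (auto intro!: borel_measurable_times_ennreal borel_measurable_indicator)
  also have "\<dots> = (\<Sum>k. ennreal (a k * (?V * r k ^ DIM('a))))"
    by (intro suminf_cong, subst nn_integral_cmult_indicator) (simp_all add: emeasure_ball r a ennreal_mult')
  also have "\<dots> < \<infinity>"
  proof -
    have "summable (\<lambda>k. ?V * (a k * r k ^ DIM('a)))" using s by (rule summable_mult)
    then have "(\<Sum>k. ennreal (?V * (a k * r k ^ DIM('a)))) \<noteq> top"
      by (rule ennreal_suminf_neq_top) (simp add: a r)
    then show ?thesis by (simp add: mult_ac top.not_eq_extremum)
  qed
  finally show "(\<integral>\<^sup>+ y. ennreal (norm (f y)) \<partial>lborel) < \<infinity>" .
qed simp

lemma dyadic_below:
  fixes t :: real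
  assumes "0 < t" "t < 1"
  shows "\<exists>k::nat. (1/2) ^ Suc k \<le> t \<and> t < (1/2) ^ k"
proof -
  obtain n where "(1/2) ^ n < t" using real_arch_pow_inv[OF assms(1), of "1/2"] by auto
  then have ex: "\<exists>k::nat. (1/2) ^ Suc k \<le> t" using assms(1) by (intro exI[of _ n]) simp
  define k where "k = (LEAST k::nat. (1/2) ^ Suc k \<le> t)"
  have 1: "(1/2) ^ Suc k \<le> t" unfolding k_def by (rule LeastI_ex[OF ex])
  have "t < (1/2) ^ k"
  proof (cases k)
    case 0
    then show ?thesis using assms(2) by simp
  next
    case (Suc j)
    then have "\<not> (1/2) ^ Suc j \<le> t" unfolding k_def by (metis not_less_Least lessI)
    then show ?thesis using Suc by simp
  qed
  then show ?thesis using 1 by blast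
qed

lemma dyadic_above:
  fixes t :: real
  assumes "1 \<le> t"
  shows "\<exists>k::nat. 2 ^ k \<le> t \<and> t < 2 ^ Suc k"
proof -
  obtain n where "t < 2 ^ n" using real_arch_pow[of 2 t] by auto
  then have ex: "\<exists>k::nat. t < 2 ^ Suc k" using assms by (intro exI[of _ n]) simp
  define k where "k = (LEAST k::nat. t < 2 ^ Suc k)"
  have 1: "t < 2 ^ Suc k" unfolding k_def by (rule LeastI_ex[OF ex])
  have "2 ^ k \<le> t"
  proof (cases k)
    case 0
    then show ?thesis using assms by simp
  next
    case (Suc j)
    then have "\<not> t < 2 ^ Suc j" unfolding k_def by (metis not_less_Least lessI)
    then show ?thesis using Suc by simp
  qed
  then show ?thesis using 1 by blast
qed

section \<open>The Newton potential in even dimension\<close>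

definition laplacian :: "('a::euclidean_space \<Rightarrow> 'b::real_normed_vector) \<Rightarrow> 'a \<Rightarrow> 'b" where
  "laplacian f x = (\<Sum>b\<in>Basis. dderiv b (dderiv b f) x)"

text \<open>In dimension \<open>2 m + 2\<close> and up to a constant, \<open>ikernel m 0\<close> is the fundamental solution of
  the Laplacian, and \<open>ikernel m e\<close> with \<open>e > 0\<close> a smooth regularisation of it.\<close>

definition ikernel :: "nat \<Rightarrow> real \<Rightarrow> 'a::euclidean_space \<Rightarrow> real" where
  "ikernel j e y = inverse ((y \<bullet> y + e) ^ j)"

lemma ikernel_base_pos: "e > 0 \<Longrightarrow> y \<bullet> y + e > (0::real)"
  by (simp add: add_nonneg_pos)

lemma ikernel_base_nonzero: "e > 0 \<Longrightarrow> (y \<bullet> y + e) ^ j \<noteq> (0::real)"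
  using ikernel_base_pos[of e y] by simp

lemma C_infinity_ikernel: "e > 0 \<Longrightarrow> C_infinity UNIV (ikernel j e)"
  unfolding ikernel_def[abs_def]
  by (intro C_infinity_inverse C_infinity_power C_infinity_add C_infinity_const
      C_infinity_bilinear[OF bounded_bilinear_inner] C_infinity_ident open_UNIV ikernel_base_nonzero)

lemma dderiv_ikernel:
  assumes "e > 0"
  shows "dderiv v (ikernel j e) y = - (2 * real j * (y \<bullet> v) * ikernel (Suc j) e y)"
proof -
  define s where "s = y \<bullet> y + e"
  have s: "s > 0" using ikernel_base_pos[OF assms] by (simp add: s_def)
  have "((\<lambda>t. inverse (t ^ j)) has_real_derivative - (real j * inverse (s ^ Suc j))) (at s)"
  proof -
    have "((\<lambda>t. inverse (t ^ j)) has_real_derivative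
        - (real j * s ^ (j - Suc 0) * inverse ((s ^ j) ^ Suc (Suc 0)))) (at s)"
      using s by (intro DERIV_inverse_fun DERIV_pow) auto
    moreover have "real j * s ^ (j - Suc 0) * inverse ((s ^ j) ^ Suc (Suc 0)) = real j * inverse (s ^ Suc j)"
      using s by (cases j) (simp_all add: field_simps)
    ultimately show ?thesis by (simp only:)
  qed
  then have 1: "((\<lambda>t. inverse (t ^ j)) has_derivative (*) (- (real j * inverse (s ^ Suc j)))) (at (y \<bullet> y + e))"
    unfolding has_field_derivative_def s_def[symmetric] .
  have 2: "((\<lambda>y. y \<bullet> y + e) has_derivative (\<lambda>v. 2 * (y \<bullet> v))) (at y)"
    by (auto intro!: derivative_eq_intros simp: inner_commute)
  have "((\<lambda>y. inverse ((y \<bullet> y + e) ^ j)) has_derivative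
      (\<lambda>v. - (real j * inverse (s ^ Suc j)) * (2 * (y \<bullet> v)))) (at y)"
    by (rule has_derivative_compose[OF 2 1])
  then have "(ikernel j e has_derivative (\<lambda>v. - (real j * inverse (s ^ Suc j)) * (2 * (y \<bullet> v)))) (at y)"
    by (simp add: ikernel_def[abs_def])
  from dderiv_eq[OF this] show ?thesis by (simp add: ikernel_def s_def)
qed

text \<open>Precisely in dimension \<open>2 m + 2\<close> the two terms of order \<open>-(m + 1)\<close> cancel, and what
  remains is an approximate identity as \<open>e\<close> tends to zero.\<close>

lemma laplacian_ikernel:
  fixes y :: "'a::euclidean_space"
  assumes e: "e > 0" and dim: "DIM('a) = 2 * m + 2"
  shows "laplacian (ikernel m e) y = - (4 * real m * (real m + 1) * e * ikernel (m + 2) e y)"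
proof -
  define s where "s = y \<bullet> y + e"
  have s: "s > 0" using ikernel_base_pos[OF e] by (simp add: s_def)
  have "dderiv b (dderiv b (ikernel m e)) y =
     - (2 * real m) * inverse (s ^ (m + 1)) + 4 * real m * (real m + 1) * (y \<bullet> b)\<^sup>2 * inverse (s ^ (m + 2))"
    if b: "b \<in> Basis" for b
  proof -
    have "dderiv b (ikernel m e) = (\<lambda>y. (- (2 * real m) * (y \<bullet> b)) * ikernel (Suc m) e y)"
      by (rule ext) (simp add: dderiv_ikernel[OF e])
    moreover have "dderiv b (\<lambda>y. (- (2 * real m) * (y \<bullet> b)) * ikernel (Suc m) e y) y =
        (- (2 * real m) * (y \<bullet> b)) * dderiv b (ikernel (Suc m) e) y
        + dderiv b (\<lambda>y. - (2 * real m) * (y \<bullet> b)) y * ikernel (Suc m) e y"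
      by (rule dderiv_mult)
         (auto intro!: C_infinity_differentiable[of UNIV] C_infinity_ikernel e C_infinity_mult C_infinity_const
           C_infinity_bilinear[OF bounded_bilinear_inner] C_infinity_ident)
    moreover have "dderiv b (\<lambda>y. - (2 * real m) * (y \<bullet> b)) y = - (2 * real m) * (b \<bullet> b)"
      by (rule dderiv_eq) (auto intro!: derivative_eq_intros)
    ultimately show ?thesis using b
      by (simp add: dderiv_ikernel[OF e] ikernel_def s_def power2_eq_square algebra_simps)
  qed
  then have "laplacian (ikernel m e) y = (\<Sum>b\<in>(Basis::'a set). - (2 * real m) * inverse (s ^ (m + 1))
      + 4 * real m * (real m + 1) * inverse (s ^ (m + 2)) * (y \<bullet> b)\<^sup>2)"
    unfolding laplacian_def by (intro sum.cong) (auto simp: mult_ac)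
  also have "\<dots> = - (2 * real m * real DIM('a)) * inverse (s ^ (m + 1))
      + 4 * real m * (real m + 1) * inverse (s ^ (m + 2)) * (y \<bullet> y)"
    unfolding sum.distrib sum_distrib_left[symmetric] sum_constant
    by (simp add: power2_eq_square euclidean_inner[symmetric])
  also have "\<dots> = - (4 * real m * (real m + 1) * e * inverse (s ^ (m + 2)))"
  proof -
    define i where "i = inverse (s ^ (m + 2))"
    have 1: "inverse (s ^ (m + 1)) = s * i" using s by (simp add: i_def)
    have 2: "y \<bullet> y = s - e" by (simp add: s_def)
    have 3: "real DIM('a) = 2 * real m + 2" by (simp add: dim)
    show ?thesis unfolding i_def[symmetric] 1 2 3 by algebra
  qed
  finally show ?thesis by (simp add: ikernel_def s_def)
qed

lemma laplacian_smooth_cpt: "smooth_cpt h \<Longrightarrow> smooth_cpt (laplacian h)"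
  unfolding laplacian_def[abs_def] by (intro smooth_cpt_sum smooth_cpt_dderiv)

lemma corr_integrable_0:
  "loc_integrable k \<Longrightarrow> smooth_cpt h \<Longrightarrow> integrable lborel (\<lambda>y. k y * h y)"
  using corr_integrable[of k h 0] by simp

text \<open>For each \<open>b\<close> the difference of the two integrands is the derivative in direction \<open>b\<close> of
  \<open>p \<partial>\<^sub>b h - h \<partial>\<^sub>b p\<close>.\<close>

lemma Green_identity:
  fixes p h :: "'a::euclidean_space \<Rightarrow> real"
  assumes p: "C_infinity UNIV p" and h: "smooth_cpt h"
  shows "(\<integral>y. p y * laplacian h y \<partial>lborel) = (\<integral>y. laplacian p y * h y \<partial>lborel)"
proof -
  have hC: "C_infinity UNIV h" using h by (rule smooth_cpt_C_infinity)
  have d: "f differentiable (at x)" if "C_infinity UNIV f" for f :: "'a \<Rightarrow> real" and x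
    using that by (rule C_infinity_differentiable) simp
  have int: "integrable lborel (\<lambda>y. f y * g y)" if "C_infinity UNIV f" "smooth_cpt g" for f g :: "'a \<Rightarrow> real"
    using that by (intro corr_integrable_0 loc_integrable_continuous C_infinity_continuous_on)
  have "(\<integral>y. p y * dderiv b (dderiv b h) y \<partial>lborel) = (\<integral>y. dderiv b (dderiv b p) y * h y \<partial>lborel)" for b
  proof -
    define w where "w y = p y * dderiv b h y - dderiv b p y * h y" for y
    have "smooth_cpt w" unfolding w_def[abs_def]
      by (intro smooth_cpt_diff smooth_cpt_bilinear_right[OF bounded_bilinear_mult] p h
          smooth_cpt_dderiv C_infinity_dderiv)
    then have "(\<integral>y. dderiv b w y \<partial>lborel) = 0" by (rule integral_dderiv_eq_0)
    moreover have "dderiv b w y = p y * dderiv b (dderiv b h) y - dderiv b (dderiv b p) y * h y" for y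
      unfolding w_def[abs_def]
      by (subst dderiv_diff dderiv_mult; (intro d C_infinity_mult C_infinity_dderiv p hC)?)+ simp
    ultimately show ?thesis
      by (simp add: int p h hC smooth_cpt_dderiv C_infinity_dderiv)
  qed
  then show ?thesis
    unfolding laplacian_def sum_distrib_left sum_distrib_right
    by (simp add: int p h hC smooth_cpt_dderiv C_infinity_dderiv)
qed

text \<open>In the shell \<open>2\<^sup>k \<le> \<bar>y\<bar> < 2\<^sup>k\<^sup>+\<^sup>1\<close> the kernel is at most \<open>4\<^sup>-\<^sup>k\<^sup>(\<^sup>m\<^sup>+\<^sup>2\<^sup>)\<close>, while the volume grows
  like \<open>4\<^sup>k\<^sup>(\<^sup>m\<^sup>+\<^sup>1\<^sup>)\<close>.\<close>

lemma integrable_ikernel: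
  assumes dim: "DIM('a::euclidean_space) = 2 * m + 2"
  shows "integrable lborel (ikernel (m + 2) 1 :: 'a \<Rightarrow> real)"
proof (rule integrable_by_balls[where a="\<lambda>k. inverse ((4 ^ k) ^ (m + 2))" and r="\<lambda>k. 2 ^ Suc k"])
  show "(ikernel (m + 2) 1 :: 'a \<Rightarrow> real) \<in> borel_measurable borel"
    by (intro borel_measurable_continuous_onI C_infinity_continuous_on C_infinity_ikernel) simp
  fix y :: 'a
  show "\<exists>k. norm y < 2 ^ Suc k \<and> \<bar>ikernel (m + 2) 1 y\<bar> \<le> inverse ((4 ^ k) ^ (m + 2))"
  proof (cases "norm y < 1")
    case True
    have "(1::real) \<le> (y \<bullet> y + 1) ^ (m + 2)" by (intro one_le_power) simp
    then have "\<bar>ikernel (m + 2) 1 y\<bar> \<le> 1"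
      using le_imp_inverse_le[of 1 "(y \<bullet> y + 1) ^ (m + 2)"]
      by (simp add: ikernel_def abs_of_nonneg del: power_add_numeral power_Suc power_add)
    then show ?thesis using True by (intro exI[of _ 0]) auto
  next
    case False
    then obtain k where k: "2 ^ k \<le> norm y" "norm y < 2 ^ Suc k" using dyadic_above[of "norm y"] by auto
    have "(4::real) ^ k = (2 ^ k)\<^sup>2" by (simp add: power2_eq_square power_mult_distrib[symmetric])
    also have "\<dots> \<le> (norm y)\<^sup>2" using k(1) by (intro power_mono) auto
    also have "\<dots> \<le> y \<bullet> y + 1" by (simp add: power2_norm_eq_inner)
    finally have "(4 ^ k) ^ (m + 2) \<le> (y \<bullet> y + 1) ^ (m + 2)" by (intro power_mono) auto
    then have "ikernel (m + 2) 1 y \<le> inverse ((4 ^ k) ^ (m + 2))"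
      unfolding ikernel_def by (intro le_imp_inverse_le) auto
    moreover have "ikernel (m + 2) 1 y \<ge> 0" unfolding ikernel_def by (simp add: add_nonneg_nonneg)
    ultimately show ?thesis using k(2) by (intro exI[of _ k]) auto
  qed
next
  have "inverse ((4 ^ k) ^ (m + 2)) * (2 ^ Suc k) ^ DIM('a) = 4 ^ (m + 1) * (1/4::real) ^ k" for k :: nat
  proof -
    have "((2::real) ^ Suc k) ^ DIM('a) = (((2 ^ Suc k))\<^sup>2) ^ (m + 1)"
      unfolding dim by (simp add: power_mult[symmetric] del: power_Suc)
    also have "((2::real) ^ Suc k)\<^sup>2 = 4 * 4 ^ k"
      by (simp add: power2_eq_square power_mult_distrib[symmetric])
    finally show ?thesis by (simp add: power_mult_distrib field_simps)
  qed
  then show "summable (\<lambda>k. inverse ((4 ^ k) ^ (m + 2)) * (2 ^ Suc k) ^ DIM('a) :: real)"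
    by (simp only:) (intro summable_mult summable_geometric, simp)
qed auto

text \<open>The same comparison on the shells \<open>2\<^sup>-\<^sup>k\<^sup>-\<^sup>1 \<le> \<bar>y\<bar>/R' < 2\<^sup>-\<^sup>k\<close> around the singularity.\<close>

lemma loc_integrable_newton:
  assumes dim: "DIM('a::euclidean_space) = 2 * m + 2"
  shows "loc_integrable (ikernel m 0 :: 'a \<Rightarrow> real)"
  unfolding loc_integrable_def
proof (intro conjI allI)
  show km: "(ikernel m 0 :: 'a \<Rightarrow> real) \<in> borel_measurable borel"
    unfolding ikernel_def[abs_def] by measurable
  fix R :: real
  define R' where "R' = \<bar>R\<bar> + 1"
  have R': "R' > 0" "R < R'" by (auto simp: R'_def)
  define a where "a k = inverse (((R' * (1/2) ^ Suc k)\<^sup>2) ^ m)" for k :: nat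
  define r where "r k = R' * (1/2) ^ k" for k :: nat
  show "integrable lborel (\<lambda>y::'a. indicator (cball 0 R) y * ikernel m 0 y)"
  proof (rule integrable_by_balls[where a=a and r=r])
    fix y :: 'a assume y: "y \<noteq> 0" "indicator (cball 0 R) y * ikernel m 0 y \<noteq> 0"
    have yR: "norm y \<le> R"
    proof (rule ccontr)
      assume "\<not> norm y \<le> R"
      then show False using y(2) by simp
    qed
    then have "0 < norm y / R'" "norm y / R' < 1" using R' y by auto
    then obtain k where k: "(1/2) ^ Suc k \<le> norm y / R'" "norm y / R' < (1/2) ^ k"
      using dyadic_below by blast
    have 1: "norm y < r k" using k(2) R' by (simp add: r_def field_simps)
    have 2: "R' * (1/2) ^ Suc k \<le> norm y" using k(1) R' by (simp add: field_simps)
    have "((R' * (1/2) ^ Suc k)\<^sup>2) ^ m \<le> ((norm y)\<^sup>2) ^ m"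
      using 2 R' by (intro power_mono) auto
    then have "ikernel m 0 y \<le> a k" unfolding ikernel_def a_def
      using R' by (intro le_imp_inverse_le) (auto simp: power2_norm_eq_inner)
    moreover have "ikernel m 0 y \<ge> 0" by (simp add: ikernel_def)
    ultimately show "\<exists>k. norm y < r k \<and> \<bar>indicator (cball 0 R) y * ikernel m 0 y\<bar> \<le> a k"
      using 1 yR by (intro exI[of _ k]) auto
  next
    have "a k * r k ^ DIM('a) = (4 ^ m * R'\<^sup>2) * (1/4) ^ k" for k
    proof -
      have "a k = inverse (((r k / 2)\<^sup>2) ^ m)" by (simp add: a_def r_def)
      also have "(r k / 2)\<^sup>2 = (r k)\<^sup>2 / 4" by (simp add: power_divide)
      finally have "a k = 4 ^ m * inverse (((r k)\<^sup>2) ^ m)" 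
        unfolding power_divide[of _ _ m] inverse_divide divide_inverse[of "4 ^ m"] .
      moreover have "r k ^ DIM('a) = ((r k)\<^sup>2) ^ m * (r k)\<^sup>2"
        unfolding dim by (simp only: power_add power_mult)
      moreover have "r k > 0" using R' by (simp add: r_def)
      moreover have "c * inverse (X ^ m) * (X ^ m * X) = c * X" if "X \<noteq> 0" for c X :: real
        using that by simp
      ultimately have "a k * r k ^ DIM('a) = 4 ^ m * (r k)\<^sup>2"
        by (metis less_irrefl zero_less_power)
      also have "(r k)\<^sup>2 = R'\<^sup>2 * ((1/2)\<^sup>2) ^ k"
        unfolding r_def power_mult_distrib by (metis power_mult mult.commute)
      also have "(1/2::real)\<^sup>2 = 1/4" by (simp add: power2_eq_square)
      finally show ?thesis by (simp only: mult.assoc)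
    qed
    then show "summable (\<lambda>k. a k * r k ^ DIM('a))"
      by (simp only:) (intro summable_mult summable_geometric, simp)
  next
    show "(\<lambda>y::'a. indicator (cball 0 R) y * ikernel m 0 y) \<in> borel_measurable borel"
      by (intro borel_measurable_times borel_measurable_indicator borel_closed closed_cball km)
  qed (use R' in \<open>auto simp: a_def r_def\<close>)
qed

definition newton_const :: "'a::euclidean_space itself \<Rightarrow> nat \<Rightarrow> real" where
  "newton_const _ m = - (4 * real m * (real m + 1) * (\<integral>y. ikernel (m + 2) 1 (y::'a) \<partial>lborel))"

lemma newton_const_nonzero:
  assumes dim: "DIM('a::euclidean_space) = 2 * m + 2" and m: "m \<ge> 1"
  shows "newton_const TYPE('a) m \<noteq> 0"
proof
  assume "newton_const TYPE('a) m = 0"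
  then have 0: "(\<integral>y. ikernel (m + 2) 1 (y::'a) \<partial>lborel) = 0" using m by (simp add: newton_const_def)
  have pos: "ikernel (m + 2) 1 y > 0" for y :: 'a
    unfolding ikernel_def using ikernel_base_pos[of 1 y] by simp
  have "AE y in lborel. ikernel (m + 2) 1 (y::'a) = 0"
    using integral_nonneg_eq_0_iff_AE[OF integrable_ikernel[OF dim]] 0 pos by (simp add: less_imp_le)
  then have "AE y in (lborel :: 'a measure). False"
    using pos by (metis (mono_tags, lifting) eventually_mono less_irrefl)
  then have "emeasure lborel (space (lborel :: 'a measure)) = 0"
    unfolding eventually_False ae_filter_eq_bot_iff .
  then show False by simp
qed

text \<open>Green's identity holds for the regularised kernels; the rescaling \<open>y = \<delta> z\<close> turns its
  right side into the integral of a fixed integrable kernel against \<open>h(\<delta> z)\<close>, and both sides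
  converge as \<open>\<delta>\<close> tends to zero.\<close>

lemma newton_at_0:
  fixes h :: "'a::euclidean_space \<Rightarrow> real"
  assumes dim: "DIM('a) = 2 * m + 2" and h: "smooth_cpt h"
  shows "(\<integral>y. ikernel m 0 y * laplacian h y \<partial>lborel) = newton_const TYPE('a) m * h 0"
proof -
  define \<delta> where "\<delta> j = inverse (real (Suc j))" for j
  have \<delta>: "\<delta> j > 0" for j by (simp add: \<delta>_def)
  have \<delta>0: "\<delta> j \<noteq> 0" for j by (simp add: \<delta>_def)
  have lim\<delta>: "\<delta> \<longlonglongrightarrow> 0" unfolding \<delta>_def[abs_def] by (rule LIMSEQ_inverse_real_of_nat)
  have hm[measurable]: "h \<in> borel_measurable borel" using smooth_cpt_measurable[OF h, of 0] by simp
  have lm[measurable]: "laplacian h \<in> borel_measurable borel"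
    using smooth_cpt_measurable[OF laplacian_smooth_cpt[OF h], of 0] by simp
  have km[measurable]: "(ikernel j e :: 'a \<Rightarrow> real) \<in> borel_measurable borel" for j e
    unfolding ikernel_def[abs_def] by measurable
  have l: "(\<lambda>j. \<integral>y. ikernel m ((\<delta> j)\<^sup>2) y * laplacian h y \<partial>lborel) \<longlonglongrightarrow>
      (\<integral>y. ikernel m 0 y * laplacian h y \<partial>lborel)"
  proof (rule integral_dominated_convergence[where w="\<lambda>y. \<bar>ikernel m 0 y * laplacian h y\<bar>"])
    show "integrable lborel (\<lambda>y. \<bar>ikernel m 0 y * laplacian h y\<bar>)"
      by (intro integrable_abs corr_integrable_0 loc_integrable_newton dim laplacian_smooth_cpt h)
    have ae: "AE y in lborel. y \<noteq> (0::'a)" by (rule AE_lborel_singleton)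
    then show "AE y in lborel. (\<lambda>j. ikernel m ((\<delta> j)\<^sup>2) y * laplacian h y) \<longlonglongrightarrow> ikernel m 0 y * laplacian h y"
    proof eventually_elim
      case (elim y)
      have "(\<lambda>j. inverse ((y \<bullet> y + (\<delta> j)\<^sup>2) ^ m) * laplacian h y) \<longlonglongrightarrow> inverse ((y \<bullet> y + 0\<^sup>2) ^ m) * laplacian h y"
        by (intro tendsto_intros lim\<delta>) (use elim in auto)
      then show ?case by (simp add: ikernel_def)
    qed
    show "AE y in lborel. norm (ikernel m ((\<delta> j)\<^sup>2) y * laplacian h y) \<le> \<bar>ikernel m 0 y * laplacian h y\<bar>" for j
      using ae
    proof eventually_elim
      case (elim y)
      have "ikernel m ((\<delta> j)\<^sup>2) y \<le> ikernel m 0 y" unfolding ikernel_def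
        using elim by (intro le_imp_inverse_le power_mono) auto
      moreover have "ikernel m ((\<delta> j)\<^sup>2) y \<ge> 0" unfolding ikernel_def by (simp add: add_nonneg_nonneg)
      ultimately show ?case by (simp add: abs_mult mult_right_mono)
    qed
  qed measurable
  have eq: "(\<integral>y. ikernel m ((\<delta> j)\<^sup>2) y * laplacian h y \<partial>lborel) =
      (\<integral>z. - (4 * real m * (real m + 1)) * (ikernel (m + 2) 1 z * h (\<delta> j *\<^sub>R z)) \<partial>lborel)" for j
  proof -
    have e: "(\<delta> j)\<^sup>2 > 0" using \<delta>0[of j] by simp
    have "(\<integral>y. ikernel m ((\<delta> j)\<^sup>2) y * laplacian h y \<partial>lborel) =
        (\<integral>y. laplacian (ikernel m ((\<delta> j)\<^sup>2)) y * h y \<partial>lborel)"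
      by (rule Green_identity[OF C_infinity_ikernel[OF e] h])
    also have "\<dots> = (\<integral>y. - (4 * real m * (real m + 1)) * ((\<delta> j)\<^sup>2 * ikernel (m + 2) ((\<delta> j)\<^sup>2) y * h y) \<partial>lborel)"
      unfolding laplacian_ikernel[OF e dim] by (simp add: mult_ac)
    also have "\<dots> = \<bar>\<delta> j\<bar> ^ DIM('a) * (\<integral>z. - (4 * real m * (real m + 1)) *
        ((\<delta> j)\<^sup>2 * ikernel (m + 2) ((\<delta> j)\<^sup>2) (0 + \<delta> j *\<^sub>R z) * h (0 + \<delta> j *\<^sub>R z)) \<partial>lborel)"
      by (rule lebesgue_integral_affine[OF _ \<delta>0]) measurable
    also have "\<dots> = (\<integral>z. \<delta> j ^ DIM('a) * (- (4 * real m * (real m + 1)) *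
        ((\<delta> j)\<^sup>2 * ikernel (m + 2) ((\<delta> j)\<^sup>2) (\<delta> j *\<^sub>R z) * h (\<delta> j *\<^sub>R z))) \<partial>lborel)"
      using \<delta>[of j] by simp
    also have "\<dots> = (\<integral>z. - (4 * real m * (real m + 1)) * (ikernel (m + 2) 1 z * h (\<delta> j *\<^sub>R z)) \<partial>lborel)"
    proof (rule Bochner_Integration.integral_cong)
      fix z :: 'a
      have "\<delta> j ^ DIM('a) * (\<delta> j)\<^sup>2 = ((\<delta> j)\<^sup>2) ^ (m + 2)"
        unfolding dim by (simp add: power_mult[symmetric] power_add[symmetric])
      moreover have "ikernel (m + 2) ((\<delta> j)\<^sup>2) (\<delta> j *\<^sub>R z) = inverse (((\<delta> j)\<^sup>2) ^ (m + 2)) * ikernel (m + 2) 1 z"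
      proof -
        have "(\<delta> j *\<^sub>R z) \<bullet> (\<delta> j *\<^sub>R z) + (\<delta> j)\<^sup>2 = (\<delta> j)\<^sup>2 * (z \<bullet> z + 1)"
          by (simp add: power2_eq_square algebra_simps)
        then show ?thesis unfolding ikernel_def
          by (simp only: power_mult_distrib inverse_mult_distrib)
      qed
      moreover have "((\<delta> j)\<^sup>2) ^ (m + 2) \<noteq> 0" using \<delta>0 by simp
      ultimately have *: "\<delta> j ^ DIM('a) * (\<delta> j)\<^sup>2 * ikernel (m + 2) ((\<delta> j)\<^sup>2) (\<delta> j *\<^sub>R z) = ikernel (m + 2) 1 z"
        by (metis mult.assoc right_inverse mult_1)
      show "\<delta> j ^ DIM('a) * (- (4 * real m * (real m + 1)) *
        ((\<delta> j)\<^sup>2 * ikernel (m + 2) ((\<delta> j)\<^sup>2) (\<delta> j *\<^sub>R z) * h (\<delta> j *\<^sub>R z))) =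
        - (4 * real m * (real m + 1)) * (ikernel (m + 2) 1 z * h (\<delta> j *\<^sub>R z))"
        unfolding *[symmetric] by (simp only: mult_ac)
    qed simp
    finally show ?thesis .
  qed
  obtain B where B: "B \<ge> 0" "\<And>x. norm (h x) \<le> B" using smooth_cpt_bounded[OF h] by blast
  have r: "(\<lambda>j. \<integral>z. - (4 * real m * (real m + 1)) * (ikernel (m + 2) 1 z * h (\<delta> j *\<^sub>R z)) \<partial>lborel) \<longlonglongrightarrow>
      (\<integral>z. - (4 * real m * (real m + 1)) * (ikernel (m + 2) 1 z * h (0 *\<^sub>R z)) \<partial>(lborel :: 'a measure))"
  proof (rule integral_dominated_convergence[where w="\<lambda>z. (4 * real m * (real m + 1)) * (ikernel (m + 2) 1 z * B)"])
    show "integrable lborel (\<lambda>z::'a. (4 * real m * (real m + 1)) * (ikernel (m + 2) 1 z * B))"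
      using integrable_ikernel[OF dim] by simp
    have c: "isCont h 0" using smooth_cpt_differentiable[OF h] differentiable_imp_continuous_within by blast
    have "(\<lambda>j. h (\<delta> j *\<^sub>R z)) \<longlonglongrightarrow> h (0 *\<^sub>R z)" for z
    proof (rule isCont_tendsto_compose[where g=h])
      show "isCont h (0 *\<^sub>R z)" using c by simp
      show "(\<lambda>j. \<delta> j *\<^sub>R z) \<longlonglongrightarrow> 0 *\<^sub>R z" by (intro tendsto_intros lim\<delta>)
    qed
    then show "AE z in lborel. (\<lambda>j. - (4 * real m * (real m + 1)) * (ikernel (m + 2) 1 z * h (\<delta> j *\<^sub>R z)))
        \<longlonglongrightarrow> - (4 * real m * (real m + 1)) * (ikernel (m + 2) 1 z * h (0 *\<^sub>R z))"
      by (intro AE_I2 tendsto_mult tendsto_const)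
    have "ikernel (m + 2) 1 z \<ge> 0" for z :: 'a unfolding ikernel_def by (simp add: add_nonneg_nonneg)
    then show "AE z in lborel. norm (- (4 * real m * (real m + 1)) * (ikernel (m + 2) 1 z * h (\<delta> j *\<^sub>R z)))
        \<le> (4 * real m * (real m + 1)) * (ikernel (m + 2) 1 z * B)" for j
      using B by (intro AE_I2) (auto simp: abs_mult intro!: mult_left_mono)
  qed measurable
  from LIMSEQ_unique[OF l r[folded eq]] show ?thesis by (simp add: newton_const_def)
qed

theorem laplacian_newton_potential:
  fixes h :: "'a::euclidean_space \<Rightarrow> real"
  assumes dim: "DIM('a) = 2 * m + 2" and h: "smooth_cpt h"
  shows "corr (ikernel m 0) (laplacian h) x = newton_const TYPE('a) m * h x"
proof -
  define g where "g y = h (x + 1 *\<^sub>R y)" for y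
  have d: "f differentiable (at x)" if "C_infinity UNIV f" for f :: "'a \<Rightarrow> real" and x
    using that by (rule C_infinity_differentiable) simp
  have hC: "C_infinity UNIV h" using h by (rule smooth_cpt_C_infinity)
  have g: "smooth_cpt g"
  proof -
    obtain R where R: "\<And>x. norm x > R \<Longrightarrow> h x = 0" using h unfolding smooth_cpt_def by blast
    have "g y = 0" if "norm y > R + norm x" for y
      unfolding g_def using R[of "x + y"] that norm_triangle_ineq4[of "x + y" x] by simp
    moreover have "C_infinity UNIV g" unfolding g_def[abs_def] by (rule C_infinity_affine[OF hC]) auto
    ultimately show ?thesis unfolding smooth_cpt_def by blast
  qed
  have 1: "dderiv b g = (\<lambda>y. dderiv b h (x + 1 *\<^sub>R y))" for b
    unfolding g_def[abs_def] by (rule ext, subst dderiv_affine) (auto intro: d hC)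
  have 2: "dderiv b (dderiv b g) y = dderiv b (dderiv b h) (x + y)" for b y
    unfolding 1 by (subst dderiv_affine) (auto intro: d hC C_infinity_dderiv)
  have "corr (ikernel m 0) (laplacian h) x = (\<integral>y. ikernel m 0 y * laplacian g y \<partial>lborel)"
    unfolding corr_def laplacian_def 2 ..
  also have "\<dots> = newton_const TYPE('a) m * g 0" by (rule newton_at_0[OF dim g])
  finally show ?thesis by (simp add: g_def)
qed

text \<open>All values of the kernel that meet the support of \<open>h\<close> are taken at distance about \<open>\<bar>x\<bar>\<close>
  from the singularity.\<close>

lemma newton_potential_decay:
  fixes h :: "'a::euclidean_space \<Rightarrow> real"
  assumes dim: "DIM('a) = 2 * m + 2" and m: "m \<ge> 1" and h: "smooth_cpt h" and e: "e > 0"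
  shows "\<exists>R. \<forall>x. norm x > R \<longrightarrow> \<bar>corr (ikernel m 0) h x\<bar> < e"
proof -
  obtain B where B: "B \<ge> 0" "\<And>x. norm (h x) \<le> B" using smooth_cpt_bounded[OF h] by blast
  obtain R where R: "\<And>x. norm x > R \<Longrightarrow> h x = 0" using h unfolding smooth_cpt_def by blast
  define R0 where "R0 = max R 0"
  define V where "V = unit_ball_vol (real DIM('a)) * R0 ^ DIM('a)"
  have V: "V \<ge> 0" by (simp add: V_def R0_def)
  define T where "T = B * V / e + 1"
  have T: "T \<ge> 1" using B V e by (simp add: T_def)
  have "\<bar>corr (ikernel m 0) h x\<bar> < e" if x: "norm x > R0 + T" for x
  proof -
    have le: "\<bar>ikernel m 0 y * h (x + y)\<bar> \<le> (inverse T * B) * indicator (cball (- x) R0) y" for y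
    proof (cases "norm (x + y) > R0")
      case True
      then show ?thesis using R[of "x + y"] T B by (simp add: R0_def)
    next
      case False
      then have "norm y \<ge> T" using x norm_triangle_ineq4[of "x + y" y] by simp
      then have "T ^ 1 \<le> (norm y) ^ (2 * m)"
        using m T by (intro order_trans[OF power_increasing[of 1 "2 * m" T] power_mono]) auto
      then have "ikernel m 0 y \<le> inverse T"
        unfolding ikernel_def using T
        by (intro le_imp_inverse_le) (auto simp: power_mult power2_norm_eq_inner)
      moreover have "ikernel m 0 y \<ge> 0" by (simp add: ikernel_def)
      moreover have "y \<in> cball (- x) R0" using False by (simp add: dist_norm norm_minus_commute add.commute)
      ultimately show ?thesis using B(2)[of "x + y"] T by (auto simp: abs_mult intro!: mult_mono)
    qed
    have ii: "integrable lborel (\<lambda>y. (inverse T * B) * indicator (cball (- x) R0) y)"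
      by (intro integrable_mult_right integrable_real_indicator)
         (use emeasure_bounded_finite[OF bounded_cball[of "- x" R0]] in auto)
    have "\<bar>corr (ikernel m 0) h x\<bar> \<le> (\<integral>y. \<bar>ikernel m 0 y * h (x + y)\<bar> \<partial>lborel)"
      unfolding corr_def by (rule integral_abs_bound)
    also have "\<dots> \<le> (\<integral>y. (inverse T * B) * indicator (cball (- x) R0) y \<partial>lborel)"
      by (rule integral_mono)
         (use le ii corr_integrable[OF loc_integrable_newton[OF dim] h] in auto)
    also have "\<dots> = inverse T * B * V"
      by (simp add: V_def R0_def content_cball)
    also have "\<dots> < e" using T B V e by (simp add: T_def field_simps add_pos_nonneg)
    finally show ?thesis .
  qed
  then show ?thesis by blast
qed

section \<open>Liouville's theorem and unique continuation\<close>

lemma no_interior_max_of_pos_second_derivative: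
  fixes \<phi> \<phi>' :: "real \<Rightarrow> real"
  assumes d1: "\<And>t. (\<phi> has_real_derivative \<phi>' t) (at t)"
    and d2: "(\<phi>' has_real_derivative D) (at 0)" and D: "D > 0"
    and r: "r > 0" and mx: "\<And>t. \<bar>t\<bar> < r \<Longrightarrow> \<phi> t \<le> \<phi> 0"
  shows False
proof -
  have 0: "\<phi>' 0 = 0"
    by (rule DERIV_local_max[OF d1 r]) (use mx in auto)
  obtain d where d: "d > 0" "\<And>h. 0 < h \<Longrightarrow> h < d \<Longrightarrow> \<phi>' 0 < \<phi>' (0 + h)"
    using DERIV_pos_inc_right[OF d2 D] by blast
  define h where "h = min d r / 2"
  have h: "0 < h" "h < d" "h < r" using d(1) r by (auto simp: h_def)
  obtain s where s: "0 < s" "s < h" "\<phi> h - \<phi> 0 = (h - 0) * \<phi>' s"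
    using MVT2[OF h(1), of \<phi> \<phi>'] d1 by blast
  have "\<phi>' s > 0" using d(2)[of s] s h 0 by simp
  then have "h * \<phi>' s > 0" using h by simp
  then have "\<phi> h > \<phi> 0" using s(3) by simp
  then show False using mx[of h] h by simp
qed

text \<open>At a positive value \<open>w p\<close>, the function \<open>w + \<delta>\<bar>x\<bar>\<^sup>2\<close> with small \<open>\<delta>\<close> attains its maximum
  over a large ball in the interior, although its Laplacian is positive. Only derivatives along
  coordinate lines are mentioned, so that the lemma applies to restrictions to affine
  subspaces.\<close>

lemma decaying_harmonic_nonpos:
  fixes w :: "'a::euclidean_space \<Rightarrow> real"
  assumes cont: "continuous_on UNIV w"
    and decay: "\<And>e. e > 0 \<Longrightarrow> \<exists>R. \<forall>x. norm x > R \<longrightarrow> \<bar>w x\<bar> < e"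
    and d1: "\<And>x b t. b \<in> Basis \<Longrightarrow> ((\<lambda>t. w (x + t *\<^sub>R b)) has_real_derivative wd b (x + t *\<^sub>R b)) (at t)"
    and d2: "\<And>x b t. b \<in> Basis \<Longrightarrow> ((\<lambda>t. wd b (x + t *\<^sub>R b)) has_real_derivative wdd b (x + t *\<^sub>R b)) (at t)"
    and harm: "\<And>x. (\<Sum>b\<in>Basis. wdd b x) = 0"
  shows "w p \<le> 0"
proof (rule ccontr)
  assume "\<not> w p \<le> 0"
  then have wp: "w p > 0" by simp
  obtain R0 where R0: "\<And>x. norm x > R0 \<Longrightarrow> \<bar>w x\<bar> < w p / 2"
    using decay[of "w p / 2"] wp by auto
  \<comment> \<open>Outside the ball of radius \<open>R\<close> the values are at most \<open>w p / 2\<close>, and \<open>\<delta> R\<^sup>2 = w p / 4\<close> is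
    too small to make up the difference.\<close>
  define R where "R = max (R0 + 1) (norm p + 1)"
  have R: "R > 0" "R > R0" "norm p < R" by (auto simp: R_def add_nonneg_pos less_max_iff_disj)
  define \<delta> where "\<delta> = w p / (4 * R\<^sup>2)"
  have \<delta>: "\<delta> > 0" using wp R by (simp add: \<delta>_def)
  define u where "u x = w x + \<delta> * (x \<bullet> x)" for x
  have "continuous_on (cball 0 R) u" unfolding u_def[abs_def]
    by (intro continuous_intros continuous_on_subset[OF cont]) auto
  then obtain x0 where x0: "x0 \<in> cball 0 R" "\<And>x. x \<in> cball 0 R \<Longrightarrow> u x \<le> u x0"
    using continuous_attains_sup[OF compact_cball, of 0 R u] R by auto
  have "u p \<ge> w p" using \<delta> by (simp add: u_def)
  then have big: "u x0 \<ge> w p" using x0(2)[of p] R by simp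
  have int: "norm x0 < R"
  proof (rule ccontr)
    assume "\<not> norm x0 < R"
    then have n: "norm x0 = R" using x0(1) by simp
    then have "w x0 < w p / 2" using R0[of x0] R by auto
    moreover have "\<delta> * (x0 \<bullet> x0) = w p / 4" using n R by (simp add: \<delta>_def power2_norm_eq_inner[symmetric])
    ultimately show False using big wp by (simp add: u_def)
  qed
  have "\<exists>b\<in>Basis. wdd b x0 + 2 * \<delta> > 0"
  proof (rule ccontr)
    assume "\<not> ?thesis"
    then have "(\<Sum>b\<in>(Basis::'a set). wdd b x0 + 2 * \<delta>) \<le> 0" by (intro sum_nonpos) auto
    then have "2 * \<delta> * real DIM('a) \<le> 0" using harm[of x0] by (simp add: sum.distrib)
    then show False using \<delta> by (simp add: mult_le_0_iff)
  qed
  then obtain b where b: "b \<in> Basis" "wdd b x0 + 2 * \<delta> > 0" by blast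
  have uline: "u (x0 + t *\<^sub>R b) = w (x0 + t *\<^sub>R b) + \<delta> * (x0 \<bullet> x0 + 2 * t * (x0 \<bullet> b) + t * t)" for t
    using b(1) by (simp add: u_def algebra_simps inner_commute inner_Basis)
  show False
  proof (rule no_interior_max_of_pos_second_derivative[where \<phi>="\<lambda>t. u (x0 + t *\<^sub>R b)"
        and \<phi>'="\<lambda>t. wd b (x0 + t *\<^sub>R b) + \<delta> * (2 * (x0 \<bullet> b) + 2 * t)" and D="wdd b x0 + 2 * \<delta>" and r="R - norm x0"])
    show "((\<lambda>t. u (x0 + t *\<^sub>R b)) has_real_derivative wd b (x0 + t *\<^sub>R b) + \<delta> * (2 * (x0 \<bullet> b) + 2 * t)) (at t)" for t
      unfolding uline
      by (intro DERIV_add d1[OF b(1)]) (auto intro!: derivative_eq_intros simp: algebra_simps)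
    have "((\<lambda>t. \<delta> * (2 * (x0 \<bullet> b) + 2 * t)) has_real_derivative 2 * \<delta>) (at 0)"
      by (auto intro!: derivative_eq_intros)
    from DERIV_add[OF d2[OF b(1), of x0 0] this]
    show "((\<lambda>t. wd b (x0 + t *\<^sub>R b) + \<delta> * (2 * (x0 \<bullet> b) + 2 * t)) has_real_derivative wdd b x0 + 2 * \<delta>) (at 0)"
      by simp
    show "u (x0 + t *\<^sub>R b) \<le> u (x0 + 0 *\<^sub>R b)" if "\<bar>t\<bar> < R - norm x0" for t
    proof -
      have "norm (x0 + t *\<^sub>R b) \<le> norm x0 + \<bar>t\<bar>"
        using norm_triangle_ineq[of x0 "t *\<^sub>R b"] b(1) by simp
      then show ?thesis using that by (simp add: x0(2))
    qed
  qed (use b int in auto)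
qed

lemma decaying_harmonic_zero:
  fixes w :: "'a::euclidean_space \<Rightarrow> real"
  assumes cont: "continuous_on UNIV w"
    and decay: "\<And>e. e > 0 \<Longrightarrow> \<exists>R. \<forall>x. norm x > R \<longrightarrow> \<bar>w x\<bar> < e"
    and d1: "\<And>x b t. b \<in> Basis \<Longrightarrow> ((\<lambda>t. w (x + t *\<^sub>R b)) has_real_derivative wd b (x + t *\<^sub>R b)) (at t)"
    and d2: "\<And>x b t. b \<in> Basis \<Longrightarrow> ((\<lambda>t. wd b (x + t *\<^sub>R b)) has_real_derivative wdd b (x + t *\<^sub>R b)) (at t)"
    and harm: "\<And>x. (\<Sum>b\<in>Basis. wdd b x) = 0"
  shows "w p = 0"
proof (rule antisym)
  show "w p \<le> 0" by (rule decaying_harmonic_nonpos[OF cont decay d1 d2 harm])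
  have "- w p \<le> 0"
    by (rule decaying_harmonic_nonpos[of "\<lambda>x. - w x" "\<lambda>b x. - wd b x" "\<lambda>b x. - wdd b x"])
       (use decay in \<open>auto intro!: continuous_on_minus cont DERIV_minus d1 d2 simp: sum_negf harm\<close>)
  then show "0 \<le> w p" by simp
qed

text \<open>The polynomial \<open>t \<mapsto> \<bar>w - t v\<bar>\<^sup>2\<close> with a complex argument.\<close>

definition cquad :: "'a::euclidean_space \<Rightarrow> 'a \<Rightarrow> complex \<Rightarrow> complex" where
  "cquad w v \<zeta> = of_real (w \<bullet> w) - 2 * \<zeta> * of_real (w \<bullet> v) + \<zeta>\<^sup>2 * of_real (v \<bullet> v)"

lemma cquad_of_real: "cquad w v (of_real t) = of_real ((w - t *\<^sub>R v) \<bullet> (w - t *\<^sub>R v))"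
  by (simp add: cquad_def power2_eq_square algebra_simps inner_commute)

text \<open>The two roots are complex conjugate by the Cauchy-Schwarz inequality and their product is
  \<open>\<bar>w\<bar>\<^sup>2/\<bar>v\<bar>\<^sup>2\<close>, so both have modulus \<open>\<bar>w\<bar>/\<bar>v\<bar>\<close>.\<close>

lemma cquad_nonzero:
  assumes "norm w > norm v * cmod \<zeta>"
  shows "cquad w v \<zeta> \<noteq> 0"
proof
  assume 0: "cquad w v \<zeta> = 0"
  define a b where "a = Re \<zeta>" and "b = Im \<zeta>"
  have re: "w \<bullet> w - 2 * a * (w \<bullet> v) + (a\<^sup>2 - b\<^sup>2) * (v \<bullet> v) = 0"
    using arg_cong[OF 0, of Re] by (simp add: cquad_def a_def b_def power2_eq_square)
  have im: "2 * b * (a * (v \<bullet> v) - w \<bullet> v) = 0"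
    using arg_cong[OF 0, of Im] by (simp add: cquad_def a_def b_def power2_eq_square algebra_simps)
  have "w \<bullet> w = (a\<^sup>2 + b\<^sup>2) * (v \<bullet> v)"
  proof (cases "b = 0")
    case False
    then have "w \<bullet> v = a * (v \<bullet> v)" using im by simp
    then show ?thesis using re by (simp add: power2_eq_square algebra_simps)
  next
    case True
    then have "(w - a *\<^sub>R v) \<bullet> (w - a *\<^sub>R v) = 0"
      using re by (simp add: power2_eq_square algebra_simps inner_commute)
    then have "w = a *\<^sub>R v" by simp
    then show ?thesis using True by (simp add: power2_eq_square)
  qed
  then have "(norm w)\<^sup>2 = (norm v * cmod \<zeta>)\<^sup>2"
    unfolding power_mult_distrib power2_norm_eq_inner[of w] power2_norm_eq_inner[of v] cmod_power2
    by (simp add: a_def b_def mult.commute)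
  moreover have "(norm v * cmod \<zeta>)\<^sup>2 < (norm w)\<^sup>2"
    using assms by (intro power_strict_mono) auto
  ultimately show False by simp
qed

text \<open>Along a segment from the centre of a source-free ball, the potential is the restriction of
  a holomorphic function of one complex variable: in even dimension the kernel is an inverse
  power of a quadratic polynomial that has no zeros in the relevant disc.\<close>

lemma newton_potential_continuation:
  fixes h :: "'a::euclidean_space \<Rightarrow> real"
  assumes dim: "DIM('a) = 2 * m + 2" and h: "smooth_cpt h"
    and hq: "\<And>z. z \<in> ball q d \<Longrightarrow> h z = 0"
    and \<eta>: "\<eta> > 0" and zero: "\<And>x. x \<in> ball q \<eta> \<Longrightarrow> corr (ikernel m 0) h x = 0"
    and x: "x \<in> ball q d"
  shows "corr (ikernel m 0) h x = 0"
proof (cases "x = q")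
  case True
  then show ?thesis using zero \<eta> by simp
next
  case False
  define v where "v = x - q"
  have v: "norm v > 0" "norm v < d" using False x by (auto simp: v_def dist_norm norm_minus_commute)
  define \<rho> where "\<rho> = d / norm v"
  have \<rho>: "\<rho> > 1" using v by (simp add: \<rho>_def)
  have vr: "norm v * cmod \<zeta> < d" if "\<zeta> \<in> ball 0 \<rho>" for \<zeta>
    using that v by (simp add: \<rho>_def field_simps)
  have hC: "continuous_on UNIV h" using h by (simp add: smooth_cpt_def C_infinity_continuous_on)
  obtain R where R: "\<And>z. norm z > R \<Longrightarrow> h z = 0" using h unfolding smooth_cpt_def by blast
  obtain a b where ab: "cball 0 R \<subseteq> cbox a (b::'a)"
    using bounded_subset_cbox_symmetric[OF bounded_cball] by metis
  have hab: "h z = 0" if "z \<notin> cbox a b" for z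
  proof -
    have "z \<notin> cball 0 R" using ab that by blast
    then show ?thesis using R by simp
  qed
  define F where "F \<zeta> z = of_real (h z) * inverse (cquad (z - q) v \<zeta> ^ m)" for \<zeta> z
  define F' where "F' \<zeta> z = of_real (h z) * (- (of_nat m * (- 2 * of_real ((z - q) \<bullet> v) + 2 * \<zeta> * of_real (v \<bullet> v)))
      * inverse (cquad (z - q) v \<zeta> ^ Suc m))" for \<zeta> z
  have nz: "cquad (z - q) v \<zeta> \<noteq> 0" if "\<zeta> \<in> ball 0 \<rho>" "z \<notin> ball q d" for \<zeta> z
    by (rule cquad_nonzero) (use vr[OF that(1)] that(2) in \<open>simp add: dist_norm norm_minus_commute\<close>)
  have der: "((\<lambda>\<zeta>. F \<zeta> z) has_field_derivative F' \<zeta> z) (at \<zeta> within ball 0 \<rho>)" if "\<zeta> \<in> ball 0 \<rho>" for \<zeta> z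
  proof (cases "z \<in> ball q d")
    case True
    then show ?thesis using hq by (simp add: F_def F'_def)
  next
    case False
    define s where "s = cquad (z - q) v \<zeta>"
    have s: "s \<noteq> 0" using nz[OF that False] by (simp add: s_def)
    have 1: "((\<lambda>\<zeta>. cquad (z - q) v \<zeta>) has_field_derivative
        - 2 * of_real ((z - q) \<bullet> v) + 2 * \<zeta> * of_real (v \<bullet> v)) (at \<zeta> within ball 0 \<rho>)"
      unfolding cquad_def by (auto intro!: derivative_eq_intros)
    have "((\<lambda>\<zeta>. cquad (z - q) v \<zeta> ^ m) has_field_derivative
        of_nat m * s ^ (m - 1) * (- 2 * of_real ((z - q) \<bullet> v) + 2 * \<zeta> * of_real (v \<bullet> v))) (at \<zeta> within ball 0 \<rho>)"
      using DERIV_power[OF 1, of m] by (simp add: s_def mult_ac)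
    then have "((\<lambda>\<zeta>. inverse (cquad (z - q) v \<zeta> ^ m)) has_field_derivative
        - (of_nat m * s ^ (m - 1) * (- 2 * of_real ((z - q) \<bullet> v) + 2 * \<zeta> * of_real (v \<bullet> v))
           * inverse ((s ^ m) ^ Suc (Suc 0)))) (at \<zeta> within ball 0 \<rho>)"
      using s unfolding s_def by (intro DERIV_inverse_fun) auto
    moreover have "of_nat m * s ^ (m - 1) * c * inverse ((s ^ m) ^ Suc (Suc 0)) = of_nat m * c * inverse (s ^ Suc m)" for c
      using s by (cases m) (simp_all add: field_simps)
    ultimately have "((\<lambda>\<zeta>. inverse (cquad (z - q) v \<zeta> ^ m)) has_field_derivative
        - (of_nat m * (- 2 * of_real ((z - q) \<bullet> v) + 2 * \<zeta> * of_real (v \<bullet> v)) * inverse (s ^ Suc m)))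
        (at \<zeta> within ball 0 \<rho>)" by (simp only:)
    from DERIV_cmult[OF this, of "of_real (h z)"] show ?thesis
      by (simp add: F_def F'_def s_def)
  qed
  have cont: "continuous_on (ball 0 \<rho> \<times> cbox a b) (\<lambda>(\<zeta>, z). of_real (h z) * (c \<zeta> z * inverse (cquad (z - q) v \<zeta> ^ k)))"
    if c: "continuous_on UNIV (\<lambda>(\<zeta>, z). c \<zeta> z)" for k and c :: "complex \<Rightarrow> 'a \<Rightarrow> complex"
  proof -
    let ?f = "\<lambda>p::complex \<times> 'a. of_real (h (snd p)) * (c (fst p) (snd p) * inverse (cquad (snd p - q) v (fst p) ^ k))"
    \<comment> \<open>The integrand is continuous on two open sets that cover the product: where the quadratic
      polynomial has no zero, and where the source vanishes.\<close>
    define A where "A = {p::complex \<times> 'a. norm v * cmod (fst p) < norm (snd p - q)}"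
    define B where "B = {p::complex \<times> 'a. norm (snd p - q) < d}"
    have "open A" "open B" unfolding A_def B_def by (intro open_Collect_less continuous_intros)+
    moreover have "continuous_on A ?f"
    proof -
      have "continuous_on A (\<lambda>p. c (fst p) (snd p))"
        using continuous_on_subset[OF c, of A] by (simp add: case_prod_beta')
      then show ?thesis
        unfolding cquad_def
        by (intro continuous_intros continuous_on_compose2[OF hC])
           (auto simp: A_def cquad_def[symmetric] dest: cquad_nonzero)
    qed
    moreover have "continuous_on B ?f"
    proof -
      have "h (snd p) = 0" if "p \<in> B" for p
        using that hq by (simp add: B_def dist_norm norm_minus_commute)
      then show ?thesis using continuous_on_cong[of B B ?f "\<lambda>_. 0"] by simp
    qed
    ultimately have "continuous_on (A \<union> B) ?f" by (rule continuous_on_open_Un)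
    moreover have "ball 0 \<rho> \<times> cbox a b \<subseteq> A \<union> B"
    proof
      fix p :: "complex \<times> 'a" assume "p \<in> ball 0 \<rho> \<times> cbox a b"
      then have "norm v * cmod (fst p) < d" using vr by auto
      then show "p \<in> A \<union> B" by (auto simp: A_def B_def)
    qed
    ultimately show ?thesis by (simp add: case_prod_beta' continuous_on_subset)
  qed
  have contF': "continuous_on (ball 0 \<rho> \<times> cbox a b) (\<lambda>(\<zeta>, z). F' \<zeta> z)"
    unfolding F'_def
    by (rule cont) (auto intro!: continuous_intros simp: case_prod_beta')
  have contF: "continuous_on (ball 0 \<rho> \<times> cbox a b) (\<lambda>(\<zeta>, z). F \<zeta> z)"
    using cont[of "\<lambda>_ _. 1" m] by (simp add: F_def case_prod_beta')
  have int: "F \<zeta> integrable_on cbox a b" if "\<zeta> \<in> ball 0 \<rho>" for \<zeta>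
  proof (rule integrable_continuous)
    have "continuous_on (cbox a b) (\<lambda>z. (\<lambda>(\<zeta>, z). F \<zeta> z) (\<zeta>, z))"
      by (rule continuous_on_compose2[OF contF]) (use that in \<open>auto intro!: continuous_intros\<close>)
    then show "continuous_on (cbox a b) (F \<zeta>)" by simp
  qed
  define \<Phi> where "\<Phi> \<zeta> = integral (cbox a b) (F \<zeta>)" for \<zeta>
  have hol: "\<Phi> holomorphic_on ball 0 \<rho>"
    unfolding \<Phi>_def[abs_def]
    by (rule leibniz_rule_holomorphic[OF der int contF']) auto
  have real: "\<Phi> (of_real t) = of_real (corr (ikernel m 0) h (q + t *\<^sub>R v))" if "\<bar>t\<bar> < \<rho>" for t
  proof -
    have tin: "of_real t \<in> ball (0::complex) \<rho>" using that by simp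
    define G where "G z = ikernel m 0 (z - (q + t *\<^sub>R v)) * h z" for z
    have FG: "F (of_real t) z = of_real (G z)" for z
    proof -
      have "cquad (z - q) v (of_real t) = of_real ((z - (q + t *\<^sub>R v)) \<bullet> (z - (q + t *\<^sub>R v)))"
        unfolding cquad_of_real by (simp add: algebra_simps)
      then show ?thesis unfolding F_def G_def ikernel_def by simp
    qed
    have [measurable]: "h \<in> borel_measurable borel" by (rule borel_measurable_continuous_onI[OF hC])
    have m1[measurable]: "(\<lambda>y. ikernel m 0 y * h (q + t *\<^sub>R v + y)) \<in> borel_measurable borel"
      unfolding ikernel_def[abs_def] by measurable
    have "corr (ikernel m 0) h (q + t *\<^sub>R v) =
        \<bar>1\<bar> ^ DIM('a) * (\<integral>z. ikernel m 0 (- (q + t *\<^sub>R v) + 1 *\<^sub>R z) * h (q + t *\<^sub>R v + (- (q + t *\<^sub>R v) + 1 *\<^sub>R z)) \<partial>lborel)"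
      unfolding corr_def by (rule lebesgue_integral_affine[OF m1]) simp
    also have "\<dots> = (\<integral>z. G z \<partial>lborel)" by (simp add: G_def algebra_simps)
    finally have c: "corr (ikernel m 0) h (q + t *\<^sub>R v) = (\<integral>z. G z \<partial>lborel)" .
    have "integrable lborel (\<lambda>z. ikernel m 0 (- (q + t *\<^sub>R v) + 1 *\<^sub>R z) * h (q + t *\<^sub>R v + (- (q + t *\<^sub>R v) + 1 *\<^sub>R z)))"
      by (rule lebesgue_integrable_affine[OF m1 _ corr_integrable[OF loc_integrable_newton[OF dim] h]]) simp
    then have "integrable lborel G" by (simp add: G_def[abs_def] algebra_simps)
    then have "(G has_integral (\<integral>z. G z \<partial>lborel)) UNIV" by (rule has_integral_integral_lborel)
    moreover have "G = (\<lambda>z. if z \<in> cbox a b then G z else 0)" using hab by (auto simp: G_def)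
    ultimately have "(G has_integral (\<integral>z. G z \<partial>lborel)) (cbox a b)"
      using has_integral_restrict_UNIV by metis
    then have "((\<lambda>z. of_real (G z)) has_integral (of_real (\<integral>z. G z \<partial>lborel) :: complex)) (cbox a b)"
      using has_integral_linear[OF _ bounded_linear_of_real] by (simp add: o_def)
    moreover have "F (of_real t) = (\<lambda>z. of_real (G z))" by (rule ext) (rule FG)
    ultimately show ?thesis unfolding \<Phi>_def c by (simp add: integral_unique)
  qed
  \<comment> \<open>On real \<open>t\<close> near zero the potential vanishes by assumption; these points accumulate at
    zero.\<close>
  define \<tau> where "\<tau> = min 1 (\<eta> / norm v)"
  have \<tau>: "0 < \<tau>" "\<tau> \<le> 1" "\<tau> * norm v \<le> \<eta>" using v \<eta> by (auto simp: \<tau>_def min_mult_distrib_right)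
  have "\<Phi> 1 = 0"
  proof (rule analytic_continuation[OF hol, where U="of_real ` {0<..<\<tau>}" and \<xi>=0])
    show "of_real ` {0<..<\<tau>} \<subseteq> ball (0::complex) \<rho>" using \<tau> \<rho> by auto
    show "(0::complex) islimpt of_real ` {0<..<\<tau>}"
      unfolding islimpt_approachable
    proof (intro allI impI)
      fix e :: real assume e: "e > 0"
      define t where "t = min e \<tau> / 2"
      have "0 < t" "t < e" "t < \<tau>" using e \<tau> by (auto simp: t_def)
      then show "\<exists>x'\<in>of_real ` {0<..<\<tau>}. x' \<noteq> (0::complex) \<and> dist x' 0 < e"
        by (intro bexI[of _ "of_real t"]) auto
    qed
    fix z :: complex assume "z \<in> of_real ` {0<..<\<tau>}"
    then obtain t where t: "z = of_real t" "0 < t" "t < \<tau>" by auto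
    have "t * norm v < \<tau> * norm v" using t(3) v(1) by (rule mult_strict_right_mono)
    then have "norm (t *\<^sub>R v) < \<eta>" using \<tau>(3) t(2) by simp
    then have "corr (ikernel m 0) h (q + t *\<^sub>R v) = 0"
      by (intro zero) (simp add: dist_norm)
    then show "\<Phi> z = 0" using real[of t] t \<tau> \<rho> by simp
  qed (use \<rho> in auto)
  then show ?thesis using real[of 1] \<rho> by (simp add: v_def)
qed

text \<open>The interior of the zero set is open, and it is relatively closed by continuation inside
  balls.\<close>

lemma newton_potential_unique_continuation:
  fixes h :: "'a::euclidean_space \<Rightarrow> real"
  assumes dim: "DIM('a) = 2 * m + 2" and h: "smooth_cpt h"
    and D: "open D" "connected D" and hD: "\<And>z. z \<in> D \<Longrightarrow> h z = 0"
    and N: "open N" "N \<subseteq> D" "N \<noteq> {}" and zero: "\<And>x. x \<in> N \<Longrightarrow> corr (ikernel m 0) h x = 0"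
    and x: "x \<in> D"
  shows "corr (ikernel m 0) h x = 0"
proof -
  define u where "u = corr (ikernel m 0) h"
  define Z where "Z = {p\<in>D. \<exists>r>0. \<forall>y\<in>ball p r. u y = 0}"
  have spread: "p \<in> Z" if "ball q d \<subseteq> D" "q \<in> Z" "p \<in> ball q d" for p q d
  proof -
    obtain r where r: "r > 0" "\<forall>y\<in>ball q r. u y = 0" using \<open>q \<in> Z\<close> by (auto simp: Z_def)
    have hq: "h z = 0" if "z \<in> ball q d" for z
      using hD \<open>ball q d \<subseteq> D\<close> that by blast
    have z: "u y = 0" if "y \<in> ball q d" for y
      unfolding u_def
      by (rule newton_potential_continuation[OF dim h hq r(1) _ that]) (use r(2) u_def in simp_all)
    obtain e where "e > 0" "ball p e \<subseteq> ball q d"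
      using \<open>p \<in> ball q d\<close> open_ball[of q d] unfolding open_contains_ball by blast
    moreover have "p \<in> D" using \<open>ball q d \<subseteq> D\<close> \<open>p \<in> ball q d\<close> by blast
    ultimately show ?thesis using z unfolding Z_def mem_Collect_eq by (intro conjI exI[of _ e]) auto
  qed
  have oZ: "open Z"
    unfolding open_contains_ball
  proof
    fix p assume p: "p \<in> Z"
    then obtain e where "e > 0" "ball p e \<subseteq> D" using D(1) unfolding Z_def by (auto elim: openE)
    then show "\<exists>e>0. ball p e \<subseteq> Z" using spread[OF _ p] by blast
  qed
  have oC: "open (D - Z)"
    unfolding open_contains_ball
  proof
    fix p assume p: "p \<in> D - Z"
    then obtain e where e: "e > 0" "ball p e \<subseteq> D" using D(1) by (auto elim: openE)
    have "q \<notin> Z" if q: "q \<in> ball p (e / 2)" for q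
    proof
      assume "q \<in> Z"
      have "ball q (e / 2) \<subseteq> D"
      proof
        fix y assume "y \<in> ball q (e / 2)"
        then have "dist p y < e" using q dist_triangle[of p y q] by simp
        then show "y \<in> D" using e by auto
      qed
      then have "p \<in> Z" using spread[OF _ \<open>q \<in> Z\<close>] q by (simp add: dist_commute)
      then show False using p by simp
    qed
    moreover have "ball p (e / 2) \<subseteq> D" using e by (auto simp: subset_iff)
    ultimately show "\<exists>e>0. ball p e \<subseteq> D - Z" using e(1) by (intro exI[of _ "e / 2"]) auto
  qed
  have "N \<subseteq> Z"
  proof
    fix p assume p: "p \<in> N"
    then obtain r where "r > 0" "ball p r \<subseteq> N" using N(1) by (auto elim: openE)
    then show "p \<in> Z" using p N(2) zero unfolding Z_def u_def by blast
  qed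
  then have "Z \<inter> D \<noteq> {}" using N by blast
  then have "(D - Z) \<inter> D = {}"
    using D(2) oZ oC unfolding connected_def by blast
  then have "x \<in> Z" using x by blast
  then obtain r where r: "r > 0" "\<forall>y\<in>ball x r. u y = 0" by (auto simp: Z_def)
  then have "u x = 0" using centre_in_ball[of x r] by blast
  then show ?thesis by (simp add: u_def)
qed

section \<open>Exact pairs of constant-coefficient operators\<close>

text \<open>\<open>M\<close> is the symmetric bilinear form of the symbol of a second-order operator \<open>hess\<close>, and
  \<open>N\<close> the symbol of a first-order operator \<open>compat\<close> that annihilates its range. The last
  assumption exhibits exactness: \<open>N x v = 0\<close> forces \<open>v\<close> to be a multiple of \<open>M x x\<close>.\<close>

locale symbol_complex =
  fixes M :: "'a::euclidean_space \<Rightarrow> 'a \<Rightarrow> 'v::euclidean_space"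
    and N :: "'a \<Rightarrow> 'v \<Rightarrow> 'w::euclidean_space"
    and P :: "'a \<Rightarrow> 'w \<Rightarrow> 'v"
    and tr :: "'v \<Rightarrow> real"
  assumes bilinear_M: "bounded_bilinear M" and bilinear_N: "bounded_bilinear N"
    and bilinear_P: "bounded_bilinear P" and linear_tr: "bounded_linear tr"
    and M_sym: "M x y = M y x"
    and N_M: "N x (M x x) = 0"
    and exact: "(x \<bullet> x) *\<^sub>R v = tr v *\<^sub>R M x x + P x (N x v)"
begin

definition hess :: "('a \<Rightarrow> real) \<Rightarrow> 'a \<Rightarrow> 'v" where
  "hess f x = (\<Sum>b\<in>Basis. \<Sum>c\<in>Basis. dderiv b (dderiv c f) x *\<^sub>R M b c)"

definition compat :: "('a \<Rightarrow> 'v) \<Rightarrow> 'a \<Rightarrow> 'w" where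
  "compat u x = (\<Sum>b\<in>Basis. N b (dderiv b u x))"

text \<open>Polarisation of the cubic identity \<open>N x (M x x) = 0\<close>.\<close>

lemma N_M_cyclic: "N a (M b c) + N b (M c a) + N c (M a b) = 0"
proof -
  have "(N a (M b c) + N b (M c a) + N c (M a b)) \<bullet> w = 0" for w
  proof -
    define q where "q a b c = N a (M b c) \<bullet> w" for a b c
    have add: "q (a + a') b c = q a b c + q a' b c" "q a (b + b') c = q a b c + q a b' c"
      "q a b (c + c') = q a b c + q a b c'" for a a' b b' c c'
      unfolding q_def bounded_bilinear.add_left[OF bilinear_M] bounded_bilinear.add_right[OF bilinear_M]
        bounded_bilinear.add_left[OF bilinear_N] bounded_bilinear.add_right[OF bilinear_N] inner_add_left
      by auto
    have sym: "q a b c = q a c b" for a b c unfolding q_def using M_sym[of b c] by simp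
    have z: "q x x x = 0" for x by (simp add: q_def N_M)
    have "q a b c + q b c a + q c a b = 0"
      using z[of "a + b + c"] z[of "a + b"] z[of "b + c"] z[of "a + c"] z[of a] z[of b] z[of c]
      unfolding add
      using sym[of a b c] sym[of b c a] sym[of c a b] by linarith
    then show ?thesis by (simp add: q_def inner_add_left)
  qed
  then show ?thesis using inner_eq_zero_iff by blast
qed

text \<open>Third derivatives are symmetric, so in the triple sum the coefficient \<open>N a (M b c)\<close> may be
  averaged over the cyclic permutations.\<close>

lemma compat_hess:
  assumes f: "C_infinity W f" and x: "x \<in> W"
  shows "compat (hess f) x = 0"
proof -
  have op: "open W" using f by (rule C_infinity_open)
  define t where "t a b c = dderiv a (dderiv b (dderiv c f)) x" for a b c
  have d: "dderiv b (dderiv c f) differentiable (at x)" for b c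
    by (rule C_infinity_differentiable[OF C_infinity_dderiv[OF C_infinity_dderiv[OF f]] x])
  have t1: "t a b c = t b a c" for a b c
    unfolding t_def by (rule dderiv_commute[OF C_infinity_dderiv[OF f] x])
  have t2: "t a b c = t a c b" for a b c
    unfolding t_def by (rule dderiv_cong[OF op x]) (rule dderiv_commute[OF f])
  have dh: "dderiv a (hess f) x = (\<Sum>b\<in>Basis. \<Sum>c\<in>Basis. t a b c *\<^sub>R M b c)" for a
  proof -
    have "dderiv a (hess f) x = (\<Sum>b\<in>Basis. dderiv a (\<lambda>x. \<Sum>c\<in>Basis. dderiv b (dderiv c f) x *\<^sub>R M b c) x)"
      unfolding hess_def[abs_def]
      by (rule dderiv_sum) (intro differentiable_sum finite_Basis ballI
          differentiable_scaleR d differentiable_const)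
    also have "\<dots> = (\<Sum>b\<in>Basis. \<Sum>c\<in>Basis. dderiv a (\<lambda>x. dderiv b (dderiv c f) x *\<^sub>R M b c) x)"
      by (intro sum.cong refl dderiv_sum differentiable_scaleR d differentiable_const)
    also have "\<dots> = (\<Sum>b\<in>Basis. \<Sum>c\<in>Basis. t a b c *\<^sub>R M b c)"
      unfolding t_def by (intro sum.cong refl dderiv_linear[OF bounded_linear_scaleR_left] d)
    finally show ?thesis .
  qed
  define A where "A = (\<Sum>a\<in>Basis. \<Sum>b\<in>Basis. \<Sum>c\<in>Basis. t a b c *\<^sub>R N a (M b c))"
  have cA: "compat (hess f) x = A"
    unfolding compat_def dh A_def
    by (simp add: bounded_bilinear.sum_right[OF bilinear_N] bounded_bilinear.scaleR_right[OF bilinear_N])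
  have B: "(\<Sum>a\<in>Basis. \<Sum>b\<in>Basis. \<Sum>c\<in>Basis. t a b c *\<^sub>R N b (M c a)) = A"
  proof -
    have "(\<Sum>a\<in>Basis. \<Sum>b\<in>Basis. \<Sum>c\<in>Basis. t a b c *\<^sub>R N b (M c a)) =
       (\<Sum>a\<in>Basis. \<Sum>b\<in>Basis. \<Sum>c\<in>Basis. t b c a *\<^sub>R N b (M c a))"
      by (intro sum.cong refl) (metis t1 t2)
    also have "\<dots> = (\<Sum>b\<in>Basis. \<Sum>a\<in>Basis. \<Sum>c\<in>Basis. t b c a *\<^sub>R N b (M c a))" by (rule sum.swap)
    also have "\<dots> = A" unfolding A_def by (intro sum.cong refl sum.swap)
    finally show ?thesis .
  qed
  have C: "(\<Sum>a\<in>Basis. \<Sum>b\<in>Basis. \<Sum>c\<in>Basis. t a b c *\<^sub>R N c (M a b)) = A"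
  proof -
    have "(\<Sum>a\<in>Basis. \<Sum>b\<in>Basis. \<Sum>c\<in>Basis. t a b c *\<^sub>R N c (M a b)) =
       (\<Sum>a\<in>Basis. \<Sum>b\<in>Basis. \<Sum>c\<in>Basis. t c a b *\<^sub>R N c (M a b))"
      by (intro sum.cong refl) (metis t1 t2)
    also have "\<dots> = (\<Sum>a\<in>Basis. \<Sum>c\<in>Basis. \<Sum>b\<in>Basis. t c a b *\<^sub>R N c (M a b))"
      by (intro sum.cong refl sum.swap)
    also have "\<dots> = A" unfolding A_def by (rule sum.swap)
    finally show ?thesis .
  qed
  have "A + A + A = (\<Sum>a\<in>Basis. \<Sum>b\<in>Basis. \<Sum>c\<in>Basis. t a b c *\<^sub>R N a (M b c))
      + (\<Sum>a\<in>Basis. \<Sum>b\<in>Basis. \<Sum>c\<in>Basis. t a b c *\<^sub>R N b (M c a))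
      + (\<Sum>a\<in>Basis. \<Sum>b\<in>Basis. \<Sum>c\<in>Basis. t a b c *\<^sub>R N c (M a b))"
    unfolding B C unfolding A_def ..
  also have "\<dots> = (\<Sum>a\<in>Basis. \<Sum>b\<in>Basis. \<Sum>c\<in>Basis. t a b c *\<^sub>R (N a (M b c) + N b (M c a) + N c (M a b)))"
    by (simp add: sum.distrib scaleR_add_right)
  also have "\<dots> = 0" by (simp add: N_M_cyclic)
  finally have "3 *\<^sub>R A = 0" by (simp add: scaleR_left.add[of 1 2, simplified] scaleR_2 add.assoc)
  then show ?thesis using cA by simp
qed

text \<open>The exactness identity with the vector replaced by the gradient: polarised in its two
  first arguments it is antisymmetric, whereas second derivatives are symmetric.\<close>

lemma laplacian_eq:
  assumes u: "C_infinity W u" and x: "x \<in> W"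
  shows "laplacian u x = hess (\<lambda>x. tr (u x)) x + (\<Sum>b\<in>Basis. P b (dderiv b (compat u) x))"
proof -
  have op: "open W" using u by (rule C_infinity_open)
  define t where "t b c = dderiv b (dderiv c u) x" for b c
  have d: "f differentiable (at y)" if "C_infinity W f" "y \<in> W" for f :: "'a \<Rightarrow> 'v" and y
    using that by (rule C_infinity_differentiable)
  have t: "t b c = t c b" for b c unfolding t_def by (rule dderiv_commute[OF u x])
  have trd: "dderiv b (dderiv c (\<lambda>x. tr (u x))) x = tr (t b c)" for b c
  proof -
    have "dderiv b (dderiv c (\<lambda>x. tr (u x))) x = dderiv b (\<lambda>x. tr (dderiv c u x)) x"
      by (rule dderiv_cong[OF op x]) (intro dderiv_linear[OF linear_tr] d u)
    also have "\<dots> = tr (t b c)" unfolding t_def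
      by (intro dderiv_linear[OF linear_tr] d u x C_infinity_dderiv)
    finally show ?thesis .
  qed
  have Nlin: "bounded_linear (N c)" for c by (rule bounded_bilinear.bounded_linear_right[OF bilinear_N])
  have dN: "(\<lambda>x. N c (dderiv c u x)) differentiable (at x)" for c
    using bounded_linear.has_derivative[OF Nlin has_derivative_dderiv[OF d[OF C_infinity_dderiv[OF u] x]]]
    unfolding differentiable_def by blast
  have cd: "dderiv b (compat u) x = (\<Sum>c\<in>Basis. N c (t b c))" for b
  proof -
    have "dderiv b (compat u) x = (\<Sum>c\<in>Basis. dderiv b (\<lambda>x. N c (dderiv c u x)) x)"
      unfolding compat_def[abs_def] by (rule dderiv_sum) (rule dN)
    also have "\<dots> = (\<Sum>c\<in>Basis. N c (t b c))" unfolding t_def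
      by (intro sum.cong refl dderiv_linear[OF Nlin] d u x C_infinity_dderiv)
    finally show ?thesis .
  qed
  define \<beta> where "\<beta> b c v = (b \<bullet> c) *\<^sub>R v - tr v *\<^sub>R M b c - P b (N c v)" for b c v
  have anti: "\<beta> b c v + \<beta> c b v = 0" for b c v
  proof -
    have diag: "\<beta> x x v = 0" for x unfolding \<beta>_def using exact[of x v] by simp
    have ip: "(b + c) \<bullet> (b + c) = b \<bullet> b + c \<bullet> c + (b \<bullet> c + c \<bullet> b)"
      by (simp add: inner_add_left inner_add_right)
    have "\<beta> (b + c) (b + c) v = \<beta> b b v + \<beta> c c v + (\<beta> b c v + \<beta> c b v)"
      unfolding \<beta>_def bounded_bilinear.add_left[OF bilinear_M] bounded_bilinear.add_right[OF bilinear_M]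
        bounded_bilinear.add_left[OF bilinear_N] bounded_bilinear.add_left[OF bilinear_P]
        bounded_bilinear.add_right[OF bilinear_P] ip scaleR_add_left scaleR_add_right
      by (simp add: algebra_simps)
    then show ?thesis by (simp add: diag)
  qed
  define A where "A = (\<Sum>b\<in>Basis. \<Sum>c\<in>Basis. \<beta> b c (t b c))"
  have "A = (\<Sum>b\<in>Basis. \<Sum>c\<in>Basis. \<beta> c b (t b c))"
    unfolding A_def by (subst sum.swap) (simp add: t[symmetric])
  then have "A + A = (\<Sum>b\<in>Basis. \<Sum>c\<in>Basis. \<beta> b c (t b c) + \<beta> c b (t b c))"
    by (subst A_def) (simp add: sum.distrib A_def)
  then have "2 *\<^sub>R A = 0" by (simp add: anti scaleR_2)
  then have "A = 0" by simp
  moreover have "A = laplacian u x - hess (\<lambda>x. tr (u x)) x - (\<Sum>b\<in>Basis. P b (dderiv b (compat u) x))"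
  proof -
    have "(\<Sum>b\<in>Basis. \<Sum>c\<in>Basis. (b \<bullet> c) *\<^sub>R t b c) = laplacian u x"
      unfolding laplacian_def t_def
    proof (rule sum.cong[OF refl])
      fix b :: 'a assume b: "b \<in> Basis"
      have "(\<Sum>c\<in>Basis. (b \<bullet> c) *\<^sub>R dderiv b (dderiv c u) x) =
          (\<Sum>c\<in>Basis. if c = b then dderiv b (dderiv c u) x else 0)"
        using b by (intro sum.cong) (auto simp: inner_Basis)
      then show "(\<Sum>c\<in>Basis. (b \<bullet> c) *\<^sub>R dderiv b (dderiv c u) x) = dderiv b (dderiv b u) x"
        using b by (simp add: sum.delta)
    qed
    then show ?thesis
      unfolding A_def \<beta>_def hess_def trd cd
      by (simp add: sum_subtractf bounded_bilinear.sum_right[OF bilinear_P])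
  qed
  ultimately show ?thesis by (simp add: algebra_simps)
qed

lemma C_infinity_hess: "C_infinity W f \<Longrightarrow> C_infinity W (hess f)"
  unfolding hess_def[abs_def]
  by (intro C_infinity_sum C_infinity_linear[OF bounded_linear_scaleR_left] C_infinity_dderiv)
     (auto dest: C_infinity_open)

lemma C_infinity_compat: "C_infinity W u \<Longrightarrow> C_infinity W (compat u)"
  unfolding compat_def[abs_def]
  by (intro C_infinity_sum C_infinity_linear[OF bounded_bilinear.bounded_linear_right[OF bilinear_N]]
      C_infinity_dderiv) (auto dest: C_infinity_open)

lemma smooth_cpt_hess: "smooth_cpt f \<Longrightarrow> smooth_cpt (hess f)"
  unfolding hess_def[abs_def]
  by (intro smooth_cpt_sum smooth_cpt_linear[OF bounded_linear_scaleR_left] smooth_cpt_dderiv)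

lemma hess_diff:
  assumes f: "C_infinity W f" and g: "C_infinity W g" and x: "x \<in> W"
  shows "hess (\<lambda>x. f x - g x) x = hess f x - hess g x"
proof -
  have op: "open W" using f by (rule C_infinity_open)
  have "dderiv b (dderiv c (\<lambda>x. f x - g x)) x = dderiv b (dderiv c f) x - dderiv b (dderiv c g) x" for b c
  proof -
    have "dderiv b (dderiv c (\<lambda>x. f x - g x)) x = dderiv b (\<lambda>x. dderiv c f x - dderiv c g x) x"
      by (rule dderiv_cong[OF op x]) (intro dderiv_diff C_infinity_differentiable[OF f] C_infinity_differentiable[OF g])
    also have "\<dots> = dderiv b (dderiv c f) x - dderiv b (dderiv c g) x"
      by (intro dderiv_diff C_infinity_differentiable[OF C_infinity_dderiv[OF f] x]
          C_infinity_differentiable[OF C_infinity_dderiv[OF g] x])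
    finally show ?thesis .
  qed
  then show ?thesis unfolding hess_def by (simp add: scaleR_diff_left sum_subtractf)
qed

lemma hess_cong:
  assumes "open W" "x \<in> W" "\<And>y. y \<in> W \<Longrightarrow> f y = g y"
  shows "hess f x = hess g x"
  unfolding hess_def
  by (intro sum.cong refl arg_cong2[where f=scaleR] dderiv_cong[OF assms(1)] assms(2,3))

end

section \<open>Order of vanishing along a set\<close>

text \<open>The recursion suits inductions that differentiate once; \<open>vanishes_iff\<close> is the equivalent
  condition on iterated partial derivatives.\<close>

primrec vanishes :: "nat \<Rightarrow> 'a::euclidean_space set \<Rightarrow> ('a \<Rightarrow> 'b::real_normed_vector) \<Rightarrow> bool" where
  "vanishes 0 \<Gamma> f \<longleftrightarrow> C_infinity UNIV f"
| "vanishes (Suc k) \<Gamma> f \<longleftrightarrow> C_infinity UNIV f \<and> (\<forall>p\<in>\<Gamma>. f p = 0) \<and>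
     (\<forall>b\<in>Basis. vanishes k \<Gamma> (dderiv b f))"

lemma vanishes_C_infinity: "vanishes k \<Gamma> f \<Longrightarrow> C_infinity UNIV f"
  by (cases k) auto

lemma vanishes_differentiable: "vanishes k \<Gamma> f \<Longrightarrow> f differentiable (at x)"
  by (rule C_infinity_differentiable[OF vanishes_C_infinity UNIV_I])

lemma smooth_differentiable: "C_infinity UNIV f \<Longrightarrow> f differentiable (at x)"
  by (rule C_infinity_differentiable[OF _ UNIV_I])

lemma vanishes_Suc: "vanishes (Suc k) \<Gamma> f \<Longrightarrow> vanishes k \<Gamma> f"
  by (induction k arbitrary: f) auto

lemma vanishes_dderiv: "vanishes (Suc k) \<Gamma> f \<Longrightarrow> b \<in> Basis \<Longrightarrow> vanishes k \<Gamma> (dderiv b f)"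
  by simp

lemma vanishes_iff:
  "vanishes k \<Gamma> f \<longleftrightarrow> C_infinity UNIV f \<and>
    (\<forall>vs. set vs \<subseteq> Basis \<and> length vs < k \<longrightarrow> (\<forall>p\<in>\<Gamma>. iter_dderiv vs f p = 0))"
proof (induction k arbitrary: f)
  case (Suc k)
  have "(\<forall>vs. set vs \<subseteq> Basis \<and> length vs < Suc k \<longrightarrow> (\<forall>p\<in>\<Gamma>. iter_dderiv vs f p = 0)) \<longleftrightarrow>
      (\<forall>p\<in>\<Gamma>. f p = 0) \<and> (\<forall>b\<in>Basis. \<forall>vs. set vs \<subseteq> Basis \<and> length vs < k \<longrightarrow>
         (\<forall>p\<in>\<Gamma>. iter_dderiv vs (dderiv b f) p = 0))" (is "?L \<longleftrightarrow> ?R")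
  proof
    assume L: ?L
    have "iter_dderiv vs (dderiv b f) p = 0"
      if "b \<in> Basis" "set vs \<subseteq> Basis" "length vs < k" "p \<in> \<Gamma>" for b vs p
      using L[rule_format, of "vs @ [b]" p] that by (simp add: iter_dderiv_append)
    then show ?R using L[rule_format, of "[]"] by auto
  next
    assume R: ?R
    show ?L
    proof (intro allI impI ballI)
      fix vs :: "'a list" and p assume vs: "set vs \<subseteq> Basis \<and> length vs < Suc k" and p: "p \<in> \<Gamma>"
      show "iter_dderiv vs f p = 0"
      proof (cases vs rule: rev_cases)
        case Nil
        then show ?thesis using R p by simp
      next
        case (snoc us b)
        then have "b \<in> Basis" "set us \<subseteq> Basis" "length us < k" using vs by auto
        then have "iter_dderiv us (dderiv b f) p = 0" using R p by blast
        then show ?thesis using snoc by (simp add: iter_dderiv_append)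
      qed
    qed
  qed
  then show ?case using Suc.IH C_infinity_dderiv by auto
qed simp

lemma vanishes_zero: "vanishes k \<Gamma> (\<lambda>x. 0)"
proof (induction k)
  case (Suc k)
  have "dderiv b (\<lambda>x::'a. 0::'b) = (\<lambda>x. 0)" for b by auto
  then show ?case using Suc by (simp add: C_infinity_const)
qed (simp add: C_infinity_const)

lemma vanishes_linear:
  "bounded_linear h \<Longrightarrow> vanishes k \<Gamma> f \<Longrightarrow> vanishes k \<Gamma> (\<lambda>x. h (f x))"
proof (induction k arbitrary: f)
  case (Suc k)
  have "dderiv b (\<lambda>x. h (f x)) = (\<lambda>x. h (dderiv b f x))" for b
    by (rule ext) (intro dderiv_linear Suc.prems(1) vanishes_differentiable[OF Suc.prems(2)])
  then show ?case using Suc linear_simps(3)[OF Suc.prems(1)] by (simp add: C_infinity_linear)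
qed (simp add: C_infinity_linear)

lemma vanishes_add:
  "vanishes k \<Gamma> f \<Longrightarrow> vanishes k \<Gamma> g \<Longrightarrow> vanishes k \<Gamma> (\<lambda>x. f x + g x)"
proof (induction k arbitrary: f g)
  case (Suc k)
  have "dderiv b (\<lambda>x. f x + g x) = (\<lambda>x. dderiv b f x + dderiv b g x)" for b
    by (rule ext) (intro dderiv_add vanishes_differentiable[OF Suc.prems(1)] vanishes_differentiable[OF Suc.prems(2)])
  then show ?case using Suc by (simp add: C_infinity_add)
qed (simp add: C_infinity_add)

lemma vanishes_minus: "vanishes k \<Gamma> f \<Longrightarrow> vanishes k \<Gamma> (\<lambda>x. - f x)"
  by (rule vanishes_linear[OF bounded_linear_minus[OF bounded_linear_ident]])

lemma vanishes_diff:
  "vanishes k \<Gamma> f \<Longrightarrow> vanishes k \<Gamma> g \<Longrightarrow> vanishes k \<Gamma> (\<lambda>x. f x - g x)"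
  using vanishes_add[of k \<Gamma> f "\<lambda>x. - g x"] vanishes_minus[of k \<Gamma> g] by simp

lemma vanishes_sum:
  "(\<And>i. i \<in> I \<Longrightarrow> vanishes k \<Gamma> (f i)) \<Longrightarrow> vanishes k \<Gamma> (\<lambda>x. \<Sum>i\<in>I. f i x)"
  by (induction I rule: infinite_finite_induct) (auto intro: vanishes_add vanishes_zero)

lemma vanishes_bilinear_aux:
  assumes p: "bounded_bilinear p"
  shows "k + j = n \<Longrightarrow> vanishes k \<Gamma> f \<Longrightarrow> vanishes j \<Gamma> g \<Longrightarrow> vanishes n \<Gamma> (\<lambda>x. p (f x) (g x))"
proof (induction n arbitrary: k j f g)
  case 0
  then show ?case using C_infinity_bilinear[OF p] by simp
next
  case (Suc n)
  have C: "C_infinity UNIV f" "C_infinity UNIV g" using Suc.prems vanishes_C_infinity by blast+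
  have d: "dderiv b (\<lambda>x. p (f x) (g x)) = (\<lambda>x. p (f x) (dderiv b g x) + p (dderiv b f x) (g x))" for b
    by (rule ext) (intro dderiv_bilinear[OF p] smooth_differentiable C)
  have z: "p (f q) (g q) = 0" if "q \<in> \<Gamma>" for q
  proof (cases k)
    case 0
    then show ?thesis using Suc.prems that bounded_bilinear.zero_right[OF p] by simp
  next
    case (Suc k')
    then show ?thesis using Suc.prems(2) that bounded_bilinear.zero_left[OF p] by simp
  qed
  have 1: "vanishes n \<Gamma> (\<lambda>x. p (f x) (dderiv b g x))" if b: "b \<in> Basis" for b
  proof (cases j)
    case 0
    then have "vanishes n \<Gamma> f" using Suc.prems by (simp add: vanishes_Suc del: vanishes.simps)
    moreover have "vanishes 0 \<Gamma> (dderiv b g)" using C by (simp add: C_infinity_dderiv)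
    ultimately show ?thesis using Suc.IH[of n 0 f "dderiv b g"] by simp
  next
    case j: (Suc j')
    then show ?thesis using Suc.IH[of k j' f "dderiv b g"] Suc.prems b by simp
  qed
  have 2: "vanishes n \<Gamma> (\<lambda>x. p (dderiv b f x) (g x))" if b: "b \<in> Basis" for b
  proof (cases k)
    case 0
    then have "vanishes n \<Gamma> g" using Suc.prems by (simp add: vanishes_Suc del: vanishes.simps)
    moreover have "vanishes 0 \<Gamma> (dderiv b f)" using C by (simp add: C_infinity_dderiv)
    ultimately show ?thesis using Suc.IH[of 0 n "dderiv b f" g] by simp
  next
    case k: (Suc k')
    then show ?thesis using Suc.IH[of k' j "dderiv b f" g] Suc.prems b by simp
  qed
  show ?case using z 1 2 C by (simp add: d vanishes_add C_infinity_bilinear[OF p])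
qed

lemma vanishes_bilinear:
  "bounded_bilinear p \<Longrightarrow> vanishes k \<Gamma> f \<Longrightarrow> vanishes j \<Gamma> g \<Longrightarrow> vanishes (k + j) \<Gamma> (\<lambda>x. p (f x) (g x))"
  by (rule vanishes_bilinear_aux[OF _ refl])

lemma vanishes_scaleR_left:
  "vanishes k \<Gamma> f \<Longrightarrow> C_infinity UNIV g \<Longrightarrow> vanishes k \<Gamma> (\<lambda>x. f x *\<^sub>R g x)"
  using vanishes_bilinear[OF bounded_bilinear_scaleR, of k \<Gamma> f 0 g] by simp

lemma vanishes_scaleR_right:
  "C_infinity UNIV f \<Longrightarrow> vanishes k \<Gamma> g \<Longrightarrow> vanishes k \<Gamma> (\<lambda>x. f x *\<^sub>R g x)"
  using vanishes_bilinear[OF bounded_bilinear_scaleR, of 0 \<Gamma> f k g] by simp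

lemma vanishes_near:
  assumes f: "C_infinity UNIV f" and V: "open V" "\<Gamma> \<subseteq> V" and z: "\<And>x. x \<in> V \<Longrightarrow> f x = 0"
  shows "vanishes k \<Gamma> f"
  using f z
proof (induction k arbitrary: f)
  case (Suc k)
  have "dderiv b f x = 0" if "x \<in> V" for b x
    using dderiv_cong[OF V(1) that, of f "\<lambda>x. 0" b] Suc.prems(2) by simp
  then show ?case using Suc V(2) by (auto simp: C_infinity_dderiv)
qed simp

lemma vanishes_power:
  fixes r :: "'a::euclidean_space \<Rightarrow> real"
  assumes "C_infinity UNIV r" "\<And>p. p \<in> \<Gamma> \<Longrightarrow> r p = 0"
  shows "vanishes k \<Gamma> (\<lambda>x. r x ^ k)"
proof (induction k)
  case (Suc k)
  have "vanishes 1 \<Gamma> r" using assms by (simp add: C_infinity_dderiv)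
  from vanishes_bilinear[OF bounded_bilinear_mult this Suc] show ?case by simp
qed (simp add: C_infinity_const)

section \<open>Taylor expansion in a defining function\<close>

text \<open>The germ at \<open>\<Gamma>\<close> of a defining function \<open>r\<close>, extended to the whole space. The function \<open>\<kappa>\<close>
  extends \<open>1/\<bar>\<nabla>r\<bar>\<^sup>2\<close> from a neighbourhood of \<open>\<Gamma>\<close>; since only Taylor coefficients on \<open>\<Gamma>\<close> matter,
  this is expressed by vanishing to all orders. The last assumption says that a function that
  vanishes on \<open>\<Gamma>\<close> has zero derivative in the directions tangent to \<open>\<Gamma>\<close>.\<close>

locale hypersurface =
  fixes \<Gamma> :: "'a::euclidean_space set" and r \<kappa> :: "'a \<Rightarrow> real"
  assumes smooth_r: "C_infinity UNIV r" and smooth_\<kappa>: "C_infinity UNIV \<kappa>"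
    and r_zero: "p \<in> \<Gamma> \<Longrightarrow> r p = 0"
    and unit: "vanishes k \<Gamma> (\<lambda>x. \<kappa> x * (\<Sum>c\<in>Basis. dderiv c r x * dderiv c r x) - 1)"
    and tangential: "C_infinity UNIV g \<Longrightarrow> (\<And>q. q \<in> \<Gamma> \<Longrightarrow> g q = 0) \<Longrightarrow> p \<in> \<Gamma> \<Longrightarrow> b \<in> Basis \<Longrightarrow>
      dderiv b g p = dderiv b r p * (\<kappa> p * (\<Sum>c\<in>Basis. dderiv c r p * dderiv c g p))"
begin

text \<open>The vector field \<open>\<nabla>r/\<bar>\<nabla>r\<bar>\<^sup>2\<close> near \<open>\<Gamma>\<close>, which differentiates \<open>r\<close> to one there.\<close>

definition normal :: "('a \<Rightarrow> 'b::euclidean_space) \<Rightarrow> 'a \<Rightarrow> 'b" where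
  "normal g x = \<kappa> x *\<^sub>R (\<Sum>c\<in>Basis. dderiv c r x *\<^sub>R dderiv c g x)"

definition rpow :: "nat \<Rightarrow> 'a \<Rightarrow> real" where
  "rpow k x = r x ^ k / fact k"

lemma smooth_normal: "C_infinity UNIV g \<Longrightarrow> C_infinity UNIV (normal g)"
  unfolding normal_def[abs_def]
  by (intro C_infinity_scaleR C_infinity_sum smooth_\<kappa> C_infinity_dderiv smooth_r) auto

lemma smooth_normal_pow: "C_infinity UNIV g \<Longrightarrow> C_infinity UNIV ((normal ^^ k) g)"
  by (induction k) (auto intro: smooth_normal)

lemma smooth_rpow: "C_infinity UNIV (rpow k)"
  unfolding rpow_def[abs_def] divide_inverse
  by (intro C_infinity_mult C_infinity_power C_infinity_const smooth_r) auto

lemma vanishes_rpow: "vanishes k \<Gamma> (rpow k)"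
proof -
  have "vanishes k \<Gamma> (\<lambda>x. r x ^ k)" by (rule vanishes_power[OF smooth_r r_zero])
  from vanishes_linear[OF bounded_linear_mult_left[of "inverse (fact k)"] this]
  show ?thesis by (simp add: rpow_def[abs_def] divide_inverse)
qed

lemma dderiv_rpow: "dderiv b (rpow (Suc k)) x = rpow k x * dderiv b r x"
proof -
  have "((\<lambda>t. t ^ Suc k / fact (Suc k)) has_real_derivative (r x ^ k / fact k)) (at (r x))"
  proof -
    have "((\<lambda>t. t ^ Suc k / fact (Suc k)) has_real_derivative (real (Suc k) * r x ^ k / fact (Suc k))) (at (r x))"
      using DERIV_cdivide[OF DERIV_pow[of "Suc k" "r x"], of "fact (Suc k)"] by simp
    moreover have "real (Suc k) * r x ^ k / fact (Suc k) = r x ^ k / fact k"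
      unfolding fact_Suc by (simp del: of_nat_Suc)
    ultimately show ?thesis by simp
  qed
  then have 1: "((\<lambda>t. t ^ Suc k / fact (Suc k)) has_derivative (*) (r x ^ k / fact k)) (at (r x))"
    by (simp only: has_field_derivative_def)
  from has_derivative_compose[OF has_derivative_dderiv[OF smooth_differentiable[OF smooth_r]] 1]
  have "(rpow (Suc k) has_derivative (\<lambda>v. r x ^ k / fact k * dderiv v r x)) (at x)"
    by (simp only: rpow_def[abs_def])
  from dderiv_eq[OF this] show ?thesis by (simp add: rpow_def)
qed

lemma tangential_vec:
  fixes g :: "'a \<Rightarrow> 'b::euclidean_space"
  assumes g: "C_infinity UNIV g" and z: "\<And>q. q \<in> \<Gamma> \<Longrightarrow> g q = 0" and p: "p \<in> \<Gamma>" and b: "b \<in> Basis"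
  shows "dderiv b g p = dderiv b r p *\<^sub>R normal g p"
proof -
  have l: "bounded_linear (\<lambda>v. v \<bullet> e)" for e :: 'b by (rule bounded_linear_inner_left)
  have d: "dderiv c (\<lambda>x. g x \<bullet> e) p = dderiv c g p \<bullet> e" for c e
    by (rule dderiv_linear[OF l smooth_differentiable[OF g]])
  have "dderiv b g p \<bullet> e = (dderiv b r p *\<^sub>R normal g p) \<bullet> e" for e
    using tangential[OF C_infinity_linear[OF l[of e] g] _ p b] z
    by (simp add: d normal_def inner_sum_left)
  then show ?thesis using vector_eq_rdot by blast
qed

text \<open>Coefficients of the tangential part \<open>\<partial>\<^sub>b - (\<partial>\<^sub>b r) normal\<close> of \<open>\<partial>\<^sub>b\<close>.\<close>

definition tangent_coeff :: "'a \<Rightarrow> 'a \<Rightarrow> 'a \<Rightarrow> real" where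
  "tangent_coeff b c x = (if b = c then 1 else 0) - dderiv b r x * (\<kappa> x * dderiv c r x)"

lemma smooth_tangent_coeff: "C_infinity UNIV (tangent_coeff b c)"
  unfolding tangent_coeff_def[abs_def]
  by (intro C_infinity_diff C_infinity_mult C_infinity_const smooth_\<kappa> C_infinity_dderiv smooth_r) auto

lemma tangent_part:
  assumes b: "b \<in> Basis"
  shows "dderiv b g x - dderiv b r x *\<^sub>R normal g x = (\<Sum>c\<in>Basis. tangent_coeff b c x *\<^sub>R dderiv c g x)"
proof -
  have "(\<Sum>c\<in>Basis. (if b = c then 1 else 0) *\<^sub>R dderiv c g x) = dderiv b g x"
    using b by (simp add: if_distrib[of "\<lambda>t. t *\<^sub>R _"] sum.delta cong: if_cong)
  then show ?thesis
    by (simp add: tangent_coeff_def scaleR_diff_left sum_subtractf normal_def scaleR_sum_right)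
qed

text \<open>A tangential derivative does not lower the order of vanishing: it keeps the zero values on
  \<open>\<Gamma>\<close>, and its commutator with \<open>\<partial>\<^sub>a\<close> is of first order, so that the induction closes.\<close>

lemma vanishes_tangent:
  fixes g :: "'a \<Rightarrow> 'b::euclidean_space"
  assumes b: "b \<in> Basis"
  shows "vanishes (Suc k) \<Gamma> g \<Longrightarrow> vanishes (Suc k) \<Gamma> (\<lambda>x. \<Sum>c\<in>Basis. tangent_coeff b c x *\<^sub>R dderiv c g x)"
proof (induction k arbitrary: g)
  case (0 g)
  have g: "C_infinity UNIV g" using 0 by (rule vanishes_C_infinity)
  have "(\<Sum>c\<in>Basis. tangent_coeff b c p *\<^sub>R dderiv c g p) = 0" if "p \<in> \<Gamma>" for p
    using tangential_vec[OF g _ that b] 0 tangent_part[OF b, of g p] by simp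
  moreover have "C_infinity UNIV (\<lambda>x. \<Sum>c\<in>Basis. tangent_coeff b c x *\<^sub>R dderiv c g x)"
    by (intro C_infinity_sum C_infinity_scaleR smooth_tangent_coeff C_infinity_dderiv g open_UNIV)
  ultimately show ?case by (simp add: C_infinity_dderiv)
next
  case (Suc k)
  have g: "C_infinity UNIV g" using Suc.prems by (rule vanishes_C_infinity)
  have sm: "C_infinity UNIV (\<lambda>x. \<Sum>c\<in>Basis. tangent_coeff b c x *\<^sub>R dderiv c g x)"
    by (intro C_infinity_sum C_infinity_scaleR smooth_tangent_coeff C_infinity_dderiv g open_UNIV)
  have z: "(\<Sum>c\<in>Basis. tangent_coeff b c p *\<^sub>R dderiv c g p) = 0" if "p \<in> \<Gamma>" for p
    using tangential_vec[OF g _ that b] Suc.prems tangent_part[OF b, of g p] by simp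
  have "vanishes (Suc k) \<Gamma> (dderiv a (\<lambda>x. \<Sum>c\<in>Basis. tangent_coeff b c x *\<^sub>R dderiv c g x))"
    if a: "a \<in> Basis" for a
  proof -
    have ag: "vanishes (Suc k) \<Gamma> (dderiv a g)" using Suc.prems a by (rule vanishes_dderiv)
    have "dderiv a (\<lambda>x. \<Sum>c\<in>Basis. tangent_coeff b c x *\<^sub>R dderiv c g x) =
      (\<lambda>x. (\<Sum>c\<in>Basis. tangent_coeff b c x *\<^sub>R dderiv c (dderiv a g) x)
         + (\<Sum>c\<in>Basis. dderiv a (tangent_coeff b c) x *\<^sub>R dderiv c g x))"
    proof
      fix x
      have "dderiv a (\<lambda>x. \<Sum>c\<in>Basis. tangent_coeff b c x *\<^sub>R dderiv c g x) x =
        (\<Sum>c\<in>Basis. dderiv a (\<lambda>x. tangent_coeff b c x *\<^sub>R dderiv c g x) x)"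
        by (intro dderiv_sum smooth_differentiable C_infinity_scaleR smooth_tangent_coeff C_infinity_dderiv g)
      also have "\<dots> = (\<Sum>c\<in>Basis. tangent_coeff b c x *\<^sub>R dderiv a (dderiv c g) x
          + dderiv a (tangent_coeff b c) x *\<^sub>R dderiv c g x)"
        by (intro sum.cong refl dderiv_scaleR smooth_differentiable smooth_tangent_coeff C_infinity_dderiv g)
      also have "\<dots> = (\<Sum>c\<in>Basis. tangent_coeff b c x *\<^sub>R dderiv c (dderiv a g) x
          + dderiv a (tangent_coeff b c) x *\<^sub>R dderiv c g x)"
        using dderiv_commute[OF g UNIV_I, of a] by simp
      finally show "dderiv a (\<lambda>x. \<Sum>c\<in>Basis. tangent_coeff b c x *\<^sub>R dderiv c g x) x =
        (\<Sum>c\<in>Basis. tangent_coeff b c x *\<^sub>R dderiv c (dderiv a g) x)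
         + (\<Sum>c\<in>Basis. dderiv a (tangent_coeff b c) x *\<^sub>R dderiv c g x)"
        by (simp add: sum.distrib)
    qed
    moreover have "vanishes (Suc k) \<Gamma> (\<lambda>x. \<Sum>c\<in>Basis. dderiv a (tangent_coeff b c) x *\<^sub>R dderiv c g x)"
      by (intro vanishes_sum vanishes_scaleR_right C_infinity_dderiv smooth_tangent_coeff
          vanishes_dderiv[OF Suc.prems])
    ultimately show ?thesis using vanishes_add[OF Suc.IH[OF ag]] by simp
  qed
  then show ?case using sm z vanishes.simps(2)[of "Suc k"] by blast
qed

lemma vanishes_normal:
  assumes "vanishes (Suc k) \<Gamma> g"
  shows "vanishes k \<Gamma> (normal g)"
  unfolding normal_def[abs_def]
  by (intro vanishes_scaleR_right smooth_\<kappa> vanishes_sum C_infinity_dderiv smooth_r vanishes_dderiv[OF assms])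

text \<open>Modulo functions that vanish to order \<open>k\<close>, the derivative \<open>\<partial>\<^sub>b\<close> equals \<open>\<partial>\<^sub>b r\<close> times the
  normal derivative, and the normal derivative of \<open>g\<close> has order \<open>k - 1\<close>; hence the induction on
  \<open>k\<close> applies to it.\<close>

lemma Taylor_remainder:
  fixes g :: "'a \<Rightarrow> 'b::euclidean_space"
  shows "vanishes k \<Gamma> g \<Longrightarrow> vanishes (Suc k) \<Gamma> (\<lambda>x. g x - rpow k x *\<^sub>R (normal ^^ k) g x)"
proof (induction k arbitrary: g)
  case 0
  then show ?case by (simp add: rpow_def vanishes_zero del: vanishes.simps(2))
next
  case (Suc k)
  define T where "T = (normal ^^ Suc k) g"
  have g: "C_infinity UNIV g" using Suc.prems by (rule vanishes_C_infinity)
  have T: "C_infinity UNIV T" unfolding T_def by (rule smooth_normal_pow[OF g])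
  have T': "T = (normal ^^ k) (normal g)" by (simp add: T_def funpow_swap1)
  have sm: "C_infinity UNIV (\<lambda>x. g x - rpow (Suc k) x *\<^sub>R T x)"
    by (intro C_infinity_diff C_infinity_scaleR smooth_rpow g T)
  have z: "g p - rpow (Suc k) p *\<^sub>R T p = 0" if "p \<in> \<Gamma>" for p
    using Suc.prems r_zero[OF that] that by (simp add: rpow_def)
  have IH: "vanishes (Suc k) \<Gamma> (\<lambda>x. normal g x - rpow k x *\<^sub>R T x)"
    unfolding T' by (rule Suc.IH[OF vanishes_normal[OF Suc.prems]])
  have "vanishes (Suc k) \<Gamma> (dderiv b (\<lambda>x. g x - rpow (Suc k) x *\<^sub>R T x))" if b: "b \<in> Basis" for b
  proof -
    have "dderiv b (\<lambda>x. g x - rpow (Suc k) x *\<^sub>R T x) =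
      (\<lambda>x. (\<Sum>c\<in>Basis. tangent_coeff b c x *\<^sub>R dderiv c g x)
        + (dderiv b r x *\<^sub>R (normal g x - rpow k x *\<^sub>R T x) - rpow (Suc k) x *\<^sub>R dderiv b T x))"
    proof
      fix x
      have "dderiv b (\<lambda>x. g x - rpow (Suc k) x *\<^sub>R T x) x =
          dderiv b g x - dderiv b (\<lambda>x. rpow (Suc k) x *\<^sub>R T x) x"
        by (intro dderiv_diff smooth_differentiable C_infinity_scaleR smooth_rpow g T)
      also have "dderiv b (\<lambda>x. rpow (Suc k) x *\<^sub>R T x) x =
          rpow (Suc k) x *\<^sub>R dderiv b T x + dderiv b (rpow (Suc k)) x *\<^sub>R T x"
        by (intro dderiv_scaleR smooth_differentiable smooth_rpow T)
      finally show "dderiv b (\<lambda>x. g x - rpow (Suc k) x *\<^sub>R T x) x =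
        (\<Sum>c\<in>Basis. tangent_coeff b c x *\<^sub>R dderiv c g x)
        + (dderiv b r x *\<^sub>R (normal g x - rpow k x *\<^sub>R T x) - rpow (Suc k) x *\<^sub>R dderiv b T x)"
        unfolding tangent_part[OF b, symmetric] dderiv_rpow by (simp add: algebra_simps)
    qed
    then show ?thesis
      by (simp only:)
         (intro vanishes_add vanishes_diff vanishes_tangent[OF b Suc.prems] vanishes_scaleR_right[OF _ IH]
           vanishes_scaleR_left[OF vanishes_rpow] C_infinity_dderiv smooth_r T)
  qed
  then show ?case using sm z unfolding T_def[symmetric] vanishes.simps(2)[of "Suc k"] by blast
qed

text \<open>The normal derivative lowers the power of \<open>r\<close> by one and keeps the coefficient, up to
  terms of higher order.\<close>

lemma leading_coefficient_zero:
  fixes h :: "'a \<Rightarrow> 'b::euclidean_space"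
  shows "C_infinity UNIV h \<Longrightarrow> vanishes (Suc m) \<Gamma> (\<lambda>x. rpow m x *\<^sub>R h x) \<Longrightarrow> p \<in> \<Gamma> \<Longrightarrow> h p = 0"
proof (induction m)
  case 0
  then show ?case by (simp add: rpow_def)
next
  case (Suc m)
  \<comment> \<open>The normal derivative of \<open>r\<close> is \<open>1 + z\<close>.\<close>
  define z where "z x = \<kappa> x * (\<Sum>c\<in>Basis. dderiv c r x * dderiv c r x) - 1" for x
  have z: "vanishes 1 \<Gamma> z" unfolding z_def[abs_def] by (rule unit)
  have "normal (\<lambda>x. rpow (Suc m) x *\<^sub>R h x) x =
      rpow m x *\<^sub>R h x + (rpow m x * z x) *\<^sub>R h x + rpow (Suc m) x *\<^sub>R normal h x" for x
  proof -
    have d: "dderiv c (\<lambda>x. rpow (Suc m) x *\<^sub>R h x) x = rpow (Suc m) x *\<^sub>R dderiv c h x + (rpow m x * dderiv c r x) *\<^sub>R h x" for c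
      using dderiv_scaleR[OF smooth_differentiable[OF smooth_rpow] smooth_differentiable[OF Suc.prems(1)], of c "Suc m" x]
      by (simp add: dderiv_rpow)
    have "(\<Sum>c\<in>Basis. dderiv c r x *\<^sub>R (rpow (Suc m) x *\<^sub>R dderiv c h x + (rpow m x * dderiv c r x) *\<^sub>R h x)) =
       rpow (Suc m) x *\<^sub>R (\<Sum>c\<in>Basis. dderiv c r x *\<^sub>R dderiv c h x)
       + (rpow m x * (\<Sum>c\<in>Basis. dderiv c r x * dderiv c r x)) *\<^sub>R h x"
      by (simp add: scaleR_sum_right scaleR_sum_left sum_distrib_left sum.distrib scaleR_add_right mult_ac)
    then show ?thesis unfolding normal_def d z_def
      by (simp add: algebra_simps)
  qed
  then have eq: "(\<lambda>x. rpow m x *\<^sub>R h x) = (\<lambda>x. normal (\<lambda>x. rpow (Suc m) x *\<^sub>R h x) x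
      - (rpow m x * z x) *\<^sub>R h x - rpow (Suc m) x *\<^sub>R normal h x)"
    by (intro ext) (simp only:, simp)
  have v1: "vanishes (Suc m) \<Gamma> (normal (\<lambda>x. rpow (Suc m) x *\<^sub>R h x))"
    by (rule vanishes_normal[OF Suc.prems(2)])
  have v2: "vanishes (Suc m) \<Gamma> (\<lambda>x. (rpow m x * z x) *\<^sub>R h x)"
    using vanishes_bilinear[OF bounded_bilinear_mult vanishes_rpow z]
    by (intro vanishes_scaleR_left Suc.prems(1)) simp
  have v3: "vanishes (Suc m) \<Gamma> (\<lambda>x. rpow (Suc m) x *\<^sub>R normal h x)"
    by (intro vanishes_scaleR_left vanishes_rpow smooth_normal Suc.prems(1))
  have "vanishes (Suc m) \<Gamma> (\<lambda>x. rpow m x *\<^sub>R h x)"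
    unfolding eq by (intro vanishes_diff v1 v2 v3)
  then show ?case using Suc by blast
qed

end

section \<open>Formal solution at the boundary\<close>

locale boundary_jet = symbol_complex M N P tr + hypersurface \<Gamma> r \<kappa>
  for M :: "'a::euclidean_space \<Rightarrow> 'a \<Rightarrow> 'v::euclidean_space"
    and N :: "'a \<Rightarrow> 'v \<Rightarrow> 'w::euclidean_space"
    and P :: "'a \<Rightarrow> 'w \<Rightarrow> 'v" and tr :: "'v \<Rightarrow> real"
    and \<Gamma> :: "'a set" and r \<kappa> :: "'a \<Rightarrow> real"
begin

lemma vanishes_compat:
  assumes "vanishes (Suc k) \<Gamma> u"
  shows "vanishes k \<Gamma> (compat u)"
  unfolding compat_def[abs_def]
  by (intro vanishes_sum vanishes_linear[OF bounded_bilinear.bounded_linear_right[OF bilinear_N]]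
      vanishes_dderiv[OF assms])

lemma vanishes_hess:
  assumes "vanishes (Suc (Suc k)) \<Gamma> f"
  shows "vanishes k \<Gamma> (hess f)"
  unfolding hess_def[abs_def]
  by (intro vanishes_sum vanishes_linear[OF bounded_linear_scaleR_left] vanishes_dderiv
      vanishes_dderiv[OF assms])

definition N_grad :: "('a \<Rightarrow> 'v) \<Rightarrow> 'a \<Rightarrow> 'w" where
  "N_grad u x = (\<Sum>b\<in>Basis. dderiv b r x *\<^sub>R N b (u x))"

definition M_grad :: "'a \<Rightarrow> 'v" where
  "M_grad x = (\<Sum>b\<in>Basis. \<Sum>c\<in>Basis. (dderiv b r x * dderiv c r x) *\<^sub>R M b c)"

lemma N_grad_eq: "N_grad u x = N (grad r x) (u x)"
  unfolding N_grad_def grad_def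
  by (simp add: bounded_bilinear.sum_left[OF bilinear_N] bounded_bilinear.scaleR_left[OF bilinear_N])

lemma M_grad_eq: "M_grad x = M (grad r x) (grad r x)"
  unfolding M_grad_def grad_def
  by (simp add: bounded_bilinear.sum_left[OF bilinear_M] bounded_bilinear.scaleR_left[OF bilinear_M]
      bounded_bilinear.sum_right[OF bilinear_M] bounded_bilinear.scaleR_right[OF bilinear_M]
      scaleR_sum_right, intro sum.cong refl, subst M_sym, rule refl)

lemma smooth_M_grad: "C_infinity UNIV M_grad"
  unfolding M_grad_def[abs_def]
  by (intro C_infinity_sum C_infinity_linear[OF bounded_linear_scaleR_left] C_infinity_mult
      C_infinity_dderiv smooth_r) auto

lemma smooth_N_grad: "C_infinity UNIV u \<Longrightarrow> C_infinity UNIV (N_grad u)"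
  unfolding N_grad_def[abs_def]
  by (intro C_infinity_sum C_infinity_scaleR C_infinity_dderiv smooth_r
      C_infinity_linear[OF bounded_bilinear.bounded_linear_right[OF bilinear_N]]) auto

lemma grad_norm: "grad r x \<bullet> grad r x = (\<Sum>c\<in>Basis. dderiv c r x * dderiv c r x)"
  unfolding grad_def by (simp add: inner_sum_left inner_sum_right inner_Basis if_distrib sum.delta cong: if_cong)

text \<open>Exactness of the symbols in the conormal direction.\<close>

lemma leading_part:
  assumes p: "p \<in> \<Gamma>" and n: "N_grad u p = 0"
  shows "u p = (\<kappa> p * tr (u p)) *\<^sub>R M_grad p"
proof -
  have "\<kappa> p * (grad r p \<bullet> grad r p) = 1"
    using unit[of 1] p by (simp add: grad_norm)
  then have "u p = \<kappa> p *\<^sub>R ((grad r p \<bullet> grad r p) *\<^sub>R u p)" by simp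
  also have "\<dots> = \<kappa> p *\<^sub>R (tr (u p) *\<^sub>R M_grad p)"
    using exact[of "grad r p" "u p"] n
    by (simp add: N_grad_eq M_grad_eq bounded_bilinear.zero_right[OF bilinear_P])
  finally show ?thesis by simp
qed

text \<open>The factor \<open>rpow k\<close> survives only if both derivatives fall on the power of \<open>r\<close>.\<close>

lemma hess_rpow:
  assumes c: "C_infinity UNIV c"
  shows "vanishes (Suc k) \<Gamma> (\<lambda>x. hess (\<lambda>x. rpow (Suc (Suc k)) x * c x) x - rpow k x *\<^sub>R (c x *\<^sub>R M_grad x))"
proof -
  have d1: "dderiv e (\<lambda>x. rpow (Suc j) x * f x) = (\<lambda>x. rpow j x * (dderiv e r x * f x) + rpow (Suc j) x * dderiv e f x)"
    if "C_infinity UNIV f" for e f j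
  proof
    fix x
    show "dderiv e (\<lambda>x. rpow (Suc j) x * f x) x = rpow j x * (dderiv e r x * f x) + rpow (Suc j) x * dderiv e f x"
      using dderiv_mult[OF smooth_differentiable[OF smooth_rpow] smooth_differentiable[OF that], of e "Suc j" x]
      by (simp add: dderiv_rpow)
  qed
  define E where "E b e x = rpow (Suc k) x * (dderiv b (\<lambda>x. dderiv e r x * c x) x + dderiv b r x * dderiv e c x
      ) + rpow (Suc (Suc k)) x * dderiv b (dderiv e c) x" for b e x
  have d2: "dderiv b (dderiv e (\<lambda>x. rpow (Suc (Suc k)) x * c x)) x =
      rpow k x * (dderiv b r x * dderiv e r x * c x) + E b e x" for b e x
  proof -
    have s1: "C_infinity UNIV (\<lambda>x. dderiv e r x * c x)" "C_infinity UNIV (dderiv e c)"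
      by (intro C_infinity_mult C_infinity_dderiv smooth_r c)+
    have "dderiv b (dderiv e (\<lambda>x. rpow (Suc (Suc k)) x * c x)) x =
      dderiv b (\<lambda>x. rpow (Suc k) x * (dderiv e r x * c x)) x + dderiv b (\<lambda>x. rpow (Suc (Suc k)) x * dderiv e c x) x"
      unfolding d1[OF c] by (intro dderiv_add smooth_differentiable C_infinity_mult smooth_rpow C_infinity_dderiv smooth_r c)
    then show ?thesis unfolding d1[OF s1(1)] d1[OF s1(2)] E_def by (simp add: algebra_simps)
  qed
  have "hess (\<lambda>x. rpow (Suc (Suc k)) x * c x) x - rpow k x *\<^sub>R (c x *\<^sub>R M_grad x) =
      (\<Sum>b\<in>Basis. \<Sum>e\<in>Basis. E b e x *\<^sub>R M b e)" for x
    unfolding hess_def d2 M_grad_def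
    by (simp add: scaleR_add_left sum.distrib scaleR_sum_right mult_ac)
  moreover have "vanishes (Suc k) \<Gamma> (E b e)" for b e
  proof -
    have s: "C_infinity UNIV (\<lambda>x. dderiv b (\<lambda>x. dderiv e r x * c x) x + dderiv b r x * dderiv e c x)"
      by (intro C_infinity_add C_infinity_mult C_infinity_dderiv smooth_r c)
    have "vanishes (Suc k) \<Gamma> (\<lambda>x. rpow (Suc k) x *\<^sub>R (dderiv b (\<lambda>x. dderiv e r x * c x) x + dderiv b r x * dderiv e c x)
        + rpow (Suc (Suc k)) x *\<^sub>R dderiv b (dderiv e c) x)"
      by (intro vanishes_add vanishes_scaleR_left vanishes_rpow vanishes_Suc[OF vanishes_rpow] s C_infinity_dderiv c)
    then show ?thesis by (simp add: E_def[abs_def])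
  qed
  ultimately show ?thesis
    by (simp only:) (intro vanishes_sum vanishes_linear[OF bounded_linear_scaleR_left])
qed

text \<open>The factor by which the leading coefficient of \<open>hess F\<close> at order \<open>k\<close> is a multiple of
  \<open>M(\<nabla>r,\<nabla>r)\<close>.\<close>

definition next_coeff :: "nat \<Rightarrow> ('a \<Rightarrow> real) \<Rightarrow> 'a \<Rightarrow> real" where
  "next_coeff k F x = \<kappa> x * tr ((normal ^^ k) (hess F) x)"

lemma smooth_next_coeff: "C_infinity UNIV F \<Longrightarrow> C_infinity UNIV (next_coeff k F)"
  unfolding next_coeff_def[abs_def]
  by (intro C_infinity_mult smooth_\<kappa> C_infinity_linear[OF linear_tr] smooth_normal_pow C_infinity_hess)

text \<open>For \<open>k > 0\<close> this is the leading coefficient, at order \<open>k - 1\<close>, of the equation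
  \<open>compat (hess F) = 0\<close>; for \<open>k = 0\<close> it has to be assumed.\<close>

lemma leading_part_of_hess:
  assumes F: "C_infinity UNIV F" and v: "vanishes k \<Gamma> (hess F)"
    and bc: "k = 0 \<Longrightarrow> (\<And>p. p \<in> \<Gamma> \<Longrightarrow> N_grad (hess F) p = 0)" and p: "p \<in> \<Gamma>"
  shows "N_grad ((normal ^^ k) (hess F)) p = 0"
proof (cases k)
  case 0
  then show ?thesis using bc p by simp
next
  case (Suc j)
  define T where "T = (normal ^^ k) (hess F)"
  have u: "C_infinity UNIV (hess F)" by (rule C_infinity_hess[OF F])
  have T: "C_infinity UNIV T" unfolding T_def by (rule smooth_normal_pow[OF u])
  have Nl: "bounded_linear (N b)" for b by (rule bounded_bilinear.bounded_linear_right[OF bilinear_N])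
  have rem: "vanishes (Suc k) \<Gamma> (\<lambda>x. hess F x - rpow k x *\<^sub>R T x)"
    unfolding T_def by (rule Taylor_remainder[OF v])
  have "compat (\<lambda>x. hess F x - rpow k x *\<^sub>R T x) x = - (rpow j x *\<^sub>R N_grad T x + rpow k x *\<^sub>R compat T x)" for x
  proof -
    have "dderiv b (\<lambda>x. hess F x - rpow k x *\<^sub>R T x) x =
        dderiv b (hess F) x - (rpow k x *\<^sub>R dderiv b T x + (rpow j x * dderiv b r x) *\<^sub>R T x)" for b
    proof -
      have "dderiv b (\<lambda>x. hess F x - rpow k x *\<^sub>R T x) x = dderiv b (hess F) x - dderiv b (\<lambda>x. rpow k x *\<^sub>R T x) x"
        by (intro dderiv_diff smooth_differentiable C_infinity_scaleR smooth_rpow T u)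
      also have "dderiv b (\<lambda>x. rpow k x *\<^sub>R T x) x = rpow k x *\<^sub>R dderiv b T x + dderiv b (rpow k) x *\<^sub>R T x"
        by (intro dderiv_scaleR smooth_differentiable smooth_rpow T)
      finally show ?thesis using Suc by (simp add: dderiv_rpow)
    qed
    then have "compat (\<lambda>x. hess F x - rpow k x *\<^sub>R T x) x =
        compat (hess F) x - (rpow k x *\<^sub>R compat T x + rpow j x *\<^sub>R N_grad T x)"
      unfolding compat_def N_grad_def
      by (simp add: linear_simps[OF Nl] sum_subtractf sum.distrib scaleR_sum_right)
    then show ?thesis using compat_hess[OF F UNIV_I] by simp
  qed
  then have "(\<lambda>x. rpow j x *\<^sub>R N_grad T x) = (\<lambda>x. - compat (\<lambda>x. hess F x - rpow k x *\<^sub>R T x) x - rpow k x *\<^sub>R compat T x)"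
    by auto
  moreover have "vanishes k \<Gamma> (\<lambda>x. - compat (\<lambda>x. hess F x - rpow k x *\<^sub>R T x) x - rpow k x *\<^sub>R compat T x)"
    by (intro vanishes_diff vanishes_minus vanishes_compat rem vanishes_scaleR_left vanishes_rpow C_infinity_compat T)
  ultimately have "vanishes (Suc j) \<Gamma> (\<lambda>x. rpow j x *\<^sub>R N_grad T x)" using Suc by simp
  from leading_coefficient_zero[OF smooth_N_grad[OF T] this p] show ?thesis by (simp add: T_def)
qed

text \<open>By exactness the leading coefficient of \<open>hess F\<close> is the multiple \<open>next_coeff\<close> of
  \<open>M(\<nabla>r,\<nabla>r)\<close>, and this is also the leading coefficient of the Hessian of the correction.\<close>

lemma jet_step:
  assumes F: "C_infinity UNIV F" and v: "vanishes k \<Gamma> (hess F)"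
    and bc: "k = 0 \<Longrightarrow> (\<And>p. p \<in> \<Gamma> \<Longrightarrow> N_grad (hess F) p = 0)"
  shows "vanishes (Suc k) \<Gamma> (hess (\<lambda>x. F x - rpow (Suc (Suc k)) x * next_coeff k F x))"
proof -
  define T where "T = (normal ^^ k) (hess F)"
  define c where "c = next_coeff k F"
  have c: "C_infinity UNIV c" unfolding c_def by (rule smooth_next_coeff[OF F])
  have T: "C_infinity UNIV T" unfolding T_def by (intro smooth_normal_pow C_infinity_hess F)
  have rem: "vanishes (Suc k) \<Gamma> (\<lambda>x. hess F x - rpow k x *\<^sub>R T x)"
    unfolding T_def by (rule Taylor_remainder[OF v])
  have "T p - c p *\<^sub>R M_grad p = 0" if p: "p \<in> \<Gamma>" for p
    using leading_part[OF p leading_part_of_hess[OF F v bc p]] by (simp add: T_def c_def next_coeff_def)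
  then have "vanishes 1 \<Gamma> (\<lambda>x. T x - c x *\<^sub>R M_grad x)"
    by (simp add: C_infinity_dderiv C_infinity_diff C_infinity_scaleR T c smooth_M_grad)
  from vanishes_bilinear[OF bounded_bilinear_scaleR vanishes_rpow[of k] this]
  have lead: "vanishes (Suc k) \<Gamma> (\<lambda>x. rpow k x *\<^sub>R (T x - c x *\<^sub>R M_grad x))" by simp
  have "hess (\<lambda>x. F x - rpow (Suc (Suc k)) x * c x) =
    (\<lambda>x. (hess F x - rpow k x *\<^sub>R T x) + rpow k x *\<^sub>R (T x - c x *\<^sub>R M_grad x)
      - (hess (\<lambda>x. rpow (Suc (Suc k)) x * c x) x - rpow k x *\<^sub>R (c x *\<^sub>R M_grad x)))"
    using hess_diff[OF F C_infinity_mult[OF smooth_rpow c] UNIV_I]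
    by (auto simp: scaleR_diff_right)
  then show ?thesis unfolding c_def[symmetric]
    by (simp only:) (intro vanishes_diff vanishes_add rem lead hess_rpow c)
qed

primrec jet :: "('a \<Rightarrow> real) \<Rightarrow> nat \<Rightarrow> 'a \<Rightarrow> real" where
  "jet F 0 = F"
| "jet F (Suc k) = (\<lambda>x. jet F k x - rpow (Suc (Suc k)) x * next_coeff k (jet F k) x)"

lemma smooth_jet: "C_infinity UNIV F \<Longrightarrow> C_infinity UNIV (jet F k)"
  by (induction k) (auto intro!: C_infinity_diff C_infinity_mult smooth_rpow smooth_next_coeff)

lemma vanishes_hess_jet:
  assumes F: "C_infinity UNIV F" and bc: "\<And>p. p \<in> \<Gamma> \<Longrightarrow> N_grad (hess F) p = 0"
  shows "vanishes k \<Gamma> (hess (jet F k))"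
proof (induction k)
  case 0
  then show ?case by (simp add: C_infinity_hess F)
next
  case (Suc k)
  have "vanishes (Suc k) \<Gamma> (hess (\<lambda>x. jet F k x - rpow (Suc (Suc k)) x * next_coeff k (jet F k) x))"
    by (rule jet_step[OF smooth_jet[OF F] Suc]) (use bc in auto)
  then show ?case by simp
qed

end

section \<open>Borel summation\<close>

lemma iter_dderiv_C_infinity: "C_infinity W f \<Longrightarrow> C_infinity W (iter_dderiv vs f)"
  by (induction vs) (auto intro: C_infinity_dderiv)

text \<open>The derivatives of order \<open>n\<close> of all but the first \<open>n\<close> terms are dominated by a geometric
  series, so the series may be differentiated termwise any number of times.\<close>

lemma C_infinity_series:
  fixes f :: "nat \<Rightarrow> 'a::euclidean_space \<Rightarrow> real"
  assumes f: "\<And>k. C_infinity UNIV (f k)"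
    and small: "\<And>k vs x. set vs \<subseteq> Basis \<Longrightarrow> length vs \<le> k \<Longrightarrow> \<bar>iter_dderiv vs (f k) x\<bar> \<le> (1/2) ^ k"
  shows "C_infinity UNIV (\<lambda>x. \<Sum>k. f k x)"
    and "set vs \<subseteq> Basis \<Longrightarrow> iter_dderiv vs (\<lambda>x. \<Sum>k. f k x) x = (\<Sum>k. iter_dderiv vs (f k) x)"
proof -
  have geo: "summable (\<lambda>k::nat. (1/2::real) ^ k)" by (rule summable_geometric) simp
  have sm: "summable (\<lambda>k. iter_dderiv vs (f k) x)" if "set vs \<subseteq> Basis" for vs x
    by (rule summable_comparison_test'[OF geo, of "length vs"]) (use small that in auto)
  have tail: "\<bar>(\<Sum>k<n. iter_dderiv vs (f k) x) - (\<Sum>k. iter_dderiv vs (f k) x)\<bar> \<le> 2 * (1/2) ^ n"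
    if vs: "set vs \<subseteq> Basis" and n: "length vs \<le> n" for vs x n
  proof -
    have ss: "summable (\<lambda>k. iter_dderiv vs (f (k + n)) x)"
      by (rule summable_ignore_initial_segment[OF sm[OF vs]])
    have gn: "summable (\<lambda>k. (1/2::real) ^ (k + n))" by (rule summable_ignore_initial_segment[OF geo])
    have le: "norm (iter_dderiv vs (f (k + n)) x) \<le> (1/2) ^ (k + n)" for k
      using small[OF vs, of "k + n"] n by simp
    have "(\<Sum>k. iter_dderiv vs (f k) x) = (\<Sum>k. iter_dderiv vs (f (k + n)) x) + (\<Sum>k<n. iter_dderiv vs (f k) x)"
      by (rule suminf_split_initial_segment[OF sm[OF vs]])
    then have "\<bar>(\<Sum>k<n. iter_dderiv vs (f k) x) - (\<Sum>k. iter_dderiv vs (f k) x)\<bar> =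
        norm (\<Sum>k. iter_dderiv vs (f (k + n)) x)" by simp
    also have "\<dots> \<le> (\<Sum>k. (1/2) ^ (k + n))" by (rule norm_suminf_le[OF le gn])
    also have "\<dots> = (1/2) ^ n * (\<Sum>k. (1/2) ^ k)"
      unfolding power_add by (subst suminf_mult2[OF geo, symmetric]) simp
    also have "(\<Sum>k. (1/2::real) ^ k) = 2" by (simp add: suminf_geometric)
    finally show ?thesis by simp
  qed
  define G where "G vs x = (\<Sum>k. iter_dderiv vs (f k) x)" for vs x
  have der: "(G vs has_derivative (\<lambda>h. \<Sum>b\<in>Basis. (h \<bullet> b) *\<^sub>R G (b # vs) x)) (at x)"
    if vs: "set vs \<subseteq> Basis" for vs x
  proof -
    have "\<exists>g. \<forall>x\<in>UNIV. (\<lambda>k. iter_dderiv vs (f k) x) sums g x \<and>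
        (g has_derivative (\<lambda>h. \<Sum>b\<in>Basis. (h \<bullet> b) *\<^sub>R G (b # vs) x)) (at x within UNIV)"
    proof (rule has_derivative_series[where f'="\<lambda>k x h. dderiv h (iter_dderiv vs (f k)) x"
          and x=0 and l="G vs 0"])
      show "(iter_dderiv vs (f k) has_derivative (\<lambda>h. dderiv h (iter_dderiv vs (f k)) x)) (at x within UNIV)" for k x
        using has_derivative_dderiv[OF smooth_differentiable[OF iter_dderiv_C_infinity[OF f]]] by simp
      show "(\<lambda>k. iter_dderiv vs (f k) 0) sums G vs 0"
        unfolding G_def by (rule summable_sums[OF sm[OF vs]])
      fix e :: real assume e: "e > 0"
      define C where "C = 2 * real DIM('a)"
      have C: "C > 0" by (simp add: C_def)
      obtain n0 where n0: "(1/2) ^ n0 < e / C"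
        using real_arch_pow_inv[of "e / C" "1/2"] e C by auto
      have "norm ((\<Sum>i<n. dderiv h (iter_dderiv vs (f i)) x) - (\<Sum>b\<in>Basis. (h \<bullet> b) *\<^sub>R G (b # vs) x)) \<le> e * norm h"
        if n: "n \<ge> max n0 (Suc (length vs))" for n x h
      proof -
        have "(\<Sum>i<n. dderiv h (iter_dderiv vs (f i)) x) = (\<Sum>i<n. \<Sum>b\<in>Basis. (h \<bullet> b) * iter_dderiv (b # vs) (f i) x)"
          by (intro sum.cong refl)
             (simp add: dderiv_expand[OF smooth_differentiable[OF iter_dderiv_C_infinity[OF f]], where v=h])
        also have "\<dots> = (\<Sum>b\<in>Basis. (h \<bullet> b) * (\<Sum>i<n. iter_dderiv (b # vs) (f i) x))"
          by (subst sum.swap) (simp add: sum_distrib_left)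
        finally have "norm ((\<Sum>i<n. dderiv h (iter_dderiv vs (f i)) x) - (\<Sum>b\<in>Basis. (h \<bullet> b) *\<^sub>R G (b # vs) x)) =
            \<bar>\<Sum>b\<in>Basis. (h \<bullet> b) * ((\<Sum>i<n. iter_dderiv (b # vs) (f i) x) - G (b # vs) x)\<bar>"
          by (simp add: sum_subtractf right_diff_distrib)
        also have "\<dots> \<le> (\<Sum>b\<in>Basis. \<bar>(h \<bullet> b) * ((\<Sum>i<n. iter_dderiv (b # vs) (f i) x) - G (b # vs) x)\<bar>)"
          by (rule sum_abs)
        also have "\<dots> \<le> (\<Sum>b\<in>(Basis::'a set). norm h * (2 * (1/2) ^ n))"
        proof (rule sum_mono)
          fix b :: 'a assume b: "b \<in> Basis"
          have "\<bar>(\<Sum>i<n. iter_dderiv (b # vs) (f i) x) - G (b # vs) x\<bar> \<le> 2 * (1/2) ^ n"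
            unfolding G_def by (rule tail) (use b vs n in auto)
          then show "\<bar>(h \<bullet> b) * ((\<Sum>i<n. iter_dderiv (b # vs) (f i) x) - G (b # vs) x)\<bar> \<le> norm h * (2 * (1/2) ^ n)"
            unfolding abs_mult using b by (intro mult_mono Basis_le_norm) auto
        qed
        also have "\<dots> = norm h * (C * (1/2) ^ n)" by (simp add: C_def)
        also have "\<dots> \<le> norm h * e"
        proof (rule mult_left_mono)
          have "(1/2::real) ^ n \<le> (1/2) ^ n0" using n by (intro power_decreasing) auto
          then have "(1/2) ^ n < e / C" using n0 by (rule le_less_trans)
          then show "C * (1/2) ^ n \<le> e" using C by (simp add: field_simps)
        qed simp
        finally show ?thesis by (simp add: mult.commute)
      qed
      then show "\<forall>\<^sub>F n in sequentially. \<forall>x\<in>UNIV. \<forall>h.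
          norm ((\<Sum>i<n. dderiv h (iter_dderiv vs (f i)) x) - (\<Sum>b\<in>Basis. (h \<bullet> b) *\<^sub>R G (b # vs) x)) \<le> e * norm h"
        unfolding eventually_sequentially by blast
    qed auto
    then obtain g where g: "\<And>x. (\<lambda>k. iter_dderiv vs (f k) x) sums g x"
        "\<And>x. (g has_derivative (\<lambda>h. \<Sum>b\<in>Basis. (h \<bullet> b) *\<^sub>R G (b # vs) x)) (at x)" by auto
    have "g = G vs" unfolding G_def using g(1) sums_unique by (intro ext) blast
    then show ?thesis using g(2) by simp
  qed
  have dG: "dderiv b (G vs) = G (b # vs)" if "set vs \<subseteq> Basis" "b \<in> Basis" for b vs
  proof
    fix x
    have "dderiv b (G vs) x = (\<Sum>c\<in>Basis. (b \<bullet> c) *\<^sub>R G (c # vs) x)" by (rule dderiv_eq[OF der[OF that(1)]])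
    also have "\<dots> = (\<Sum>c\<in>Basis. if c = b then G (b # vs) x else 0)"
      using that(2) by (intro sum.cong) (auto simp: inner_Basis)
    finally show "dderiv b (G vs) x = G (b # vs) x" using that(2) by (simp add: sum.delta)
  qed
  have G0: "G [] = (\<lambda>x. \<Sum>k. f k x)" by (auto simp: G_def)
  have "C_infinity UNIV (G [])"
  proof (rule C_infinity_coinduct[where P="\<lambda>g. \<exists>vs. set vs \<subseteq> Basis \<and> g = G vs"])
    show "\<exists>vs. set vs \<subseteq> Basis \<and> G [] = G vs" by (intro exI[of _ "[]"]) auto
    show "g differentiable (at x)" if "\<exists>vs. set vs \<subseteq> Basis \<and> g = G vs" for g x
      using that der unfolding differentiable_def by blast
    fix g and b :: 'a assume "\<exists>vs. set vs \<subseteq> Basis \<and> g = G vs" and b: "b \<in> Basis"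
    then obtain vs where "set vs \<subseteq> Basis" "g = G vs" by blast
    then show "\<exists>g'. (\<exists>vs. set vs \<subseteq> Basis \<and> g' = G vs) \<and> (\<forall>x\<in>UNIV. dderiv b g x = g' x)"
      using dG[of vs b] b by (intro exI[of _ "G (b # vs)"] conjI exI[of _ "b # vs"]) auto
  qed simp
  then show "C_infinity UNIV (\<lambda>x. \<Sum>k. f k x)" by (simp add: G0)
  have it: "iter_dderiv vs (G []) = G vs" if "set vs \<subseteq> Basis" for vs
    using that by (induction vs) (auto simp: dG)
  show "set vs \<subseteq> Basis \<Longrightarrow> iter_dderiv vs (\<lambda>x. \<Sum>k. f k x) x = (\<Sum>k. iter_dderiv vs (f k) x)"
    using it[of vs] by (simp add: G0[symmetric]) (simp add: G_def)
qed

text \<open>The derivative of order \<open>l\<close> of an even plateau function, equal to one on \<open>[-1, 1]\<close> and to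
  zero outside \<open>[-2, 2]\<close>.\<close>

definition plateau :: "nat \<Rightarrow> real \<Rightarrow> real" where
  "plateau l = (dderiv 1 ^^ l) (\<lambda>t. smooth_step (t * t))"

lemma smooth_plateau: "C_infinity UNIV (plateau l)"
proof -
  have "C_infinity UNIV (\<lambda>t. smooth_step (t * t))"
    by (intro C_infinity_compose_real[OF C_infinity_smooth_step] C_infinity_mult C_infinity_ident) auto
  then show ?thesis unfolding plateau_def by (induction l) (auto intro: C_infinity_dderiv)
qed

lemma plateau_Suc: "dderiv 1 (plateau l) = plateau (Suc l)"
  by (simp add: plateau_def)

lemma plateau_outside: "\<bar>t\<bar> > 2 \<Longrightarrow> plateau l t = 0"
proof (induction l arbitrary: t)
  case 0
  have "2 \<le> \<bar>t\<bar> * \<bar>t\<bar>" using mult_mono[of 2 "\<bar>t\<bar>" 1 "\<bar>t\<bar>"] 0 by simp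
  then show ?case by (simp add: plateau_def smooth_step_eq_0)
next
  case (Suc l)
  have o: "open {t::real. \<bar>t\<bar> > 2}" by (intro open_Collect_less continuous_intros)
  have "dderiv 1 (plateau l) t = dderiv 1 (\<lambda>t. 0) t"
    by (rule dderiv_cong[OF o]) (use Suc in auto)
  then show ?case by (simp add: plateau_Suc)
qed

lemma plateau_inside: "\<bar>t\<bar> \<le> 1 \<Longrightarrow> plateau 0 t = 1"
  using mult_mono[of "\<bar>t\<bar>" 1 "\<bar>t\<bar>" 1] by (simp add: plateau_def smooth_step_eq_1)

lemma plateau_bounded: "\<exists>B\<ge>0. \<forall>t. \<bar>plateau l t\<bar> \<le> B"
proof -
  have "smooth_cpt (plateau l)"
    using smooth_plateau plateau_outside unfolding smooth_cpt_def by (metis real_norm_def)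
  from smooth_cpt_bounded[OF this] show ?thesis by simp
qed

context hypersurface
begin

text \<open>Sums of functions \<open>\<epsilon>\<^sup>-\<^sup>i r\<^sup>j \<psi>\<^sup>(\<^sup>l\<^sup>)(r/\<epsilon>) a\<close> with \<open>j - i \<ge> n\<close>. On the support of \<open>\<psi>\<^sup>(\<^sup>l\<^sup>)(r/\<epsilon>)\<close> one
  has \<open>\<bar>r\<bar> \<le> 2\<epsilon>\<close>, so such a function is of size \<open>\<epsilon>\<^sup>n\<close>, and each derivative costs at most one
  power of \<open>\<epsilon>\<close>.\<close>

inductive family :: "nat \<Rightarrow> (real \<Rightarrow> 'a \<Rightarrow> real) \<Rightarrow> bool" where
  base: "i + n \<le> j \<Longrightarrow> smooth_cpt a \<Longrightarrow>
    family n (\<lambda>\<epsilon> x. (inverse \<epsilon>) ^ i * r x ^ j * plateau l (inverse \<epsilon> * r x) * a x)"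
| add: "family n \<phi> \<Longrightarrow> family n \<phi>' \<Longrightarrow> family n (\<lambda>\<epsilon> x. \<phi> \<epsilon> x + \<phi>' \<epsilon> x)"

lemma smooth_family_base:
  assumes a: "smooth_cpt a"
  shows "smooth_cpt (\<lambda>x. c * r x ^ j * plateau l (d * r x) * a x)"
  by (rule smooth_cpt_bilinear_right[OF bounded_bilinear_mult _ a])
     (intro C_infinity_mult C_infinity_const C_infinity_power smooth_r
       C_infinity_compose_real[OF smooth_plateau] open_UNIV UNIV_I)

lemma smooth_family: "family n \<phi> \<Longrightarrow> smooth_cpt (\<phi> \<epsilon>)"
  by (induction rule: family.induct) (auto intro: smooth_family_base smooth_cpt_add)

lemma family_bound:
  "family n \<phi> \<Longrightarrow> \<exists>C\<ge>0. \<forall>\<epsilon> x. 0 < \<epsilon> \<and> \<epsilon> \<le> 1 \<longrightarrow> \<bar>\<phi> \<epsilon> x\<bar> \<le> C * \<epsilon> ^ n"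
proof (induction rule: family.induct)
  case (base i n j a l)
  obtain A where A: "A \<ge> 0" "\<And>x. norm (a x) \<le> A" using smooth_cpt_bounded[OF base(2)] by blast
  obtain B where B: "B \<ge> 0" "\<And>t. \<bar>plateau l t\<bar> \<le> B" using plateau_bounded by blast
  have "\<bar>(inverse \<epsilon>) ^ i * r x ^ j * plateau l (inverse \<epsilon> * r x) * a x\<bar> \<le> 2 ^ j * B * A * \<epsilon> ^ n"
    if e: "0 < \<epsilon>" "\<epsilon> \<le> 1" for \<epsilon> x
  proof (cases "\<bar>inverse \<epsilon> * r x\<bar> > 2")
    case True
    then show ?thesis using A B e by (simp add: plateau_outside)
  next
    case False
    then have rx: "\<bar>r x\<bar> \<le> 2 * \<epsilon>" using e by (simp add: abs_mult field_simps)
    have "(inverse \<epsilon>) ^ i * \<bar>r x\<bar> ^ j \<le> (inverse \<epsilon>) ^ i * (2 * \<epsilon>) ^ j"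
      using e rx by (intro mult_left_mono power_mono) auto
    also have "\<dots> = 2 ^ j * \<epsilon> ^ (j - i)"
    proof -
      have "\<epsilon> ^ j = \<epsilon> ^ i * \<epsilon> ^ (j - i)" using base(1) by (simp add: power_add[symmetric])
      then show ?thesis using e by (simp add: power_mult_distrib power_inverse field_simps)
    qed
    also have "\<dots> \<le> 2 ^ j * \<epsilon> ^ n" using base(1) e by (intro mult_left_mono power_decreasing) auto
    finally have 1: "(inverse \<epsilon>) ^ i * \<bar>r x\<bar> ^ j \<le> 2 ^ j * \<epsilon> ^ n" .
    have "(inverse \<epsilon>) ^ i * \<bar>r x\<bar> ^ j * \<bar>plateau l (inverse \<epsilon> * r x)\<bar> * \<bar>a x\<bar> \<le> 2 ^ j * \<epsilon> ^ n * B * A"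
      using A(2)[of x] B A(1) e by (intro mult_mono 1) auto
    then show ?thesis using e by (simp add: abs_mult power_abs mult_ac)
  qed
  then show ?case using A B by (intro exI[of _ "2 ^ j * B * A"]) auto
next
  case (add n \<phi> \<phi>')
  obtain C where C: "C \<ge> 0" "\<And>\<epsilon> x. 0 < \<epsilon> \<Longrightarrow> \<epsilon> \<le> 1 \<Longrightarrow> \<bar>\<phi> \<epsilon> x\<bar> \<le> C * \<epsilon> ^ n"
    using add.IH(1) by blast
  obtain C' where C': "C' \<ge> 0" "\<And>\<epsilon> x. 0 < \<epsilon> \<Longrightarrow> \<epsilon> \<le> 1 \<Longrightarrow> \<bar>\<phi>' \<epsilon> x\<bar> \<le> C' * \<epsilon> ^ n"
    using add.IH(2) by blast
  have "\<bar>\<phi> \<epsilon> x + \<phi>' \<epsilon> x\<bar> \<le> (C + C') * \<epsilon> ^ n" if "0 < \<epsilon>" "\<epsilon> \<le> 1" for \<epsilon> x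
    using C(2)[OF that, of x] C'(2)[OF that, of x] by (simp add: distrib_right)
  then show ?case using C C' by (intro exI[of _ "C + C'"]) auto
qed

lemma family_dderiv:
  "family n \<phi> \<Longrightarrow> n = Suc m \<Longrightarrow> b \<in> Basis \<Longrightarrow> \<exists>\<phi>'. family m \<phi>' \<and> (\<forall>\<epsilon>. dderiv b (\<phi> \<epsilon>) = \<phi>' \<epsilon>)"
proof (induction rule: family.induct)
  case (base i n j a l)
  obtain j' where j: "j = Suc j'" using base by (cases j) auto
  have aC: "C_infinity UNIV a" using base(2) by (rule smooth_cpt_C_infinity)
  define \<phi>' where "\<phi>' \<epsilon> x = ((inverse \<epsilon>) ^ i * r x ^ j' * plateau l (inverse \<epsilon> * r x) * (real j * dderiv b r x * a x)
     + (inverse \<epsilon>) ^ Suc i * r x ^ j * plateau (Suc l) (inverse \<epsilon> * r x) * (dderiv b r x * a x))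
     + (inverse \<epsilon>) ^ i * r x ^ j * plateau l (inverse \<epsilon> * r x) * dderiv b a x" for \<epsilon> x
  have "family m \<phi>'"
    unfolding \<phi>'_def[abs_def]
  proof (intro family.add family.base)
    show "smooth_cpt (\<lambda>x. real j * dderiv b r x * a x)"
      by (rule smooth_cpt_bilinear_right[OF bounded_bilinear_mult _ base(2)])
         (intro C_infinity_mult C_infinity_const C_infinity_dderiv smooth_r open_UNIV)
    show "smooth_cpt (\<lambda>x. dderiv b r x * a x)"
      by (rule smooth_cpt_bilinear_right[OF bounded_bilinear_mult _ base(2)]) (intro C_infinity_dderiv smooth_r)
    show "smooth_cpt (dderiv b a)" by (rule smooth_cpt_dderiv[OF base(2)])
  qed (use base j in auto)
  moreover have "dderiv b (\<lambda>x. (inverse \<epsilon>) ^ i * r x ^ j * plateau l (inverse \<epsilon> * r x) * a x) = \<phi>' \<epsilon>" for \<epsilon>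
  proof
    fix x
    have rd: "(r has_derivative (\<lambda>v. dderiv v r x)) (at x)" by (rule has_derivative_dderiv[OF smooth_differentiable[OF smooth_r]])
    have pd: "(plateau l has_derivative (\<lambda>t. t * plateau (Suc l) s)) (at s)" for s
    proof -
      have "dderiv t (plateau l) s = t * plateau (Suc l) s" for t
        using dderiv_expand[OF smooth_differentiable[OF smooth_plateau], of t] unfolding Basis_real_def plateau_Suc[symmetric] by simp
      then have "(\<lambda>t. dderiv t (plateau l) s) = (\<lambda>t. t * plateau (Suc l) s)" by blast
      then show ?thesis using has_derivative_dderiv[OF smooth_differentiable[OF smooth_plateau[of l]], of s] by simp
    qed
    have 1: "((\<lambda>x. plateau l (inverse \<epsilon> * r x)) has_derivative
        (\<lambda>v. inverse \<epsilon> * dderiv v r x * plateau (Suc l) (inverse \<epsilon> * r x))) (at x)"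
      by (rule has_derivative_compose[OF has_derivative_mult_right[OF rd] pd])
    have 2: "((\<lambda>x. (inverse \<epsilon>) ^ i * r x ^ j) has_derivative
        (\<lambda>v. (inverse \<epsilon>) ^ i * (real j * r x ^ j' * dderiv v r x))) (at x)"
      using has_derivative_mult_right[OF has_derivative_power[OF rd, of j], of "(inverse \<epsilon>) ^ i"] j
      by (simp add: mult_ac)
    have "((\<lambda>x. (inverse \<epsilon>) ^ i * r x ^ j * plateau l (inverse \<epsilon> * r x) * a x) has_derivative
      (\<lambda>v. ((inverse \<epsilon>) ^ i * r x ^ j * plateau l (inverse \<epsilon> * r x)) * dderiv v a x +
        (((inverse \<epsilon>) ^ i * r x ^ j) * (inverse \<epsilon> * dderiv v r x * plateau (Suc l) (inverse \<epsilon> * r x)) +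
         ((inverse \<epsilon>) ^ i * (real j * r x ^ j' * dderiv v r x)) * plateau l (inverse \<epsilon> * r x)) * a x)) (at x)"
      by (rule has_derivative_mult[OF has_derivative_mult[OF 2 1] has_derivative_dderiv[OF smooth_differentiable[OF aC]]])
    from dderiv_eq[OF this, of b]
    show "dderiv b (\<lambda>x. (inverse \<epsilon>) ^ i * r x ^ j * plateau l (inverse \<epsilon> * r x) * a x) x = \<phi>' \<epsilon> x"
      by (simp add: \<phi>'_def algebra_simps)
  qed
  ultimately show ?case by blast
next
  case (add n \<phi> \<phi>')
  obtain \<psi> where \<psi>: "family m \<psi>" "\<And>\<epsilon>. dderiv b (\<phi> \<epsilon>) = \<psi> \<epsilon>" using add.IH(1) add.prems by blast
  obtain \<psi>' where \<psi>': "family m \<psi>'" "\<And>\<epsilon>. dderiv b (\<phi>' \<epsilon>) = \<psi>' \<epsilon>" using add.IH(2) add.prems by blast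
  have "dderiv b (\<lambda>x. \<phi> \<epsilon> x + \<phi>' \<epsilon> x) = (\<lambda>x. \<psi> \<epsilon> x + \<psi>' \<epsilon> x)" for \<epsilon>
    using dderiv_add[OF smooth_cpt_differentiable[OF smooth_family[OF add.hyps(1)]]
        smooth_cpt_differentiable[OF smooth_family[OF add.hyps(2)]]] \<psi>(2) \<psi>'(2) by auto
  then show ?case using family.add[OF \<psi>(1) \<psi>'(1)] by (intro exI[of _ "\<lambda>\<epsilon> x. \<psi> \<epsilon> x + \<psi>' \<epsilon> x"]) auto
qed

lemma family_iter_dderiv:
  "family (n + length vs) \<phi> \<Longrightarrow> set vs \<subseteq> Basis \<Longrightarrow> \<exists>\<phi>'. family n \<phi>' \<and> (\<forall>\<epsilon>. iter_dderiv vs (\<phi> \<epsilon>) = \<phi>' \<epsilon>)"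
proof (induction vs arbitrary: n)
  case (Cons v vs)
  obtain \<phi>' where \<phi>': "family (Suc n) \<phi>'" "\<And>\<epsilon>. iter_dderiv vs (\<phi> \<epsilon>) = \<phi>' \<epsilon>"
    using Cons.IH[of "Suc n"] Cons.prems by auto
  obtain \<psi> where "family n \<psi>" "\<forall>\<epsilon>. dderiv v (\<phi>' \<epsilon>) = \<psi> \<epsilon>"
    using family_dderiv[OF \<phi>'(1) refl, of v] Cons.prems by auto
  then show ?case using \<phi>'(2) by auto
qed auto

lemma family_small:
  assumes \<phi>: "family (Suc k) \<phi>" and \<delta>: "\<delta> > 0"
  shows "\<exists>\<epsilon>>0. \<epsilon> \<le> 1 \<and> (\<forall>vs x. set vs \<subseteq> Basis \<and> length vs \<le> k \<longrightarrow> \<bar>iter_dderiv vs (\<phi> \<epsilon>) x\<bar> \<le> \<delta>)"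
proof -
  define L where "L = {vs. set vs \<subseteq> (Basis::'a set) \<and> length vs \<le> k}"
  have fin: "finite L" unfolding L_def by (rule finite_lists_length_le) simp
  have "\<exists>C. C \<ge> 0 \<and> (\<forall>\<epsilon> x. 0 < \<epsilon> \<and> \<epsilon> \<le> 1 \<longrightarrow> \<bar>iter_dderiv vs (\<phi> \<epsilon>) x\<bar> \<le> C * \<epsilon>)" if vs: "vs \<in> L" for vs
  proof -
    have len: "length vs \<le> k" using vs by (simp add: L_def)
    then have "family (Suc (k - length vs) + length vs) \<phi>" using \<phi> by simp
    then obtain \<phi>' where \<phi>': "family (Suc (k - length vs)) \<phi>'" "\<And>\<epsilon>. iter_dderiv vs (\<phi> \<epsilon>) = \<phi>' \<epsilon>"
      using family_iter_dderiv[of "Suc (k - length vs)" vs \<phi>] vs by (auto simp: L_def)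
    obtain C where C: "C \<ge> 0" "\<And>\<epsilon> x. 0 < \<epsilon> \<Longrightarrow> \<epsilon> \<le> 1 \<Longrightarrow> \<bar>\<phi>' \<epsilon> x\<bar> \<le> C * \<epsilon> ^ Suc (k - length vs)"
      using family_bound[OF \<phi>'(1)] by blast
    have "\<bar>iter_dderiv vs (\<phi> \<epsilon>) x\<bar> \<le> C * \<epsilon>" if e: "0 < \<epsilon>" "\<epsilon> \<le> 1" for \<epsilon> x
    proof -
      have "\<epsilon> ^ Suc (k - length vs) \<le> \<epsilon> ^ 1" using e by (intro power_decreasing) auto
      then have "C * \<epsilon> ^ Suc (k - length vs) \<le> C * \<epsilon>" using C(1) by (intro mult_left_mono) auto
      then show ?thesis using C(2)[OF e, of x] \<phi>'(2) by simp
    qed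
    then show ?thesis using C(1) by blast
  qed
  then obtain C where C: "\<And>vs. vs \<in> L \<Longrightarrow> C vs \<ge> 0"
    "\<And>vs \<epsilon> x. vs \<in> L \<Longrightarrow> 0 < \<epsilon> \<Longrightarrow> \<epsilon> \<le> 1 \<Longrightarrow> \<bar>iter_dderiv vs (\<phi> \<epsilon>) x\<bar> \<le> C vs * \<epsilon>" by metis
  define K where "K = (\<Sum>vs\<in>L. C vs)"
  have K: "K \<ge> 0" unfolding K_def using C(1) by (rule sum_nonneg)
  define \<epsilon> where "\<epsilon> = min 1 (\<delta> / (K + 1))"
  have e: "0 < \<epsilon>" "\<epsilon> \<le> 1" using \<delta> K by (auto simp: \<epsilon>_def add_nonneg_pos)
  have "\<bar>iter_dderiv vs (\<phi> \<epsilon>) x\<bar> \<le> \<delta>" if vs: "vs \<in> L" for vs x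
  proof -
    have "C vs \<le> K + 1" using member_le_sum[OF vs, of C] fin C(1) by (simp add: K_def add_increasing2)
    have "\<bar>iter_dderiv vs (\<phi> \<epsilon>) x\<bar> \<le> C vs * \<epsilon>" by (rule C(2)[OF vs e])
    also have "\<dots> \<le> (K + 1) * (\<delta> / (K + 1))"
      using \<open>C vs \<le> K + 1\<close> e \<delta> K by (intro mult_mono) (auto simp: \<epsilon>_def)
    also have "\<dots> = \<delta>" using K by simp
    finally show ?thesis .
  qed
  then show ?thesis using e by (intro exI[of _ \<epsilon>]) (auto simp: L_def)
qed

text \<open>Multiplying the term of order \<open>k + 2\<close> by a plateau of width \<open>\<epsilon> k\<close> in \<open>r\<close> changes no
  derivative on \<open>\<Gamma>\<close> and makes its derivatives up to order \<open>k\<close> smaller than \<open>2\<^sup>-\<^sup>k\<close>, if \<open>\<epsilon> k\<close> is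
  small enough.\<close>

lemma Borel_summation:
  assumes a: "\<And>k. smooth_cpt (a k)"
  shows "\<exists>g. C_infinity UNIV g \<and>
    (\<forall>k. vanishes (k + 2) \<Gamma> (\<lambda>x. g x - (\<Sum>j<k. r x ^ (j + 2) * a j x)))"
proof -
  define \<phi> where "\<phi> k \<epsilon> x = r x ^ (k + 2) * a k x * plateau 0 (inverse \<epsilon> * r x)" for k \<epsilon> x
  have fam: "family (Suc k) (\<phi> k)" for k
  proof -
    have "family (Suc k) (\<lambda>\<epsilon> x. (inverse \<epsilon>) ^ 0 * r x ^ (k + 2) * plateau 0 (inverse \<epsilon> * r x) * a k x)"
      by (rule family.base) (use a in auto)
    then show ?thesis by (simp add: \<phi>_def[abs_def] mult_ac)
  qed
  have "\<exists>\<epsilon>. \<epsilon> > 0 \<and> (\<forall>vs x. set vs \<subseteq> Basis \<and> length vs \<le> k \<longrightarrow> \<bar>iter_dderiv vs (\<phi> k \<epsilon>) x\<bar> \<le> (1/2) ^ k)" for k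
    using family_small[OF fam, of "(1/2) ^ k" k] by auto
  then obtain \<epsilon> where e: "\<And>k. \<epsilon> k > 0"
    "\<And>k vs x. set vs \<subseteq> Basis \<Longrightarrow> length vs \<le> k \<Longrightarrow> \<bar>iter_dderiv vs (\<phi> k (\<epsilon> k)) x\<bar> \<le> (1/2) ^ k"
    by metis
  define f where "f k = \<phi> k (\<epsilon> k)" for k
  have fC: "C_infinity UNIV (f k)" for k
    unfolding f_def by (rule smooth_cpt_C_infinity[OF smooth_family[OF fam]])
  have small: "\<And>k vs x. set vs \<subseteq> Basis \<Longrightarrow> length vs \<le> k \<Longrightarrow> \<bar>iter_dderiv vs (f k) x\<bar> \<le> (1/2) ^ k"
    unfolding f_def by (rule e(2))
  define g where "g x = (\<Sum>k. f k x)" for x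
  have gC: "C_infinity UNIV g" unfolding g_def[abs_def] by (rule C_infinity_series(1)[OF fC small])
  have git: "iter_dderiv vs g x = (\<Sum>k. iter_dderiv vs (f k) x)" if "set vs \<subseteq> Basis" for vs x
    unfolding g_def[abs_def] by (rule C_infinity_series(2)[OF fC small that])
  have raC: "C_infinity UNIV (\<lambda>x. r x ^ (j + 2) * a j x)" for j
    by (intro C_infinity_mult C_infinity_power smooth_r smooth_cpt_C_infinity a)
  have fv: "vanishes (k + 2) \<Gamma> (f k)" for k
  proof -
    have "C_infinity UNIV (\<lambda>x. a k x * plateau 0 (inverse (\<epsilon> k) * r x))"
      by (intro C_infinity_mult smooth_cpt_C_infinity a C_infinity_compose_real[OF smooth_plateau]
          C_infinity_const smooth_r open_UNIV UNIV_I)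
    from vanishes_scaleR_left[OF vanishes_power[OF smooth_r r_zero, of \<Gamma> "k + 2"] this]
    show ?thesis by (simp add: f_def \<phi>_def[abs_def] mult.assoc)
  qed
  have near: "vanishes n \<Gamma> (\<lambda>x. f j x - r x ^ (j + 2) * a j x)" for n j
  proof (rule vanishes_near[where V="{x. \<bar>r x\<bar> < \<epsilon> j}"])
    show "C_infinity UNIV (\<lambda>x. f j x - r x ^ (j + 2) * a j x)" by (intro C_infinity_diff fC raC)
    show "open {x. \<bar>r x\<bar> < \<epsilon> j}"
      by (intro open_Collect_less continuous_intros C_infinity_continuous_on[OF smooth_r])
    show "\<Gamma> \<subseteq> {x. \<bar>r x\<bar> < \<epsilon> j}" using r_zero e(1) by auto
    show "f j x - r x ^ (j + 2) * a j x = 0" if "x \<in> {x. \<bar>r x\<bar> < \<epsilon> j}" for x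
    proof -
      have "\<bar>inverse (\<epsilon> j) * r x\<bar> \<le> 1" using that e(1)[of j] by (simp add: abs_mult field_simps)
      then show ?thesis by (simp add: f_def \<phi>_def plateau_inside)
    qed
  qed
  have itdiff: "iter_dderiv vs (\<lambda>x. u x - w x) = (\<lambda>x. iter_dderiv vs u x - iter_dderiv vs w x)"
    if "C_infinity UNIV u" "C_infinity UNIV w" for vs and u w :: "'a \<Rightarrow> real"
  proof (induction vs)
    case (Cons v vs)
    then show ?case
      using dderiv_diff[OF smooth_differentiable[OF iter_dderiv_C_infinity[OF that(1)]]
          smooth_differentiable[OF iter_dderiv_C_infinity[OF that(2)]]] by auto
  qed simp
  have itsum: "iter_dderiv vs (\<lambda>x. \<Sum>j<k. f j x) = (\<lambda>x. \<Sum>j<k. iter_dderiv vs (f j) x)" for vs k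
  proof (induction vs)
    case (Cons v vs)
    show ?case unfolding iter_dderiv.simps Cons.IH
      by (rule ext) (intro dderiv_sum smooth_differentiable iter_dderiv_C_infinity fC)
  qed simp
  have "vanishes (k + 2) \<Gamma> (\<lambda>x. g x - (\<Sum>j<k. r x ^ (j + 2) * a j x))" for k
  proof -
    have sC: "C_infinity UNIV (\<lambda>x. \<Sum>j<k. f j x)" by (intro C_infinity_sum fC open_UNIV)
    have "vanishes (k + 2) \<Gamma> (\<lambda>x. g x - (\<Sum>j<k. f j x))"
      unfolding vanishes_iff
    proof (intro conjI allI impI ballI)
      show "C_infinity UNIV (\<lambda>x. g x - (\<Sum>j<k. f j x))" by (intro C_infinity_diff gC sC)
      fix vs :: "'a list" and p assume vs: "set vs \<subseteq> Basis \<and> length vs < k + 2" and p: "p \<in> \<Gamma>"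
      have "iter_dderiv vs (f j) p = 0" if "j \<notin> {..<k}" for j
      proof -
        have "vanishes (j + 2) \<Gamma> (f j)" by (rule fv)
        then show ?thesis using vs p that unfolding vanishes_iff by auto
      qed
      then have "(\<Sum>j. iter_dderiv vs (f j) p) = (\<Sum>j<k. iter_dderiv vs (f j) p)"
        by (intro suminf_finite) auto
      then show "iter_dderiv vs (\<lambda>x. g x - (\<Sum>j<k. f j x)) p = 0"
        using git[of vs p] vs by (simp add: itdiff[OF gC sC] itsum)
    qed
    moreover have "vanishes (k + 2) \<Gamma> (\<lambda>x. \<Sum>j<k. f j x - r x ^ (j + 2) * a j x)"
      by (intro vanishes_sum near)
    ultimately have "vanishes (k + 2) \<Gamma> (\<lambda>x. (g x - (\<Sum>j<k. f j x)) + (\<Sum>j<k. f j x - r x ^ (j + 2) * a j x))"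
      by (rule vanishes_add)
    then show ?thesis by (simp add: sum_subtractf)
  qed
  then show ?thesis using gC by blast
qed

end

context boundary_jet
begin

text \<open>Compact support of \<open>\<kappa>\<close> gives the coefficients of the formal power series compact support,
  as Borel summation requires.\<close>

theorem formal_solution:
  assumes \<kappa>: "smooth_cpt \<kappa>" and F: "C_infinity UNIV F"
    and bc: "\<And>p. p \<in> \<Gamma> \<Longrightarrow> N_grad (hess F) p = 0"
  shows "\<exists>G. C_infinity UNIV G \<and> vanishes 2 \<Gamma> (\<lambda>x. G x - F x) \<and> (\<forall>k. vanishes k \<Gamma> (hess G))"
proof -
  define a where "a k x = - inverse (fact (k + 2)) * next_coeff k (jet F k) x" for k x
  have "smooth_cpt (a k)" for k
  proof -
    have "smooth_cpt (next_coeff k (jet F k))" unfolding next_coeff_def[abs_def]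
      by (intro smooth_cpt_bilinear_left[OF bounded_bilinear_mult \<kappa>] C_infinity_linear[OF linear_tr]
          smooth_normal_pow C_infinity_hess smooth_jet F)
    from smooth_cpt_linear[OF bounded_linear_mult_right[of "- inverse (fact (k + 2))"] this]
    show ?thesis unfolding a_def[abs_def] .
  qed
  then obtain g where g: "C_infinity UNIV g"
    "\<And>k. vanishes (k + 2) \<Gamma> (\<lambda>x. g x - (\<Sum>j<k. r x ^ (j + 2) * a j x))"
    using Borel_summation by blast
  have jet: "jet F k x = F x + (\<Sum>j<k. r x ^ (j + 2) * a j x)" for k x
    by (induction k) (simp_all add: a_def rpow_def divide_inverse mult_ac)
  define G where "G x = F x + g x" for x
  have GC: "C_infinity UNIV G" unfolding G_def[abs_def] by (intro C_infinity_add F g)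
  have "vanishes k \<Gamma> (hess G)" for k
  proof -
    have v: "vanishes (Suc (Suc k)) \<Gamma> (\<lambda>x. G x - jet F k x)" using g(2)[of k] by (simp add: G_def jet del: vanishes.simps)
    have "vanishes k \<Gamma> (\<lambda>x. hess (\<lambda>x. G x - jet F k x) x + hess (jet F k) x)"
      by (rule vanishes_add[OF vanishes_hess[OF v] vanishes_hess_jet[OF F bc]])
    then show ?thesis using hess_diff[OF GC smooth_jet[OF F] UNIV_I] by simp
  qed
  moreover have "vanishes 2 \<Gamma> (\<lambda>x. G x - F x)" using g(2)[of 0] by (simp add: G_def numeral_2_eq_2 del: vanishes.simps)
  ultimately show ?thesis using GC by blast
qed

end

section \<open>Solving by the Newton potential\<close>

context symbol_complex
begin

text \<open>For the Newton potential \<open>g\<close> of the trace, \<open>hess g - H\<close> has Laplacian \<open>hess (tr H) - \<Delta>H\<close>,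
  which vanishes by the operator identity; Liouville's theorem applies to its components.\<close>

theorem compact_solution:
  assumes dim: "DIM('a) = 2 * m + 2" and m: "m \<ge> 1"
    and H: "smooth_cpt H" and c: "\<And>x. compat H x = 0"
  shows "\<exists>k. k \<noteq> 0 \<and> (\<forall>x. hess (\<lambda>x. k * corr (ikernel m 0) (\<lambda>x. tr (H x)) x) x = H x)"
proof -
  define k where "k = inverse (newton_const TYPE('a) m)"
  have k: "k \<noteq> 0" using newton_const_nonzero[OF dim m] by (simp add: k_def)
  define h where "h x = tr (H x)" for x
  define E where "E = (ikernel m 0 :: 'a \<Rightarrow> real)"
  have E: "loc_integrable E" unfolding E_def by (rule loc_integrable_newton[OF dim])
  have h: "smooth_cpt h" unfolding h_def[abs_def] by (rule smooth_cpt_linear[OF linear_tr H])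
  have Hh: "smooth_cpt (hess h)" by (rule smooth_cpt_hess[OF h])
  define g where "g x = k * corr E h x" for x
  have dg: "dderiv b (dderiv c g) x = k * corr E (dderiv b (dderiv c h)) x" for b c x
  proof -
    have 1: "dderiv b (\<lambda>x. k * corr E f x) = (\<lambda>x. k * corr E (dderiv b f) x)" if "smooth_cpt f" for b f
      using dderiv_linear[OF bounded_linear_mult_right smooth_differentiable[OF C_infinity_corr[OF E that]]]
        dderiv_corr[OF E that] by auto
    show ?thesis unfolding g_def[abs_def] 1[OF h] 1[OF smooth_cpt_dderiv[OF h]] ..
  qed
  have int: "integrable lborel (\<lambda>y. E y * (f (x + y) * q))" if "smooth_cpt f" for f q x
    using corr_integrable[OF E that, of x] integrable_mult_left[of q lborel] by (simp add: mult.assoc[symmetric])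
  have comp: "hess g x \<bullet> e = k * corr E (\<lambda>x. hess h x \<bullet> e) x" for x e
  proof -
    have s: "smooth_cpt (dderiv b (dderiv c h))" for b c by (intro smooth_cpt_dderiv h)
    have "corr E (\<lambda>x. hess h x \<bullet> e) x =
       (\<integral>y. (\<Sum>b\<in>Basis. \<Sum>c\<in>Basis. E y * (dderiv b (dderiv c h) (x + y) * (M b c \<bullet> e))) \<partial>lborel)"
      unfolding corr_def hess_def by (simp add: inner_sum_left sum_distrib_left)
    also have "\<dots> = (\<Sum>b\<in>Basis. \<Sum>c\<in>Basis. \<integral>y. E y * (dderiv b (dderiv c h) (x + y) * (M b c \<bullet> e)) \<partial>lborel)"
      by (simp add: int s)
    also have "\<dots> = (\<Sum>b\<in>Basis. \<Sum>c\<in>Basis. corr E (dderiv b (dderiv c h)) x * (M b c \<bullet> e))"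
      unfolding corr_def by (simp add: mult.assoc[symmetric])
    finally show ?thesis
      unfolding hess_def dg by (simp add: inner_sum_left sum_distrib_left mult.assoc)
  qed
  have "hess g p \<bullet> e - H p \<bullet> e = 0" for p e
  proof -
    define f where "f x = hess h x \<bullet> e" for x
    define He where "He x = H x \<bullet> e" for x
    have le: "bounded_linear (\<lambda>v::'v. v \<bullet> e)" by (rule bounded_linear_inner_left)
    have f: "smooth_cpt f" unfolding f_def[abs_def] by (rule smooth_cpt_linear[OF le Hh])
    have He: "smooth_cpt He" unfolding He_def[abs_def] by (rule smooth_cpt_linear[OF le H])
    define w where "w x = k * corr E f x - He x" for x
    have wC: "C_infinity UNIV w" unfolding w_def[abs_def]
      by (intro C_infinity_diff C_infinity_linear[OF bounded_linear_mult_right] C_infinity_corr E f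
          smooth_cpt_C_infinity He)
    have lap: "(\<Sum>b\<in>Basis. dderiv b (dderiv b w) x) = 0" for x
    proof -
      have d1: "dderiv b (\<lambda>x. k * corr E f x - g x) = (\<lambda>x. k * corr E (dderiv b f) x - dderiv b g x)"
        if "smooth_cpt f" "smooth_cpt g" for b f g
      proof
        fix x
        have "dderiv b (\<lambda>x. k * corr E f x - g x) x = dderiv b (\<lambda>x. k * corr E f x) x - dderiv b g x"
          by (intro dderiv_diff smooth_differentiable C_infinity_linear[OF bounded_linear_mult_right] C_infinity_corr E
              that smooth_cpt_C_infinity)
        also have "dderiv b (\<lambda>x. k * corr E f x) x = k * corr E (dderiv b f) x"
          using dderiv_linear[OF bounded_linear_mult_right smooth_differentiable[OF C_infinity_corr[OF E that(1)]]]
            dderiv_corr[OF E that(1)] by auto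
        finally show "dderiv b (\<lambda>x. k * corr E f x - g x) x = k * corr E (dderiv b f) x - dderiv b g x" .
      qed
      have "(\<Sum>b\<in>Basis. dderiv b (dderiv b w) x) =
          (\<Sum>b\<in>Basis. k * corr E (dderiv b (dderiv b f)) x - dderiv b (dderiv b He) x)"
        unfolding w_def[abs_def] d1[OF f He] d1[OF smooth_cpt_dderiv[OF f] smooth_cpt_dderiv[OF He]] ..
      also have "\<dots> = k * corr E (laplacian f) x - laplacian He x"
      proof -
        have "corr E (laplacian f) x = (\<Sum>b\<in>Basis. corr E (dderiv b (dderiv b f)) x)"
          unfolding corr_def laplacian_def sum_distrib_left
          by (rule Bochner_Integration.integral_sum) (intro corr_integrable E smooth_cpt_dderiv f)
        then show ?thesis by (simp add: laplacian_def sum_subtractf sum_distrib_left)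
      qed
      also have "k * corr E (laplacian f) x = f x"
        using laplacian_newton_potential[OF dim f, of x] k by (simp add: E_def k_def)
      also have "laplacian He x = laplacian H x \<bullet> e"
      proof -
        have 1: "dderiv b (\<lambda>x. q x \<bullet> e) = (\<lambda>x. dderiv b q x \<bullet> e)" if "smooth_cpt q" for b and q :: "'a \<Rightarrow> 'v"
          by (rule ext) (intro dderiv_linear[OF le] smooth_cpt_differentiable that)
        show ?thesis unfolding laplacian_def He_def[abs_def] 1[OF H] 1[OF smooth_cpt_dderiv[OF H]]
          by (simp add: inner_sum_left)
      qed
      also have "laplacian H x = hess h x"
      proof -
        have "compat H = (\<lambda>x. 0)" using c by auto
        then show ?thesis
          using laplacian_eq[OF smooth_cpt_C_infinity[OF H] UNIV_I, of x]
          by (simp add: h_def[abs_def] bounded_bilinear.zero_right[OF bilinear_P])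
      qed
      finally show ?thesis by (simp add: f_def)
    qed
    have "w p = 0"
    proof (rule decaying_harmonic_zero[where w=w and wd="\<lambda>b. dderiv b w" and wdd="\<lambda>b. dderiv b (dderiv b w)"])
      show "continuous_on UNIV w" by (rule C_infinity_continuous_on[OF wC])
      show "((\<lambda>t. w (x + t *\<^sub>R b)) has_real_derivative dderiv b w (x + t *\<^sub>R b)) (at t)" for x b t
        by (intro DERIV_along_line smooth_differentiable wC)
      show "((\<lambda>t. dderiv b w (x + t *\<^sub>R b)) has_real_derivative dderiv b (dderiv b w) (x + t *\<^sub>R b)) (at t)" for x b t
        by (intro DERIV_along_line smooth_differentiable C_infinity_dderiv wC)
      fix \<epsilon> :: real assume "\<epsilon> > 0"
      then have "\<epsilon> / \<bar>k\<bar> > 0" using k by simp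
      then obtain R1 where R1: "\<And>x. norm x > R1 \<Longrightarrow> \<bar>corr E f x\<bar> < \<epsilon> / \<bar>k\<bar>"
        using newton_potential_decay[OF dim m f] unfolding E_def by blast
      obtain R2 where R2: "\<And>x. norm x > R2 \<Longrightarrow> He x = 0" using He unfolding smooth_cpt_def by blast
      have "\<bar>w x\<bar> < \<epsilon>" if "norm x > max R1 R2" for x
        using R1[of x] R2[of x] that k by (simp add: w_def abs_mult field_simps)
      then show "\<exists>R. \<forall>x. norm x > R \<longrightarrow> \<bar>w x\<bar> < \<epsilon>" by blast
    qed (rule lap)
    then show ?thesis by (simp add: w_def f_def[abs_def] He_def comp)
  qed
  then have "hess g p = H p" for p
    by (metis (no_types, lifting) eq_iff_diff_eq_0 vector_eq_rdot)
  then show ?thesis using k unfolding g_def[abs_def] h_def[abs_def] E_def by blast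
qed

end

section \<open>Extension by zero\<close>

definition cut :: "'a set \<Rightarrow> ('a \<Rightarrow> 'b::zero) \<Rightarrow> 'a \<Rightarrow> 'b" where
  "cut \<Omega> f x = (if x \<in> \<Omega> then f x else 0)"

text \<open>At a frontier point \<open>f\<close> vanishes together with its first derivatives, so both \<open>f\<close> and zero
  are \<open>o(\<bar>y - x\<bar>)\<close>.\<close>

lemma cut_has_derivative:
  fixes f :: "'a::euclidean_space \<Rightarrow> 'b::real_normed_vector"
  assumes \<Omega>: "open \<Omega>" and f: "\<And>k. vanishes k (frontier \<Omega>) f"
  shows "(cut \<Omega> f has_derivative (\<lambda>v. cut \<Omega> (dderiv v f) x)) (at x)"
proof -
  have d: "(f has_derivative (\<lambda>v. dderiv v f x)) (at x)" for x
    by (rule has_derivative_dderiv[OF vanishes_differentiable[OF f]])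
  consider "x \<in> \<Omega>" | "x \<in> frontier \<Omega>" | "x \<in> - closure \<Omega>"
    using frontier_def[of \<Omega>] interior_open[OF \<Omega>] by blast
  then show ?thesis
  proof cases
    case 1
    have "(cut \<Omega> f has_derivative (\<lambda>v. dderiv v f x)) (at x)"
      by (rule has_derivative_transform_within_open[OF d \<Omega> 1]) (simp add: cut_def)
    then show ?thesis using 1 by (simp add: cut_def)
  next
    case 2
    then have x: "x \<notin> \<Omega>" using \<Omega> frontier_disjoint_eq by fastforce
    have v: "vanishes 2 (frontier \<Omega>) f" by (rule f)
    then have fx: "f x = 0" "\<And>b. b \<in> Basis \<Longrightarrow> dderiv b f x = 0" using 2 by (auto simp: numeral_2_eq_2)
    have "dderiv v f x = 0" for v
      using dderiv_expand[OF vanishes_differentiable[OF v], of v x] fx(2) by simp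
    then have "(f has_derivative (\<lambda>v. 0)) (at x)" using d[of x] by simp
    then have lim: "\<And>e. e > 0 \<Longrightarrow> \<exists>d>0. \<forall>y. norm (y - x) < d \<longrightarrow> norm (f y) \<le> e * norm (y - x)"
      unfolding has_derivative_at_alt by (simp add: fx(1))
    have "(cut \<Omega> f has_derivative (\<lambda>v. 0)) (at x)"
      unfolding has_derivative_at_alt
    proof (intro conjI allI impI)
      fix e :: real assume e: "e > 0"
      obtain d where "d > 0" "\<And>y. norm (y - x) < d \<Longrightarrow> norm (f y) \<le> e * norm (y - x)" using lim[OF e] by blast
      then show "\<exists>d>0. \<forall>y. norm (y - x) < d \<longrightarrow> norm (cut \<Omega> f y - cut \<Omega> f x - 0) \<le> e * norm (y - x)"
        using x e by (intro exI[of _ d]) (auto simp: cut_def)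
    qed simp
    then show ?thesis using x by (simp add: cut_def)
  next
    case 3
    have "(cut \<Omega> f has_derivative (\<lambda>v. 0)) (at x)"
      by (rule has_derivative_transform_within_open[OF has_derivative_const[of 0] _ 3])
         (use closure_subset in \<open>auto simp: cut_def\<close>)
    moreover have "x \<notin> \<Omega>" using 3 closure_subset by blast
    ultimately show ?thesis by (simp add: cut_def)
  qed
qed

lemma dderiv_cut:
  assumes "open \<Omega>" "\<And>k. vanishes k (frontier \<Omega>) f"
  shows "dderiv v (cut \<Omega> f) = cut \<Omega> (dderiv v f)"
  by (rule ext) (rule dderiv_eq[OF cut_has_derivative[OF assms]])

lemma C_infinity_cut:
  assumes \<Omega>: "open \<Omega>" and f: "\<And>k. vanishes k (frontier \<Omega>) f"
  shows "C_infinity UNIV (cut \<Omega> f)"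
proof (rule C_infinity_coinduct[where P="\<lambda>h. \<exists>f. (\<forall>k. vanishes k (frontier \<Omega>) f) \<and> h = cut \<Omega> f"])
  show "h differentiable (at x)" if "\<exists>f. (\<forall>k. vanishes k (frontier \<Omega>) f) \<and> h = cut \<Omega> f" for h x
    using that cut_has_derivative[OF \<Omega>] unfolding differentiable_def by blast
  fix h and b :: 'a assume "\<exists>f. (\<forall>k. vanishes k (frontier \<Omega>) f) \<and> h = cut \<Omega> f" and b: "b \<in> Basis"
  then obtain f where f: "\<And>k. vanishes k (frontier \<Omega>) f" "h = cut \<Omega> f" by blast
  have "\<And>k. vanishes k (frontier \<Omega>) (dderiv b f)" using vanishes_dderiv[OF f(1) b] .
  then show "\<exists>g. (\<exists>f. (\<forall>k. vanishes k (frontier \<Omega>) f) \<and> g = cut \<Omega> f) \<and> (\<forall>x\<in>UNIV. dderiv b h x = g x)"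
    using dderiv_cut[OF \<Omega> f(1), of b] f(2) by auto
qed (use f in auto)

section \<open>Geometry of a defining function\<close>

lemma grad_inner_Basis: "b \<in> Basis \<Longrightarrow> grad f x \<bullet> b = dderiv b f x"
  unfolding grad_def by (simp add: inner_sum_left inner_Basis if_distrib sum.delta cong: if_cong)

lemma grad_inner:
  assumes "f differentiable (at x)"
  shows "grad f x \<bullet> v = dderiv v f x"
proof -
  have "dderiv v f x = (\<Sum>b\<in>Basis. (v \<bullet> b) * (grad f x \<bullet> b))"
    unfolding dderiv_expand[OF assms, where v=v] by (intro sum.cong refl) (simp add: grad_inner_Basis)
  then show ?thesis by (simp add: euclidean_inner[of "grad f x" v] mult.commute)
qed

lemma differentiable_estimate:
  fixes f :: "'a::euclidean_space \<Rightarrow> real"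
  assumes "f differentiable (at p)" "e > 0"
  shows "\<exists>d>0. \<forall>h. norm h < d \<longrightarrow> \<bar>f (p + h) - f p - dderiv h f p\<bar> \<le> e * norm h"
proof -
  obtain d where d: "d > 0" "\<And>y. norm (y - p) < d \<Longrightarrow> norm (f y - f p - dderiv (y - p) f p) \<le> e * norm (y - p)"
    using has_derivative_dderiv[OF assms(1)] assms(2) unfolding has_derivative_at_alt by blast
  have "\<bar>f (p + h) - f p - dderiv h f p\<bar> \<le> e * norm h" if "norm h < d" for h
    using d(2)[of "p + h"] that by simp
  then show ?thesis using d(1) by blast
qed

text \<open>By the intermediate value theorem there is, for small \<open>t\<close>, a zero of \<open>\<rho>\<close> at
  \<open>p + t v + s n\<close> with \<open>\<bar>s\<bar> \<le> \<eta> t\<close>, where \<open>n\<close> is the gradient and \<open>\<eta>\<close> any prescribed positive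
  number. As \<open>g\<close> vanishes there, its derivative along \<open>v\<close> is at most \<open>\<eta>\<close> times that along \<open>n\<close>,
  up to a small error.\<close>

lemma tangent_derivative_zero:
  fixes \<rho> g :: "'a::euclidean_space \<Rightarrow> real"
  assumes W: "open W" "C_infinity W \<rho>" and p: "p \<in> W" "\<rho> p = 0" and \<nu>: "grad \<rho> p \<noteq> 0"
    and g: "g differentiable (at p)" and z: "\<And>q. q \<in> W \<Longrightarrow> \<rho> q = 0 \<Longrightarrow> g q = 0"
    and v: "v \<bullet> grad \<rho> p = 0"
  shows "dderiv v g p = 0"
proof (rule ccontr)
  assume a: "dderiv v g p \<noteq> 0"
  define n where "n = grad \<rho> p"
  have nn: "n \<bullet> n > 0" using \<nu> by (simp add: n_def)
  have \<rho>d: "\<rho> differentiable (at p)" by (rule C_infinity_differentiable[OF W(2) p(1)])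
  define A where "A = \<bar>dderiv v g p\<bar>"
  define c where "c = \<bar>dderiv n g p\<bar>"
  have A: "A > 0" using a by (simp add: A_def)
  define \<eta> where "\<eta> = min 1 (A / (4 * (c + 1)))"
  have \<eta>: "\<eta> > 0" "\<eta> \<le> 1" using A by (auto simp: \<eta>_def c_def)
  have \<eta>c: "\<eta> * c \<le> A / 4"
  proof -
    have "\<eta> * c \<le> A / (4 * (c + 1)) * (c + 1)"
      by (intro mult_mono) (use A in \<open>auto simp: \<eta>_def c_def\<close>)
    also have "\<dots> = A / 4"
    proof -
      have "c + 1 > 0" by (simp add: c_def add_nonneg_pos)
      then show ?thesis by (simp add: field_simps)
    qed
    finally show ?thesis .
  qed
  define L where "L = norm v + norm n + 1"
  have L: "L > 0" unfolding L_def by (smt (verit) norm_ge_zero)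
  \<comment> \<open>The error bounds are chosen so that \<open>\<rho>\<close> still changes sign between \<open>s = -\<eta> t\<close> and
    \<open>s = \<eta> t\<close>, and the error for \<open>g\<close> is a quarter of the derivative to be excluded.\<close>
  define e1 where "e1 = \<eta> * (n \<bullet> n) / (2 * L)"
  define e2 where "e2 = A / (4 * L)"
  have e: "e1 > 0" "e2 > 0" using \<eta> nn L A by (auto simp: e1_def e2_def)
  obtain d0 where d0: "d0 > 0" "ball p d0 \<subseteq> W" using W(1) p(1) openE by blast
  obtain d1 where d1: "d1 > 0" "\<And>h. norm h < d1 \<Longrightarrow> \<bar>\<rho> (p + h) - \<rho> p - dderiv h \<rho> p\<bar> \<le> e1 * norm h"
    using differentiable_estimate[OF \<rho>d e(1)] by blast
  obtain d2 where d2: "d2 > 0" "\<And>h. norm h < d2 \<Longrightarrow> \<bar>g (p + h) - g p - dderiv h g p\<bar> \<le> e2 * norm h"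
    using differentiable_estimate[OF g e(2)] by blast
  define d where "d = min d0 (min d1 d2)"
  have d: "d > 0" using d0 d1 d2 by (simp add: d_def)
  define t where "t = d / (2 * L)"
  have t: "t > 0" using d L by (simp add: t_def)
  have tL: "t * L = d / 2" using L by (simp add: t_def)
  define h where "h s = t *\<^sub>R v + s *\<^sub>R n" for s
  have hn: "norm (h s) \<le> t * L" "norm (h s) < d" if "\<bar>s\<bar> \<le> \<eta> * t" for s
  proof -
    have "\<bar>s\<bar> \<le> 1 * t" using that mult_right_mono[OF \<eta>(2), of t] t by linarith
    then have "\<bar>s\<bar> * norm n \<le> t * norm n" by (intro mult_right_mono) auto
    then have "norm (h s) \<le> t * norm v + t * norm n"
      unfolding h_def using norm_triangle_ineq[of "t *\<^sub>R v" "s *\<^sub>R n"] t by simp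
    also have "\<dots> \<le> t * L" using t by (simp add: L_def algebra_simps)
    finally show "norm (h s) \<le> t * L" .
    then show "norm (h s) < d" using tL d by simp
  qed
  have inW: "p + h s \<in> W" if "\<bar>s\<bar> \<le> \<eta> * t" for s
    using hn(2)[OF that] d0 by (auto simp: d_def dist_norm)
  have lin: "dderiv (h s) f p = t * dderiv v f p + s * dderiv n f p" if "f differentiable (at p)" for s and f :: "'a \<Rightarrow> real"
    using linear_simps(1,5)[OF dderiv_bounded_linear[OF that]] by (simp add: h_def)
  have \<rho>h: "\<bar>\<rho> (p + h s) - s * (n \<bullet> n)\<bar> \<le> \<eta> * t * (n \<bullet> n) / 2" if "\<bar>s\<bar> \<le> \<eta> * t" for s
  proof -
    have "\<bar>\<rho> (p + h s) - \<rho> p - dderiv (h s) \<rho> p\<bar> \<le> e1 * norm (h s)"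
      by (rule d1(2)) (use hn(2)[OF that] d_def in auto)
    also have "\<dots> \<le> e1 * (t * L)" using hn(1)[OF that] e by (intro mult_left_mono) auto
    also have "\<dots> = \<eta> * t * (n \<bullet> n) / 2" using L by (simp add: e1_def)
    finally have "\<bar>\<rho> (p + h s) - \<rho> p - dderiv (h s) \<rho> p\<bar> \<le> \<eta> * t * (n \<bullet> n) / 2" .
    moreover have "dderiv (h s) \<rho> p = s * (n \<bullet> n)"
      using lin[OF \<rho>d, of s] grad_inner[OF \<rho>d, of v] grad_inner[OF \<rho>d, of n] v
      by (simp add: n_def inner_commute)
    ultimately show ?thesis using p(2) by simp
  qed
  have "\<exists>s. - (\<eta> * t) \<le> s \<and> s \<le> \<eta> * t \<and> \<rho> (p + h s) = 0"
  proof (rule IVT')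
    have pos: "\<eta> * t * (n \<bullet> n) > 0" using \<eta> t nn by simp
    have st: "\<bar>- (\<eta> * t)\<bar> \<le> \<eta> * t" "\<bar>\<eta> * t\<bar> \<le> \<eta> * t" using \<eta> t by auto
    show "\<rho> (p + h (- (\<eta> * t))) \<le> 0" using abs_le_D1[OF \<rho>h[OF st(1)]] pos by simp
    show "0 \<le> \<rho> (p + h (\<eta> * t))" using abs_le_D2[OF \<rho>h[OF st(2)]] pos by simp
    show "- (\<eta> * t) \<le> \<eta> * t" using \<eta> t by simp
    show "continuous_on {- (\<eta> * t)..\<eta> * t} (\<lambda>s. \<rho> (p + h s))"
    proof (rule continuous_on_compose2[OF C_infinity_continuous_on[OF W(2)]])
      show "continuous_on {- (\<eta> * t)..\<eta> * t} (\<lambda>s. p + h s)"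
        unfolding h_def by (intro continuous_intros)
    qed (auto intro!: inW simp: abs_le_iff)
  qed
  then obtain s where s': "- (\<eta> * t) \<le> s" "s \<le> \<eta> * t" "\<rho> (p + h s) = 0" by blast
  have s: "\<bar>s\<bar> \<le> \<eta> * t" "\<rho> (p + h s) = 0" using s' by auto
  have "g (p + h s) = 0" "g p = 0" using z inW[OF s(1)] s(2) p by auto
  moreover have "\<bar>g (p + h s) - g p - dderiv (h s) g p\<bar> \<le> e2 * norm (h s)"
    by (rule d2(2)) (use hn(2)[OF s(1)] d_def in auto)
  ultimately have "\<bar>dderiv (h s) g p\<bar> \<le> e2 * norm (h s)" by simp
  moreover have "e2 * norm (h s) \<le> e2 * (t * L)" using hn(1)[OF s(1)] e by (intro mult_left_mono) auto
  moreover have "e2 * (t * L) = t * A / 4" using L by (simp add: e2_def)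
  ultimately have "\<bar>t * dderiv v g p + s * dderiv n g p\<bar> \<le> t * A / 4"
    unfolding lin[OF g] by linarith
  then have "\<bar>t * dderiv v g p\<bar> \<le> \<bar>s * dderiv n g p\<bar> + t * A / 4" by linarith
  moreover have "\<bar>s * dderiv n g p\<bar> \<le> \<eta> * t * c" unfolding abs_mult c_def using s(1) by (intro mult_right_mono) auto
  moreover have "\<eta> * t * c \<le> t * A / 4" using mult_left_mono[OF \<eta>c, of t] t by (simp add: mult_ac)
  moreover have "\<bar>t * dderiv v g p\<bar> = t * A" using t by (simp add: abs_mult A_def)
  ultimately have "t * A \<le> t * A / 2" by linarith
  moreover have "t * A > 0" using t A by simp
  ultimately show False by linarith
qed

text \<open>Moving from \<open>x\<close> along a fixed gradient direction one meets \<open>\<Gamma>\<close> after a distance comparable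
  to \<open>\<bar>\<rho> x\<bar>\<close>; the quadratic Taylor estimate at that point bounds \<open>w x\<close>. Compactness makes the
  constant uniform.\<close>

lemma boundary_quadratic_bound:
  fixes \<rho> w :: "'a::euclidean_space \<Rightarrow> real"
  assumes W: "open W" "C_infinity W \<rho>" and \<Gamma>: "compact \<Gamma>" "\<Gamma> = {x\<in>W. \<rho> x = 0}"
    and \<nu>: "\<And>x. x \<in> \<Gamma> \<Longrightarrow> grad \<rho> x \<noteq> 0"
    and w: "smooth_cpt w" "vanishes 2 \<Gamma> w"
  shows "\<exists>V C. open V \<and> \<Gamma> \<subseteq> V \<and> (\<forall>x\<in>V. \<bar>w x\<bar> \<le> C * (\<rho> x)\<^sup>2)"
proof -
  obtain K where K: "K \<ge> 0" "\<And>x v. norm (w (x + v) - w x - dderiv v w x) \<le> K * (norm v)\<^sup>2"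
    using smooth_cpt_Taylor2[OF w(1)] by blast
  have w0: "w q = 0" "dderiv v w q = 0" if "q \<in> \<Gamma>" for q v
  proof -
    have "\<And>b. b \<in> Basis \<Longrightarrow> dderiv b w q = 0" using w(2) that by (simp add: numeral_2_eq_2)
    then show "dderiv v w q = 0" using dderiv_expand[OF vanishes_differentiable[OF w(2)], of v q] by simp
    show "w q = 0" using w(2) that by (simp add: numeral_2_eq_2)
  qed
  have "\<exists>V C. open V \<and> p \<in> V \<and> C \<ge> 0 \<and> (\<forall>x\<in>V. \<bar>w x\<bar> \<le> C * (\<rho> x)\<^sup>2)" if p: "p \<in> \<Gamma>" for p
  proof -
    define n where "n = grad \<rho> p"
    have nn: "norm n > 0" using \<nu>[OF p] by (simp add: n_def)
    define c where "c = (norm n)\<^sup>2 / 2"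
    have c: "c > 0" using nn by (simp add: c_def)
    have pW: "p \<in> W" "\<rho> p = 0" using p \<Gamma>(2) by auto
    have "dderiv n \<rho> p = n \<bullet> n"
      using grad_inner[OF C_infinity_differentiable[OF W(2) pW(1)], of n] by (simp add: n_def)
    then have big: "dderiv n \<rho> p > c" using nn by (simp add: c_def power2_norm_eq_inner)
    have co: "continuous_on W (dderiv n \<rho>)" by (intro C_infinity_continuous_on C_infinity_dderiv W)
    have cr: "continuous_on W \<rho>" by (rule C_infinity_continuous_on[OF W(2)])
    have "open (dderiv n \<rho> -` {c<..} \<inter> W)" by (rule continuous_on_open_vimage[THEN iffD1, rule_format, OF W(1) co]) simp
    moreover have "p \<in> dderiv n \<rho> -` {c<..} \<inter> W" using big pW by simp
    ultimately obtain d where d: "d > 0" "ball p d \<subseteq> dderiv n \<rho> -` {c<..} \<inter> W" using openE by blast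
    define S where "S = d / (2 * norm n)"
    have S: "S > 0" using d nn by (simp add: S_def)
    have "open (\<rho> -` {- (c * S)<..<c * S} \<inter> W)"
      by (rule continuous_on_open_vimage[THEN iffD1, rule_format, OF W(1) cr]) simp
    then have oV: "open (ball p (d / 2) \<inter> (\<rho> -` {- (c * S)<..<c * S} \<inter> W))" by auto
    have "\<bar>w x\<bar> \<le> K * (norm n)\<^sup>2 / c\<^sup>2 * (\<rho> x)\<^sup>2"
      if x: "x \<in> ball p (d / 2) \<inter> (\<rho> -` {- (c * S)<..<c * S} \<inter> W)" for x
    proof -
      have near: "x + s *\<^sub>R n \<in> ball p d" if "\<bar>s\<bar> \<le> S" for s
      proof -
        have "norm (s *\<^sub>R n) \<le> d / 2"
          using mult_right_mono[OF that, of "norm n"] nn by (simp add: S_def)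
        moreover have "dist p (x + s *\<^sub>R n) \<le> dist p x + norm (s *\<^sub>R n)"
          using dist_triangle[of p "x + s *\<^sub>R n" x] by (simp add: dist_norm)
        ultimately show ?thesis using x by simp
      qed
      have nearW: "x + s *\<^sub>R n \<in> W" "dderiv n \<rho> (x + s *\<^sub>R n) > c" if "\<bar>s\<bar> \<le> S" for s
        using near[OF that] d(2) by auto
      define s0 where "s0 = \<bar>\<rho> x\<bar> / c"
      have s0: "0 \<le> s0" "s0 \<le> S" using x c by (auto simp: s0_def field_simps abs_le_iff)
      have cline: "continuous_on {a..b} (\<lambda>s. \<rho> (x + s *\<^sub>R n))" if "- S \<le> a" "b \<le> S" for a b
        by (rule continuous_on_compose2[OF cr]) (use that in \<open>auto intro!: continuous_intros nearW\<close>)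
      have mvt: "\<rho> (x + b *\<^sub>R n) - \<rho> (x + a *\<^sub>R n) \<ge> c * (b - a)" if "- S \<le> a" "a \<le> b" "b \<le> S" for a b
      proof (cases "a = b")
        case False
        then have "a < b" using that by simp
        moreover have "((\<lambda>s. \<rho> (x + s *\<^sub>R n)) has_real_derivative dderiv n \<rho> (x + s *\<^sub>R n)) (at s)"
          if "a \<le> s" "s \<le> b" for s
          using \<open>- S \<le> a\<close> \<open>b \<le> S\<close> that by (intro DERIV_along_line C_infinity_differentiable[OF W(2)] nearW) auto
        ultimately obtain z where z: "a < z" "z < b"
          "\<rho> (x + b *\<^sub>R n) - \<rho> (x + a *\<^sub>R n) = (b - a) * dderiv n \<rho> (x + z *\<^sub>R n)"
          using MVT2[of a b "\<lambda>s. \<rho> (x + s *\<^sub>R n)" "\<lambda>s. dderiv n \<rho> (x + s *\<^sub>R n)"] by blast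
        have "dderiv n \<rho> (x + z *\<^sub>R n) > c" by (rule nearW) (use z that in auto)
        then show ?thesis unfolding z(3) using \<open>a < b\<close> by (simp add: mult.commute mult_left_mono)
      qed simp
      have "\<exists>s. \<bar>s\<bar> \<le> s0 \<and> \<rho> (x + s *\<^sub>R n) = 0"
      proof (cases "\<rho> x \<le> 0")
        case True
        have "\<exists>s. 0 \<le> s \<and> s \<le> s0 \<and> \<rho> (x + s *\<^sub>R n) = 0"
        proof (rule IVT')
          show "0 \<le> \<rho> (x + s0 *\<^sub>R n)" using mvt[of 0 s0] s0 S True c by (simp add: s0_def)
        qed (use True s0 S cline in auto)
        then show ?thesis by (metis abs_of_nonneg)
      next
        case False
        have "\<exists>s. - s0 \<le> s \<and> s \<le> 0 \<and> \<rho> (x + s *\<^sub>R n) = 0"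
        proof (rule IVT')
          show "\<rho> (x + (- s0) *\<^sub>R n) \<le> 0" using mvt[of "- s0" 0] s0 S False c by (simp add: s0_def)
        qed (use False s0 S cline in auto)
        then obtain s where "- s0 \<le> s" "s \<le> 0" "\<rho> (x + s *\<^sub>R n) = 0" by blast
        then show ?thesis by (intro exI[of _ s]) auto
      qed
      then obtain s where s: "\<bar>s\<bar> \<le> s0" "\<rho> (x + s *\<^sub>R n) = 0" by blast
      define q where "q = x + s *\<^sub>R n"
      have q: "q \<in> \<Gamma>" unfolding \<Gamma>(2) q_def using s s0 nearW by auto
      have "x = q + (- s) *\<^sub>R n" by (simp add: q_def)
      then have "\<bar>w x\<bar> \<le> K * (norm ((- s) *\<^sub>R n))\<^sup>2" using K(2)[of q "(- s) *\<^sub>R n"] w0[OF q] by simp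
      also have "\<dots> = K * (norm n)\<^sup>2 * \<bar>s\<bar>\<^sup>2" by (simp add: power_mult_distrib)
      also have "\<dots> \<le> K * (norm n)\<^sup>2 * s0\<^sup>2" using s(1) K(1) by (intro mult_left_mono power_mono) auto
      also have "\<dots> = K * (norm n)\<^sup>2 / c\<^sup>2 * (\<rho> x)\<^sup>2" by (simp add: s0_def power_divide)
      finally show ?thesis .
    qed
    moreover have "p \<in> ball p (d / 2) \<inter> (\<rho> -` {- (c * S)<..<c * S} \<inter> W)"
      using pW d c S by (simp add: mult_pos_pos)
    moreover have "K * (norm n)\<^sup>2 / c\<^sup>2 \<ge> 0" using K by simp
    ultimately show ?thesis using oV by blast
  qed
  then obtain V C where VC: "\<And>p. p \<in> \<Gamma> \<Longrightarrow> open (V p) \<and> p \<in> V p \<and> C p \<ge> (0::real) \<and> (\<forall>x\<in>V p. \<bar>w x\<bar> \<le> C p * (\<rho> x)\<^sup>2)"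
    by metis
  obtain D where D: "D \<subseteq> \<Gamma>" "finite D" "\<Gamma> \<subseteq> (\<Union>p\<in>D. V p)"
    by (rule compactE_image[OF \<Gamma>(1), of \<Gamma> V]) (use VC in auto)
  have "\<bar>w x\<bar> \<le> (\<Sum>p\<in>D. C p) * (\<rho> x)\<^sup>2" if x: "x \<in> (\<Union>p\<in>D. V p)" for x
  proof -
    obtain p where p: "p \<in> D" "x \<in> V p" using x by blast
    have "C p \<le> (\<Sum>p\<in>D. C p)" using VC D by (intro member_le_sum p) auto
    then have "C p * (\<rho> x)\<^sup>2 \<le> (\<Sum>p\<in>D. C p) * (\<rho> x)\<^sup>2" by (intro mult_right_mono) auto
    then show ?thesis using VC[of p] p D(1) by fastforce
  qed
  moreover have "open (\<Union>p\<in>D. V p)" using VC D(1) by blast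
  ultimately show ?thesis using D(3) by blast
qed

section \<open>The boundary condition contained in the weak equation\<close>

text \<open>Blowing up at \<open>p\<close> turns \<open>\<Omega>\<close> into the half space \<open>{y. n \<bullet> y < 0}\<close> and \<open>Y\<close> into the constant
  field \<open>Y p\<close>; in the limit, the integral of a bump over the half space has zero derivative when
  the bump is translated along \<open>Y p\<close>. If \<open>Y p\<close> were transversal, such a translation would carry
  the bump from outside the half space to its inside.\<close>

lemma weak_normal_component_zero:
  fixes Y :: "'a::euclidean_space \<Rightarrow> 'a" and \<rho> :: "'a \<Rightarrow> real"
  assumes Y: "continuous_on UNIV Y" and B: "\<And>x. norm (Y x) \<le> B"
    and \<Omega>: "open \<Omega>" and W: "open W" "\<Omega> = {x\<in>W. \<rho> x < 0}" and p: "p \<in> W" "\<rho> p = 0"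
    and \<rho>: "\<rho> differentiable (at p)" and \<nu>: "grad \<rho> p \<noteq> 0"
    and V: "open V" "p \<in> V"
    and weak: "\<And>\<phi> :: 'a \<Rightarrow> real. smooth_cpt \<phi> \<Longrightarrow> closure {x. \<phi> x \<noteq> 0} \<subseteq> V \<Longrightarrow>
      (\<integral>x. indicator \<Omega> x * dderiv (Y x) \<phi> x \<partial>lborel) = 0"
  shows "Y p \<bullet> grad \<rho> p = 0"
proof (rule ccontr)
  assume ne: "Y p \<bullet> grad \<rho> p \<noteq> 0"
  define n where "n = grad \<rho> p"
  define k where "k = (indicator {y. n \<bullet> y < 0} :: 'a \<Rightarrow> real)"
  define \<phi> where "\<phi> = (ball_bump 0 1 :: 'a \<Rightarrow> real)"
  have \<phi>: "smooth_cpt \<phi>"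
    unfolding smooth_cpt_def \<phi>_def
    by (intro conjI C_infinity_ball_bump exI[of _ 2]) (auto intro!: ball_bump_eq_0 simp: dist_norm)
  have half: "open {y. n \<bullet> y < 0}" by (intro open_Collect_less continuous_intros)
  have km[measurable]: "k \<in> borel_measurable borel" unfolding k_def using half by simp
  have k: "loc_integrable k"
    unfolding loc_integrable_def
  proof (intro conjI allI km)
    fix R :: real
    have "integrable lborel (\<lambda>y::'a. indicator (cball 0 R) y *\<^sub>R k y)"
      by (rule integrableI_bounded_set_indicator[where B=1])
         (use emeasure_bounded_finite[OF bounded_cball[of 0 R]] in \<open>auto simp: k_def indicator_def\<close>)
    then show "integrable lborel (\<lambda>y. indicator (cball 0 R) y * k y)" by simp
  qed
  have hyper: "AE y in lborel. n \<bullet> y \<noteq> 0"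
  proof -
    have "negligible {y. n \<bullet> y = 0}" using \<nu> by (intro negligible_hyperplane) (simp add: n_def)
    moreover have "closed {y. n \<bullet> y = 0}" by (rule closed_hyperplane)
    ultimately have "{y. n \<bullet> y = 0} \<in> null_sets lborel"
      by (auto simp: null_sets_completion_iff negligible_iff_null_sets)
    from AE_not_in[OF this] show ?thesis by simp
  qed
  define \<delta> where "\<delta> j = inverse (real (Suc j))" for j
  have \<delta>: "\<delta> j > 0" for j by (simp add: \<delta>_def)
  have lim\<delta>: "\<delta> \<longlonglongrightarrow> 0" unfolding \<delta>_def[abs_def] by (rule LIMSEQ_inverse_real_of_nat)
  \<comment> \<open>The limit of the rescaled equation, for the bump translated by \<open>s\<close>.\<close>
  have key: "corr k (dderiv (Y p) \<phi>) s = 0" for s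
  proof -
    define \<psi> where "\<psi> y = \<phi> (s + 1 *\<^sub>R y)" for y
    have \<psi>C: "C_infinity UNIV \<psi>" unfolding \<psi>_def[abs_def]
      by (rule C_infinity_affine[OF smooth_cpt_C_infinity[OF \<phi>]]) auto
    define R where "R = norm s + 2"
    have R: "R > 0" by (simp add: R_def add_nonneg_pos)
    have \<psi>0: "\<psi> y = 0" if "norm y > R" for y
    proof -
      have "norm (s + y) \<ge> 2" using that norm_triangle_ineq4[of "s + y" s] by (simp add: R_def)
      then show ?thesis unfolding \<psi>_def \<phi>_def by (intro ball_bump_eq_0) (auto simp: dist_norm)
    qed
    have \<psi>: "smooth_cpt \<psi>" using \<psi>C \<psi>0 unfolding smooth_cpt_def by blast
    have \<psi>d: "dderiv v \<psi> y = dderiv v \<phi> (s + y)" for v y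
      unfolding \<psi>_def[abs_def] by (subst dderiv_affine) (auto intro: smooth_cpt_differentiable \<phi>)
    have o: "open {x::'a. norm x > R}" by (intro open_Collect_less continuous_intros)
    have \<psi>d0: "dderiv v \<psi> y = 0" if "norm y > R" for v y
      using dderiv_cong[OF o, of y \<psi> "\<lambda>x. 0" v] that \<psi>0 by simp
    obtain L where L: "L \<ge> 0" "\<And>v y. \<bar>dderiv v \<psi> y\<bar> \<le> L * norm v"
      using smooth_cpt_dderiv_bound[OF \<psi>] by (metis real_norm_def)
    obtain r0 where r0: "r0 > 0" "cball p r0 \<subseteq> V" using V open_contains_cball_eq by metis
    define f where "f j y = indicator \<Omega> (p + \<delta> j *\<^sub>R y) * dderiv (Y (p + \<delta> j *\<^sub>R y)) \<psi> y" for j y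
    define f0 where "f0 y = k y * dderiv (Y p) \<psi> y" for y
    have expand: "dderiv v \<psi> y = (\<Sum>b\<in>Basis. (v \<bullet> b) * dderiv b \<psi> y)" for v y
      using dderiv_expand[OF smooth_cpt_differentiable[OF \<psi>], of v y] by simp
    have dm[measurable]: "dderiv b \<psi> \<in> borel_measurable borel" for b
      by (intro borel_measurable_continuous_onI C_infinity_continuous_on C_infinity_dderiv \<psi>C)
    have Ym[measurable]: "Y \<in> borel_measurable borel" by (rule borel_measurable_continuous_onI[OF Y])
    have \<Omega>m[measurable]: "\<Omega> \<in> sets borel" using \<Omega> by simp
    have fm: "f j \<in> borel_measurable borel" for j
    proof -
      have "f j = (\<lambda>y. indicator \<Omega> (p + \<delta> j *\<^sub>R y) * (\<Sum>b\<in>Basis. (Y (p + \<delta> j *\<^sub>R y) \<bullet> b) * dderiv b \<psi> y))"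
        unfolding f_def[abs_def] by (intro ext arg_cong2[where f="(*)"] refl expand)
      also have "\<dots> \<in> borel_measurable borel" by measurable
      finally show ?thesis .
    qed
    have f0m: "f0 \<in> borel_measurable borel"
    proof -
      have "f0 = (\<lambda>y. k y * (\<Sum>b\<in>Basis. (Y p \<bullet> b) * dderiv b \<psi> y))"
        unfolding f0_def[abs_def] by (intro ext arg_cong2[where f="(*)"] refl expand)
      also have "\<dots> \<in> borel_measurable borel" by measurable
      finally show ?thesis .
    qed
    have conv: "(\<lambda>j. \<integral>y. f j y \<partial>lborel) \<longlonglongrightarrow> (\<integral>y. f0 y \<partial>lborel)"
    proof (rule integral_dominated_convergence[where w="\<lambda>y. L * B * indicator (cball 0 R) y"])
      show "integrable lborel (\<lambda>y. L * B * indicator (cball 0 R) y)"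
        by (intro integrable_mult_right integrable_real_indicator)
           (use emeasure_bounded_finite[OF bounded_cball[of 0 R]] in auto)
      have "\<bar>f j y\<bar> \<le> L * B * indicator (cball 0 R) y" for j y
      proof (cases "norm y > R")
        case True
        then show ?thesis by (simp add: f_def \<psi>d0)
      next
        case False
        have "\<bar>dderiv (Y (p + \<delta> j *\<^sub>R y)) \<psi> y\<bar> \<le> L * B"
          using L(2)[of "Y (p + \<delta> j *\<^sub>R y)" y] mult_left_mono[OF B[of "p + \<delta> j *\<^sub>R y"] L(1)] by simp
        then show ?thesis using False by (auto simp: f_def indicator_def abs_mult)
      qed
      then show "AE y in lborel. norm (f j y) \<le> L * B * indicator (cball 0 R) y" for j by simp
      show "AE y in lborel. (\<lambda>j. f j y) \<longlonglongrightarrow> f0 y" using hyper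
      proof eventually_elim
        case (elim y)
        have py: "(\<lambda>j. p + \<delta> j *\<^sub>R y) \<longlonglongrightarrow> p"
          using tendsto_add[OF tendsto_const[of p] tendsto_scaleR[OF lim\<delta> tendsto_const[of y]]] by simp
        have "(\<lambda>j. Y (p + \<delta> j *\<^sub>R y)) \<longlonglongrightarrow> Y p"
          using Y by (intro isCont_tendsto_compose[OF _ py]) (simp add: continuous_on_eq_continuous_at)
        then have Ylim: "(\<lambda>j. dderiv (Y (p + \<delta> j *\<^sub>R y)) \<psi> y) \<longlonglongrightarrow> dderiv (Y p) \<psi> y"
          unfolding expand[of "Y p"] expand[of "Y (p + _)"] by (intro tendsto_intros)
        have inW: "\<forall>\<^sub>F j in sequentially. p + \<delta> j *\<^sub>R y \<in> W"
          using topological_tendstoD[OF py W(1) p(1)] .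
        have y0: "norm y > 0" using elim by auto
        define e where "e = \<bar>n \<bullet> y\<bar> / (2 * norm y)"
        have e: "e > 0" using elim y0 by (simp add: e_def)
        obtain d where d: "d > 0" "\<And>h. norm h < d \<Longrightarrow> \<bar>\<rho> (p + h) - \<rho> p - dderiv h \<rho> p\<bar> \<le> e * norm h"
          using differentiable_estimate[OF \<rho> e] by blast
        have "(\<lambda>j. norm (\<delta> j *\<^sub>R y)) \<longlonglongrightarrow> 0"
          using tendsto_norm[OF tendsto_scaleR[OF lim\<delta> tendsto_const[of y]]] by simp
        then have small: "\<forall>\<^sub>F j in sequentially. norm (\<delta> j *\<^sub>R y) < d" using d(1) by (rule order_tendstoD)
        have "\<forall>\<^sub>F j in sequentially. indicator \<Omega> (p + \<delta> j *\<^sub>R y) = k y"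
          using inW small
        proof eventually_elim
          case (elim j)
          have "\<bar>\<rho> (p + \<delta> j *\<^sub>R y) - \<delta> j * (n \<bullet> y)\<bar> \<le> e * norm (\<delta> j *\<^sub>R y)"
            using d(2)[OF elim(2)] p(2) dderiv_scale[OF \<rho>, of "\<delta> j" y]
            by (simp add: grad_inner[OF \<rho>, symmetric] n_def)
          also have "\<dots> = \<delta> j * \<bar>n \<bullet> y\<bar> / 2" using y0 \<delta>[of j] by (simp add: e_def)
          finally have est: "\<bar>\<rho> (p + \<delta> j *\<^sub>R y) - \<delta> j * (n \<bullet> y)\<bar> \<le> \<delta> j * \<bar>n \<bullet> y\<bar> / 2" .
          have "\<rho> (p + \<delta> j *\<^sub>R y) < 0 \<longleftrightarrow> n \<bullet> y < 0"
          proof (cases "n \<bullet> y < 0")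
            case True
            then have "\<delta> j * (n \<bullet> y) < 0" using \<delta>[of j] by (simp add: mult_pos_neg)
            then show ?thesis using est True by (simp add: abs_le_iff)
          next
            case False
            then have "\<delta> j * (n \<bullet> y) > 0" using \<delta>[of j] \<open>n \<bullet> y \<noteq> 0\<close> by simp
            moreover have "\<bar>n \<bullet> y\<bar> = n \<bullet> y" using False by simp
            ultimately show ?thesis using abs_le_D2[OF est] False by simp
          qed
          then show ?case using elim(1) by (auto simp: W(2) k_def indicator_def)
        qed
        then have "(\<lambda>j. indicator \<Omega> (p + \<delta> j *\<^sub>R y)) \<longlonglongrightarrow> k y" by (rule tendsto_eventually)
        then show ?case unfolding f_def f0_def by (rule tendsto_mult[OF _ Ylim])
      qed
    qed (use fm f0m in auto)
    have zero: "\<forall>\<^sub>F j in sequentially. (\<integral>y. f j y \<partial>lborel) = 0"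
    proof -
      have "\<forall>\<^sub>F j in sequentially. \<delta> j < r0 / R" using r0 R by (intro order_tendstoD[OF lim\<delta>]) simp
      then show ?thesis
      proof eventually_elim
        case (elim j)
        define \<theta> where "\<theta> x = \<psi> ((- inverse (\<delta> j)) *\<^sub>R p + inverse (\<delta> j) *\<^sub>R x)" for x
        have \<theta>C: "C_infinity UNIV \<theta>" unfolding \<theta>_def[abs_def] by (rule C_infinity_affine[OF \<psi>C]) auto
        have arg: "(- inverse (\<delta> j)) *\<^sub>R p + inverse (\<delta> j) *\<^sub>R x = inverse (\<delta> j) *\<^sub>R (x - p)" for x
          by (simp add: scaleR_diff_right)
        have supp: "x \<in> cball p r0" if "\<theta> x \<noteq> 0" for x
        proof -
          have "norm (inverse (\<delta> j) *\<^sub>R (x - p)) \<le> R" using that \<psi>0 unfolding \<theta>_def arg by (meson not_le)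
          then have "inverse (\<delta> j) * norm (x - p) \<le> R" using \<delta>[of j] unfolding norm_scaleR by simp
          then have "norm (x - p) \<le> R * \<delta> j" using \<delta>[of j] by (simp add: field_simps)
          also have "\<dots> \<le> r0" using elim R by (simp add: field_simps)
          finally show ?thesis by (simp add: dist_norm norm_minus_commute)
        qed
        then have cl: "closure {x. \<theta> x \<noteq> 0} \<subseteq> cball p r0" by (intro closure_minimal) auto
        have "\<theta> x = 0" if "norm x > norm p + r0" for x
        proof (rule ccontr)
          assume "\<theta> x \<noteq> 0"
          then have "norm (x - p) \<le> r0" using supp[of x] by (simp add: dist_norm norm_minus_commute)
          then show False using that norm_triangle_sub[of x p] by simp
        qed
        then have \<theta>: "smooth_cpt \<theta>" using \<theta>C unfolding smooth_cpt_def by blast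
        have d\<theta>: "dderiv v \<theta> x = inverse (\<delta> j) * dderiv v \<psi> (inverse (\<delta> j) *\<^sub>R (x - p))" for v x
          unfolding \<theta>_def[abs_def]
          by (subst dderiv_affine) (auto intro: smooth_cpt_differentiable \<psi> simp: arg scaleR_diff_right)
        define F where "F x = indicator \<Omega> x * dderiv (Y x) \<theta> x" for x
        have Fm[measurable]: "F \<in> borel_measurable borel"
        proof -
          have "F = (\<lambda>x. indicator \<Omega> x * (inverse (\<delta> j) * (\<Sum>b\<in>Basis. (Y x \<bullet> b) * dderiv b \<psi> (inverse (\<delta> j) *\<^sub>R (x - p)))))"
            unfolding F_def[abs_def] d\<theta> by (intro ext arg_cong2[where f="(*)"] refl expand)
          also have "\<dots> \<in> borel_measurable borel" by measurable
          finally show ?thesis .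
        qed
        have "0 = (\<integral>x. F x \<partial>lborel)" unfolding F_def using weak[OF \<theta>] cl r0(2) by auto
        also have "\<dots> = \<bar>\<delta> j\<bar> ^ DIM('a) * (\<integral>y. F (p + \<delta> j *\<^sub>R y) \<partial>lborel)"
          by (rule lebesgue_integral_affine[OF Fm]) (use \<delta>[of j] in simp)
        also have "(\<lambda>y. F (p + \<delta> j *\<^sub>R y)) = (\<lambda>y. inverse (\<delta> j) * f j y)"
          using \<delta>[of j] by (auto simp: F_def d\<theta> f_def)
        finally show "(\<integral>y. f j y \<partial>lborel) = 0" using \<delta>[of j] by simp
      qed
    qed
    have "(\<integral>y. f0 y \<partial>lborel) = 0"
      using LIMSEQ_unique[OF conv tendsto_eventually[OF zero]] .
    then show ?thesis unfolding corr_def f0_def \<psi>d .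
  qed
  \<comment> \<open>Hence the part of the bump inside the half space keeps its mass under translation along
    \<open>Y p\<close>.\<close>
  have const: "corr k \<phi> (t *\<^sub>R Y p) = corr k \<phi> 0" for t
  proof -
    have c: "((\<lambda>t. corr k \<phi> (0 + t *\<^sub>R Y p)) has_real_derivative 0) (at t)" for t
      using DERIV_along_line[OF smooth_differentiable[OF C_infinity_corr[OF k \<phi>]], where x=0 and t=t and v="Y p"]
      unfolding dderiv_corr[OF k \<phi>] key .
    have "corr k \<phi> (0 + t *\<^sub>R Y p) = corr k \<phi> (0 + 0 *\<^sub>R Y p)"
      by (rule DERIV_isconst_all) (use c in blast)
    then show ?thesis by simp
  qed
  define a where "a = Y p \<bullet> n"
  have a: "a \<noteq> 0" using ne by (simp add: a_def n_def)
  \<comment> \<open>The bump has radius two; after translation by \<open>\<plusminus>T Y p\<close> the linear form \<open>n\<close> has a definite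
    sign on its support.\<close>
  define T where "T = (2 * norm n + 1) / a"
  have sup: "norm (x + y) < 2" if "\<phi> (x + y) \<noteq> 0" for x y
    using ball_bump_eq_0[of 1 "x + y" 0] that unfolding \<phi>_def by (force simp: dist_norm)
  have CS: "\<bar>n \<bullet> (x + y)\<bar> \<le> norm n * 2" if "\<phi> (x + y) \<noteq> 0" for x y
    using Cauchy_Schwarz_ineq2[of n "x + y"] mult_left_mono[OF less_imp_le[OF sup[OF that]], of "norm n"]
    by simp
  have low: "corr k \<phi> ((- T) *\<^sub>R Y p) = 0"
  proof -
    have "k y * \<phi> ((- T) *\<^sub>R Y p + y) = 0" for y
    proof (rule ccontr)
      assume c: "k y * \<phi> ((- T) *\<^sub>R Y p + y) \<noteq> 0"
      then have "n \<bullet> y < 0" by (auto simp: k_def indicator_def split: if_splits)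
      moreover have "\<bar>n \<bullet> ((- T) *\<^sub>R Y p + y)\<bar> \<le> norm n * 2"
        using c by (intro CS) simp
      moreover have "n \<bullet> ((- T) *\<^sub>R Y p + y) = - (2 * norm n + 1) + n \<bullet> y"
        using a by (simp add: inner_add_right inner_diff_right T_def a_def inner_commute)
      ultimately show False by simp
    qed
    then have "corr k \<phi> ((- T) *\<^sub>R Y p) = (\<integral>y. 0 \<partial>(lborel :: 'a measure))"
      unfolding corr_def by (simp only:)
    then show ?thesis by simp
  qed
  have high: "corr k \<phi> (T *\<^sub>R Y p) = (\<integral>y. \<phi> (T *\<^sub>R Y p + y) \<partial>lborel)"
  proof -
    have "k y * \<phi> (T *\<^sub>R Y p + y) = \<phi> (T *\<^sub>R Y p + y)" for y
    proof (cases "\<phi> (T *\<^sub>R Y p + y) = 0")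
      case False
      have "\<bar>n \<bullet> (T *\<^sub>R Y p + y)\<bar> \<le> norm n * 2" using False by (rule CS)
      moreover have "n \<bullet> (T *\<^sub>R Y p + y) = (2 * norm n + 1) + n \<bullet> y"
        using a by (simp add: inner_add_right inner_diff_right T_def a_def inner_commute)
      ultimately have "n \<bullet> y < 0" by simp
      then show ?thesis by (simp add: k_def)
    qed simp
    then show ?thesis unfolding corr_def by (simp only:)
  qed
  have \<phi>m[measurable]: "\<phi> \<in> borel_measurable borel" using smooth_cpt_measurable[OF \<phi>, of 0] by simp
  have "(\<integral>y. \<phi> (T *\<^sub>R Y p + y) \<partial>lborel) = (\<integral>y. \<phi> y \<partial>lborel)"
    using lebesgue_integral_affine[OF \<phi>m, of 1 "T *\<^sub>R Y p"] by simp
  moreover have "(\<integral>y. \<phi> y \<partial>lborel) > 0"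
  proof -
    have i: "integrable lborel (indicator (ball 0 1) :: 'a \<Rightarrow> real)"
      by (intro integrable_real_indicator) (use emeasure_bounded_finite[OF bounded_ball[of 0 1]] in auto)
    have i2: "integrable lborel \<phi>"
      using corr_integrable_0[OF loc_integrable_continuous[of "\<lambda>_. 1"] \<phi>] by simp
    have "0 < measure lborel (ball (0::'a) 1)" using content_ball_gt_0_iff[of "0::'a" 1] by simp
    also have "\<dots> = (\<integral>y. indicator (ball (0::'a) 1) y \<partial>lborel)" by simp
    also have "\<dots> \<le> (\<integral>y. \<phi> y \<partial>lborel)"
      by (rule integral_mono[OF i i2])
         (auto simp: \<phi>_def indicator_def ball_bump_nonneg ball_bump_eq_1 dist_norm)
    finally show ?thesis .
  qed
  ultimately show False using high low const[of T] const[of "- T"] by simp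
qed

section \<open>Octonions\<close>

lemma cross3_nth: "cross3 x y $ 1 = x$2 * y$3 - x$3 * y$2"
  "cross3 x y $ 2 = x$3 * y$1 - x$1 * y$3" "cross3 x y $ 3 = x$1 * y$2 - x$2 * y$1"
  by (simp_all add: cross3_def)

text \<open>Identities between octonions are proved by comparing the eight real coordinates; the
  identities below that stand in for associativity are consequences of alternativity.\<close>

lemma oct_eq_iff: "(x::oct) = y \<longleftrightarrow>
   fst (fst x) = fst (fst y) \<and> snd (fst x) $ 1 = snd (fst y) $ 1 \<and> snd (fst x) $ 2 = snd (fst y) $ 2 \<and> snd (fst x) $ 3 = snd (fst y) $ 3 \<and>
   fst (snd x) = fst (snd y) \<and> snd (snd x) $ 1 = snd (snd y) $ 1 \<and> snd (snd x) $ 2 = snd (snd y) $ 2 \<and> snd (snd x) $ 3 = snd (snd y) $ 3"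
  by (auto simp: prod_eq_iff vec_eq_iff forall_3)

lemmas oct_coords = omult_def qmult_def qconj_def oconj_def ore_def oct_of_real_def case_prod_beta
  inner_prod_def inner_vec_def sum_3 cross3_nth

lemma bilinear_omult: "bounded_bilinear (\<odot>)"
proof -
  have "bilinear (\<odot>)"
    unfolding bilinear_def
    by (auto intro!: linearI simp: oct_eq_iff oct_coords algebra_simps)
  then show ?thesis by (simp add: bilinear_conv_bounded_bilinear)
qed

lemma linear_oconj: "bounded_linear oconj"
proof -
  have "linear oconj" by (auto intro!: linearI simp: oct_eq_iff oct_coords)
  then show ?thesis by (simp add: linear_conv_bounded_linear)
qed

lemma oct_alt_right: "(x \<odot> oconj y) \<odot> y = (y \<bullet> y) *\<^sub>R x"
  by (simp add: oct_eq_iff oct_coords) (simp add: algebra_simps)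

lemma oct_alt_right': "(x \<odot> y) \<odot> oconj y = (y \<bullet> y) *\<^sub>R x"
  by (simp add: oct_eq_iff oct_coords) (simp add: algebra_simps)

lemma oct_alt_left: "x \<odot> (oconj x \<odot> y) = (x \<bullet> x) *\<^sub>R y"
  by (simp add: oct_eq_iff oct_coords) (simp add: algebra_simps)

lemma oconj_omult: "oconj (x \<odot> y) = oconj y \<odot> oconj x"
  by (simp add: oct_eq_iff oct_coords)

lemma oconj_oconj [simp]: "oconj (oconj x) = x"
  by (simp add: oct_eq_iff oct_coords)

lemma ore_omult_oconj: "ore (x \<odot> oconj y) = x \<bullet> y"
  by (simp add: oct_coords)

lemma ore_oconj_omult: "ore (oconj x \<odot> y) = x \<bullet> y"
  by (simp add: oct_coords)

lemma oct_adjoint: "x \<bullet> (q \<odot> y) = y \<bullet> (oconj q \<odot> x)"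
  by (simp add: oct_coords algebra_simps)


lemma ore_transpose_right: "ore (q \<odot> (y \<odot> oconj e)) = (oconj q \<odot> e) \<bullet> y"
  by (simp add: oct_coords algebra_simps)

lemma ore_transpose_left: "ore (q \<odot> (e \<odot> oconj z)) = (q \<odot> e) \<bullet> z"
  by (simp add: oct_coords algebra_simps)

lemma omult_of_real: "x \<odot> oct_of_real t = t *\<^sub>R x"
  by (simp add: oct_eq_iff oct_coords)

lemma linear_oct_of_real: "bounded_linear oct_of_real"
proof -
  have "linear oct_of_real" by (auto intro!: linearI simp: oct_eq_iff oct_coords)
  then show ?thesis by (simp add: linear_conv_bounded_linear)
qed

lemma linear_ore: "bounded_linear ore"
proof -
  have "linear ore" by (auto intro!: linearI simp: oct_coords)
  then show ?thesis by (simp add: linear_conv_bounded_linear)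
qed

lemmas omult_add = bounded_bilinear.add_left[OF bilinear_omult] bounded_bilinear.add_right[OF bilinear_omult]
lemmas omult_scale = bounded_bilinear.scaleR_left[OF bilinear_omult] bounded_bilinear.scaleR_right[OF bilinear_omult]
lemmas omult_zero = bounded_bilinear.zero_left[OF bilinear_omult] bounded_bilinear.zero_right[OF bilinear_omult]
lemmas omult_diff = bounded_bilinear.diff_left[OF bilinear_omult] bounded_bilinear.diff_right[OF bilinear_omult]
lemmas oconj_simps = linear_simps[OF linear_oconj]

section \<open>The symbols of the octonionic operators\<close>

text \<open>A triple \<open>(a, b, q)\<close> stands for the Hermitian matrix with diagonal \<open>a, b\<close> and upper right
  entry \<open>q\<close>, so that Hermitian matrices form a whole Euclidean space.\<close>

type_synonym herm = "real \<times> real \<times> oct"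

definition oct_M :: "oct^2 \<Rightarrow> oct^2 \<Rightarrow> herm" where
  "oct_M \<xi> \<eta> = (\<xi>$1 \<bullet> \<eta>$1, \<xi>$2 \<bullet> \<eta>$2, (1/2) *\<^sub>R (\<xi>$1 \<odot> oconj (\<eta>$2) + \<eta>$1 \<odot> oconj (\<xi>$2)))"

definition oct_N :: "oct^2 \<Rightarrow> herm \<Rightarrow> oct^2" where
  "oct_N \<xi> h = vector [snd (snd h) \<odot> \<xi>$2 - fst (snd h) *\<^sub>R \<xi>$1, oconj (snd (snd h)) \<odot> \<xi>$1 - fst h *\<^sub>R \<xi>$2]"

text \<open>With \<open>w = N(\<xi>, h)\<close>, alternativity gives
  \<open>w\<^sub>1 conj(\<xi>\<^sub>2) + \<xi>\<^sub>1 conj(w\<^sub>2) = \<bar>\<xi>\<bar>\<^sup>2 q - (a + b) \<xi>\<^sub>1 conj(\<xi>\<^sub>2)\<close>, and the diagonal entries are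
  \<open>\<plusminus>(a \<bar>\<xi>\<^sub>2\<bar>\<^sup>2 - b \<bar>\<xi>\<^sub>1\<bar>\<^sup>2)\<close>.\<close>

definition oct_P :: "oct^2 \<Rightarrow> oct^2 \<Rightarrow> herm" where
  "oct_P \<xi> w = (\<xi>$1 \<bullet> w$1 - \<xi>$2 \<bullet> w$2, \<xi>$2 \<bullet> w$2 - \<xi>$1 \<bullet> w$1, w$1 \<odot> oconj (\<xi>$2) + \<xi>$1 \<odot> oconj (w$2))"

definition oct_tr :: "herm \<Rightarrow> real" where
  "oct_tr h = fst h + fst (snd h)"

lemma vec2_eq_iff: "(x::'b^2) = y \<longleftrightarrow> x$1 = y$1 \<and> x$2 = y$2"
  by (simp add: vec_eq_iff forall_2)

lemma bounded_bilinearI: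
  fixes p :: "'b::euclidean_space \<Rightarrow> 'c::euclidean_space \<Rightarrow> 'd::euclidean_space"
  assumes "\<And>x y z. p (x + y) z = p x z + p y z" "\<And>x y z. p x (y + z) = p x y + p x z"
    "\<And>c x y. p (c *\<^sub>R x) y = c *\<^sub>R p x y" "\<And>c x y. p x (c *\<^sub>R y) = c *\<^sub>R p x y"
  shows "bounded_bilinear p"
  unfolding bilinear_conv_bounded_bilinear[symmetric] bilinear_def using assms by (auto intro!: linearI)

lemma bilinear_oct_M: "bounded_bilinear oct_M"
  by (rule bounded_bilinearI)
     (simp_all add: oct_M_def omult_add omult_scale oconj_simps inner_add_left inner_add_right
       scaleR_add_right algebra_simps)

lemma bilinear_oct_N: "bounded_bilinear oct_N"
  by (rule bounded_bilinearI)
     (simp_all add: oct_N_def vec2_eq_iff omult_add omult_scale oconj_simps scaleR_add_right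
       scaleR_diff_right scaleR_add_left)

lemma bilinear_oct_P: "bounded_bilinear oct_P"
  by (rule bounded_bilinearI)
     (simp_all add: oct_P_def omult_add omult_scale oconj_simps inner_add_left inner_add_right
       scaleR_add_right right_diff_distrib)

lemma linear_oct_tr: "bounded_linear oct_tr"
proof -
  have "linear oct_tr" by (auto intro!: linearI simp: oct_tr_def algebra_simps)
  then show ?thesis by (simp add: linear_conv_bounded_linear)
qed

interpretation oct: symbol_complex oct_M oct_N oct_P oct_tr
proof (rule symbol_complex.intro)
  show "oct_M x y = oct_M y x" for x y by (simp add: oct_M_def inner_commute add.commute)
  show "oct_N x (oct_M x x) = 0" for x
  proof -
    have "(1/2::real) *\<^sub>R (z + z) = z" for z :: oct by (simp add: scaleR_2[symmetric])
    then show ?thesis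
      by (simp add: oct_N_def oct_M_def vec2_eq_iff oconj_omult oct_alt_right)
  qed
  show "(x \<bullet> x) *\<^sub>R v = oct_tr v *\<^sub>R oct_M x x + oct_P x (oct_N x v)" for x v
  proof -
    obtain a b q where v: "v = (a, b, q)" by (metis prod.exhaust)
    have half: "(1/2::real) *\<^sub>R (z + z) = z" for z :: oct by (simp add: scaleR_2[symmetric])
    have n: "x \<bullet> x = x$1 \<bullet> x$1 + x$2 \<bullet> x$2" by (simp add: inner_vec_def sum_2)
    have ad: "x$1 \<bullet> (q \<odot> x$2) = x$2 \<bullet> (oconj q \<odot> x$1)" by (rule oct_adjoint)
    have c: "(q \<odot> x$2 - b *\<^sub>R x$1) \<odot> oconj (x$2) + x$1 \<odot> oconj (oconj q \<odot> x$1 - a *\<^sub>R x$2) =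
        (x \<bullet> x) *\<^sub>R q - (a + b) *\<^sub>R (x$1 \<odot> oconj (x$2))"
      by (simp add: omult_diff omult_scale oconj_simps oconj_omult oct_alt_left oct_alt_right' n
          scaleR_add_left)
    show ?thesis
      unfolding v oct_N_def oct_P_def oct_M_def oct_tr_def
      by (simp add: half c) (simp add: n inner_diff_right ad algebra_simps)
  qed
qed (rule bilinear_oct_M bilinear_oct_N bilinear_oct_P linear_oct_tr)+

definition to_mat :: "herm \<Rightarrow> oct^2^2" where
  "to_mat h = mat2 (oct_of_real (fst h)) (snd (snd h)) (oconj (snd (snd h))) (oct_of_real (fst (snd h)))"

lemma mat2_nth [simp]: "mat2 a b c d $ 1 $ 1 = a" "mat2 a b c d $ 1 $ 2 = b"
  "mat2 a b c d $ 2 $ 1 = c" "mat2 a b c d $ 2 $ 2 = d"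
  by (simp_all add: mat2_def)

lemma sum_Basis_oct2:
  fixes g :: "oct^2 \<Rightarrow> 'b::comm_monoid_add"
  shows "(\<Sum>b\<in>Basis. g b) = (\<Sum>e\<in>Basis. g (axis 1 e)) + (\<Sum>e\<in>Basis. g (axis 2 e))"
proof -
  have B: "(Basis :: (oct^2) set) = axis 1 ` Basis \<union> axis 2 ` Basis"
    by (auto simp: Basis_vec_def UNIV_2)
  have d: "axis (1::2) ` Basis \<inter> axis 2 ` (Basis :: oct set) = {}"
    using nonzero_Basis by (auto simp: axis_eq_axis)
  have i: "inj_on (axis (j::2)) (Basis :: oct set)" for j by (auto simp: inj_on_def axis_eq_axis)
  show ?thesis unfolding B
    by (subst sum.union_disjoint) (auto simp: d sum.reindex i)
qed

lemma axis_oct2_nth [simp]: "axis (1::2) e $ 1 = e" "axis (1::2) e $ 2 = (0::oct)"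
  "axis (2::2) e $ 1 = (0::oct)" "axis (2::2) e $ 2 = e"
  by (simp_all add: axis_def)

definition mixed :: "2 \<Rightarrow> 2 \<Rightarrow> (oct^2 \<Rightarrow> real) \<Rightarrow> oct^2 \<Rightarrow> oct" where
  "mixed i j f x = (\<Sum>e\<in>Basis. \<Sum>e'\<in>Basis. dderiv (axis i e) (dderiv (axis j e') f) x *\<^sub>R (e \<odot> oconj e'))"

lemma mixed_conj:
  assumes "C_infinity W f" "x \<in> W"
  shows "mixed j i f x = oconj (mixed i j f x)"
proof -
  have "oconj (mixed i j f x) = (\<Sum>e\<in>Basis. \<Sum>e'\<in>Basis. dderiv (axis i e) (dderiv (axis j e') f) x *\<^sub>R (e' \<odot> oconj e))"
    unfolding mixed_def by (simp add: linear_sum[OF bounded_linear.linear[OF linear_oconj]] oconj_simps oconj_omult)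
  also have "\<dots> = (\<Sum>e'\<in>Basis. \<Sum>e\<in>Basis. dderiv (axis i e) (dderiv (axis j e') f) x *\<^sub>R (e' \<odot> oconj e))"
    by (rule sum.swap)
  also have "\<dots> = mixed j i f x"
    unfolding mixed_def by (intro sum.cong refl arg_cong2[where f=scaleR] dderiv_commute[OF assms])
  finally show ?thesis ..
qed

lemma dbar_dd:
  assumes f: "C_infinity W f" and x: "x \<in> W"
  shows "dbar i (dd j (\<lambda>y. oct_of_real (f y))) x = mixed i j f x"
proof -
  have op: "open W" using f by (rule C_infinity_open)
  have 1: "dd j (\<lambda>y. oct_of_real (f y)) z = (\<Sum>e'\<in>Basis. dderiv (axis j e') f z *\<^sub>R oconj e')" if "z \<in> W" for z
    unfolding dd_def partial_def
    using dderiv_linear[OF linear_oct_of_real C_infinity_differentiable[OF f that]]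
    by (simp add: omult_of_real)
  have d: "dderiv (axis j e') f differentiable (at x)" for e'
    by (rule C_infinity_differentiable[OF C_infinity_dderiv[OF f] x])
  have 2: "dderiv v (dd j (\<lambda>y. oct_of_real (f y))) x = (\<Sum>e'\<in>Basis. dderiv v (dderiv (axis j e') f) x *\<^sub>R oconj e')" for v
  proof -
    have "dderiv v (dd j (\<lambda>y. oct_of_real (f y))) x = dderiv v (\<lambda>z. \<Sum>e'\<in>Basis. dderiv (axis j e') f z *\<^sub>R oconj e') x"
      by (rule dderiv_cong[OF op x 1])
    also have "\<dots> = (\<Sum>e'\<in>Basis. dderiv v (\<lambda>z. dderiv (axis j e') f z *\<^sub>R oconj e') x)"
      by (intro dderiv_sum differentiable_scaleR d differentiable_const)
    also have "\<dots> = (\<Sum>e'\<in>Basis. dderiv v (dderiv (axis j e') f) x *\<^sub>R oconj e')"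
      by (intro sum.cong refl dderiv_linear[OF bounded_linear_scaleR_left] d)
    finally show ?thesis .
  qed
  show ?thesis
    unfolding dbar_def partial_def 2 mixed_def
    by (simp add: bounded_bilinear.sum_right[OF bilinear_omult] omult_scale)
qed

lemma hess_oct:
  assumes f: "C_infinity W f" and x: "x \<in> W"
  shows "oct.hess f x = (laplace 1 f x, laplace 2 f x, mixed 1 2 f x)"
proof -
  define t where "t i e j e' = dderiv (axis i e) (dderiv (axis j e') f) x" for i j :: 2 and e e' :: oct
  have m11: "oct_M (axis 1 e) (axis 1 e') = (e \<bullet> e', 0, 0)" and m22: "oct_M (axis 2 e) (axis 2 e') = (0, e \<bullet> e', 0)"
    and m12: "oct_M (axis 1 e) (axis 2 e') = (0, 0, (1/2) *\<^sub>R (e \<odot> oconj e'))"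
    and m21: "oct_M (axis 2 e) (axis 1 e') = (0, 0, (1/2) *\<^sub>R (e' \<odot> oconj e))" for e e'
    by (simp_all add: oct_M_def omult_zero oconj_simps)
  have lap: "(\<Sum>e\<in>Basis. \<Sum>e'\<in>Basis. t i e i e' * (e \<bullet> e')) = laplace i f x" for i
    unfolding laplace_def partial_def t_def
    by (intro sum.cong refl) (simp add: inner_Basis if_distrib sum.delta' cong: if_cong)
  have "oct.hess f x = (\<Sum>e\<in>Basis. \<Sum>e'\<in>Basis. t 1 e 1 e' *\<^sub>R (e \<bullet> e', 0, 0)) + (\<Sum>e\<in>Basis. \<Sum>e'\<in>Basis. t 1 e 2 e' *\<^sub>R (0, 0, (1/2) *\<^sub>R (e \<odot> oconj e')))
     + ((\<Sum>e\<in>Basis. \<Sum>e'\<in>Basis. t 2 e 1 e' *\<^sub>R (0, 0, (1/2) *\<^sub>R (e' \<odot> oconj e))) + (\<Sum>e\<in>Basis. \<Sum>e'\<in>Basis. t 2 e 2 e' *\<^sub>R (0, e \<bullet> e', 0)))"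
    unfolding oct.hess_def sum_Basis_oct2 t_def m11 m12 m21 m22 sum.distrib by (simp only: add_ac)
  also have "\<dots> = (\<Sum>e\<in>Basis. \<Sum>e'\<in>Basis. t 1 e 1 e' * (e \<bullet> e'), \<Sum>e\<in>Basis. \<Sum>e'\<in>Basis. t 2 e 2 e' * (e \<bullet> e'),
      (1/2) *\<^sub>R mixed 1 2 f x + (1/2) *\<^sub>R oconj (mixed 2 1 f x))"
    by (simp add: prod_eq_iff fst_sum snd_sum mixed_def t_def scaleR_sum_right
        linear_sum[OF bounded_linear.linear[OF linear_oconj]] oconj_simps oconj_omult mult.commute)
  also have "\<dots> = (laplace 1 f x, laplace 2 f x, mixed 1 2 f x)"
    unfolding lap mixed_conj[OF f x, of 1 2, symmetric] by (simp add: scaleR_left.add[symmetric])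
  finally show ?thesis .
qed

lemma D0_eq:
  assumes "C_infinity W f" "x \<in> W"
  shows "D0 f x = to_mat (oct.hess f x)"
  unfolding D0_def hess_oct[OF assms] to_mat_def dbar_dd[OF assms] mixed_conj[OF assms, of 2 1] by simp

lemma D1_eq:
  assumes u: "u differentiable (at x)"
  shows "D1 (\<lambda>y. to_mat (u y)) x = oct.compat u x"
proof -
  have d: "dderiv v (\<lambda>y. L (u y)) x = L (dderiv v u x)" if "bounded_linear L" for v L
    by (rule dderiv_linear[OF that u])
  have l: "bounded_linear (\<lambda>h::herm. oct_of_real (fst h))" "bounded_linear (\<lambda>h::herm. oct_of_real (fst (snd h)))"
    "bounded_linear (\<lambda>h::herm. snd (snd h))" "bounded_linear (\<lambda>h::herm. oconj (snd (snd h)))"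
    by (intro bounded_linear_compose[OF linear_oct_of_real] bounded_linear_compose[OF linear_oconj]
        bounded_linear_fst bounded_linear_snd bounded_linear_fst_comp bounded_linear_snd_comp)+
  have n: "oct_N (axis 1 e) h = vector [- (fst (snd h) *\<^sub>R e), oconj (snd (snd h)) \<odot> e]"
    "oct_N (axis 2 e) h = vector [snd (snd h) \<odot> e, - (fst h *\<^sub>R e)]" for e h
    by (simp_all add: oct_N_def vec2_eq_iff omult_zero)
  show ?thesis
    unfolding oct.compat_def sum_Basis_oct2 n vec2_eq_iff
    by (simp add: D1_def dbar_r_def dbar_def partial_def to_mat_def d[OF l(1)] d[OF l(2)] d[OF l(3)] d[OF l(4)]
        omult_of_real sum_component sum_negf)
qed

lemma D1_cong:
  assumes "open W" "x \<in> W" "\<And>y. y \<in> W \<Longrightarrow> u y = u' y"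
  shows "D1 u x = D1 u' x"
proof -
  have "dderiv v (\<lambda>y. u y $ i $ j) x = dderiv v (\<lambda>y. u' y $ i $ j) x" for v i j
    by (rule dderiv_cong[OF assms(1,2)]) (simp add: assms(3))
  then show ?thesis unfolding D1_def dbar_r_def dbar_def partial_def by simp
qed

lemma D1_D0:
  assumes f: "C_infinity W f" and x: "x \<in> W"
  shows "D1 (D0 f) x = 0"
proof -
  have "D1 (D0 f) x = D1 (\<lambda>y. to_mat (oct.hess f y)) x"
    by (rule D1_cong[OF C_infinity_open[OF f] x]) (rule D0_eq[OF f])
  also have "\<dots> = oct.compat (oct.hess f) x"
    by (rule D1_eq[OF C_infinity_differentiable[OF oct.C_infinity_hess[OF f] x]])
  finally show ?thesis using oct.compat_hess[OF f x] by simp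
qed

text \<open>The adjoint is expressed by the symbol of the operator itself, so that no derivative of
  the matrix field is involved.\<close>

lemma D1_adj_eq:
  assumes v: "v differentiable (at x)"
  shows "inner_H2 (to_mat h) (D1_adj v x) = - (\<Sum>b\<in>Basis. oct_N b h \<bullet> dderiv b v x)"
proof -
  obtain a b q where h: "h = (a, b, q)" by (metis prod.exhaust)
  have d: "dderiv w (\<lambda>y. v y $ i) x = dderiv w v x $ i" for w i
    by (rule dderiv_linear[OF bounded_linear_vec_nth v])
  have dc: "dderiv w (\<lambda>y. oconj (v y $ i)) x = oconj (dderiv w v x $ i)" for w i
    by (rule dderiv_linear[OF bounded_linear_compose[OF linear_oconj bounded_linear_vec_nth] v])
  have n: "oct_N (axis 1 e) h \<bullet> z = (oconj q \<odot> e) \<bullet> z$2 - b * (e \<bullet> z$1)"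
    "oct_N (axis 2 e) h \<bullet> z = (q \<odot> e) \<bullet> z$1 - a * (e \<bullet> z$2)" for e z
    by (simp_all add: oct_N_def h omult_zero inner_vec_def sum_2)
  have r: "ore (\<Sum>i\<in>I. g i) = (\<Sum>i\<in>I. ore (g i))" for I and g :: "oct \<Rightarrow> oct"
    by (rule linear_sum[OF bounded_linear.linear[OF linear_ore]])
  have osum: "ore (q \<odot> (\<Sum>i\<in>I. g i)) = (\<Sum>i\<in>I. ore (q \<odot> g i))" for I and g :: "oct \<Rightarrow> oct"
    by (simp add: bounded_bilinear.sum_right[OF bilinear_omult] r)
  have o1: "ore (q \<odot> (\<Sum>e\<in>Basis. y e \<odot> oconj e)) = (\<Sum>e\<in>Basis. (oconj q \<odot> e) \<bullet> y e)" for y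
    unfolding osum by (intro sum.cong refl ore_transpose_right)
  have o2: "ore (q \<odot> (\<Sum>e\<in>Basis. e \<odot> oconj (z e))) = (\<Sum>e\<in>Basis. (q \<odot> e) \<bullet> z e)" for z
    unfolding osum by (intro sum.cong refl ore_transpose_left)
  have o: "ore (q \<odot> (s *\<^sub>R ((\<Sum>e\<in>Basis. y e \<odot> oconj e) + (\<Sum>e\<in>Basis. e \<odot> oconj (z e))))) =
      s * ((\<Sum>e\<in>Basis. (oconj q \<odot> e) \<bullet> y e) + (\<Sum>e\<in>Basis. (q \<odot> e) \<bullet> z e))" for s and y z :: "oct \<Rightarrow> oct"
    unfolding omult_scale omult_add linear_simps[OF linear_ore] o1 o2 by simp
  have fin: "A + B + 2 * (- 1 / 2 * (Q + Q')) = - ((Q - B) + (Q' - A))" for A B Q Q' :: real by (simp add: field_simps)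
  have ro: "ore (oct_of_real t) = t" for t by (simp add: oct_of_real_def ore_def)
  show ?thesis
    unfolding sum_Basis_oct2 n sum_subtractf sum_distrib_left[symmetric]
    unfolding inner_H2_def D1_adj_def to_mat_def h dd_def dd_r_def dbar_def partial_def mat2_nth d dc fst_conv snd_conv o
      ro r ore_oconj_omult
    by (rule fin)
qed

lemma inner_O2_zero: "inner_O2 0 w = 0" "inner_O2 w 0 = 0"
  by (simp_all add: inner_O2_def ore_omult_oconj)

section \<open>Compactly supported solutions for the octonionic Hessian\<close>

text \<open>On the slice through \<open>x\<close> the function is harmonic in the first octonionic variable and
  decays, so Liouville's theorem in eight dimensions applies.\<close>

lemma slice_vanishing:
  fixes g :: "oct^2 \<Rightarrow> real" and x :: "oct^2"
  assumes g: "C_infinity UNIV g"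
    and decay: "\<And>e. e > 0 \<Longrightarrow> \<exists>R. \<forall>x. norm x > R \<longrightarrow> \<bar>g x\<bar> < e"
    and harm: "\<And>x. norm x > R \<Longrightarrow> laplace 1 g x = 0"
    and x: "norm (x $ 2) > R"
  shows "g x = 0"
proof -
  define mk :: "oct \<Rightarrow> oct^2" where "mk y = axis 1 y + axis 2 (x $ 2)" for y
  have mk_add: "mk (y + t *\<^sub>R e) = mk y + t *\<^sub>R axis 1 e" for y e and t :: real
    unfolding mk_def vec2_eq_iff by simp
  have n1: "norm y \<le> norm (mk y)" for y
    using Finite_Cartesian_Product.norm_nth_le[of "mk y" 1] by (simp add: mk_def)
  have n2: "norm (x $ 2) \<le> norm (mk y)" for y
    using Finite_Cartesian_Product.norm_nth_le[of "mk y" 2] by (simp add: mk_def)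
  have "g (mk (x $ 1)) = 0"
  proof (rule decaying_harmonic_zero[where w="\<lambda>y. g (mk y)" and wd="\<lambda>e y. dderiv (axis 1 e) g (mk y)"
        and wdd="\<lambda>e y. dderiv (axis 1 e) (dderiv (axis 1 e) g) (mk y)"])
    have "continuous_on UNIV mk"
      unfolding mk_def[abs_def]
      by (intro continuous_on_add continuous_on_const linear_continuous_on)
         (simp add: linear_conv_bounded_linear[symmetric] linear_iff vec2_eq_iff)
    then show "continuous_on UNIV (\<lambda>y. g (mk y))"
      by (rule continuous_on_compose2[OF C_infinity_continuous_on[OF g]]) auto
    show "((\<lambda>t. g (mk (y + t *\<^sub>R e))) has_real_derivative dderiv (axis 1 e) g (mk (y + t *\<^sub>R e))) (at t)" for y e t
      unfolding mk_add by (intro DERIV_along_line smooth_differentiable g)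
    show "((\<lambda>t. dderiv (axis 1 e) g (mk (y + t *\<^sub>R e))) has_real_derivative
        dderiv (axis 1 e) (dderiv (axis 1 e) g) (mk (y + t *\<^sub>R e))) (at t)" for y e t
      unfolding mk_add by (intro DERIV_along_line smooth_differentiable C_infinity_dderiv g)
    show "(\<Sum>e\<in>Basis. dderiv (axis 1 e) (dderiv (axis 1 e) g) (mk y)) = 0" for y
      using harm[of "mk y"] n2[of y] x by (simp add: laplace_def partial_def)
    fix e :: real assume "e > 0"
    then obtain R' where "\<And>x. norm x > R' \<Longrightarrow> \<bar>g x\<bar> < e" using decay by blast
    then show "\<exists>R. \<forall>y. norm y > R \<longrightarrow> \<bar>g (mk y)\<bar> < e"
      using n1 by (intro exI[of _ R']) (meson less_le_trans)
  qed
  moreover have "mk (x $ 1) = x" by (simp add: mk_def vec2_eq_iff)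
  ultimately show ?thesis by simp
qed

lemma DIM_oct2: "DIM(oct^2) = 2 * 7 + 2"
  by simp

text \<open>The potential vanishes where \<open>\<bar>x\<^sub>2\<bar>\<close> is large, which is an open subset of the connected
  source-free set \<open>D\<close>.\<close>

lemma oct_hess_solution:
  assumes H: "smooth_cpt H" and c: "\<And>x. oct.compat H x = 0"
    and D: "open D" "connected D" "\<And>x. x \<in> D \<Longrightarrow> H x = 0" "bounded (- D)"
  shows "\<exists>g. C_infinity UNIV g \<and> (\<forall>x. oct.hess g x = H x) \<and> (\<forall>x\<in>D. g x = 0)"
proof -
  define h where "h x = oct_tr (H x)" for x
  have h: "smooth_cpt h" unfolding h_def[abs_def] by (rule smooth_cpt_linear[OF linear_oct_tr H])
  define E where "E = corr (ikernel 7 0) h"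
  have E: "C_infinity UNIV E" unfolding E_def by (rule C_infinity_corr[OF loc_integrable_newton[OF DIM_oct2] h])
  obtain k where k: "k \<noteq> 0" "\<And>x. oct.hess (\<lambda>x. k * E x) x = H x"
    using oct.compact_solution[OF DIM_oct2 _ H c] unfolding E_def h_def[abs_def] by auto
  define g where "g x = k * E x" for x
  have g: "C_infinity UNIV g" unfolding g_def[abs_def] by (rule C_infinity_linear[OF bounded_linear_mult_right E])
  have gH: "oct.hess g x = H x" for x using k(2) by (simp add: g_def[abs_def])
  obtain R where R: "\<And>x. x \<in> - D \<Longrightarrow> norm x \<le> R" using D(4) unfolding bounded_iff by blast
  have far: "x \<in> D" if "norm x > R" for x using R[of x] that by (meson ComplI not_le)
  have "g x = 0" if "norm (x $ 2) > R" for x :: "oct^2"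
  proof (rule slice_vanishing[OF g _ _ that])
    fix e :: real assume "e > 0"
    then have "e / \<bar>k\<bar> > 0" using k by simp
    then obtain R' where "\<And>x. norm x > R' \<Longrightarrow> \<bar>E x\<bar> < e / \<bar>k\<bar>"
      using newton_potential_decay[OF DIM_oct2 _ h] unfolding E_def by auto
    then have "\<bar>g x\<bar> < e" if "norm x > R'" for x
      using that k by (simp add: g_def abs_mult field_simps)
    then show "\<exists>R. \<forall>x. norm x > R \<longrightarrow> \<bar>g x\<bar> < e" by blast
  next
    fix x :: "oct^2" assume "norm x > R"
    then have "H x = 0" using far D(3) by blast
    then show "laplace 1 g x = 0" using gH[of x] hess_oct[OF g UNIV_I, of x] by (simp add: zero_prod_def)
  qed
  then have E0: "E x = 0" if "norm (x $ 2) > R" for x :: "oct^2" using that k by (simp add: g_def)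
  define N where "N = {x :: oct^2. norm (x $ 2) > R}"
  have "E x = 0" if "x \<in> D" for x
    unfolding E_def
  proof (rule newton_potential_unique_continuation[OF DIM_oct2 h D(1,2) _ _ _ _ _ that, where N=N])
    show "h z = 0" if "z \<in> D" for z
      using D(3)[OF that] by (simp add: h_def linear_simps[OF linear_oct_tr])
    show "open N" unfolding N_def by (intro open_Collect_less continuous_intros)
    show "N \<subseteq> D"
    proof
      fix x assume "x \<in> N"
      then have "norm x > R" using Finite_Cartesian_Product.norm_nth_le[of x 2] by (simp add: N_def)
      then show "x \<in> D" by (rule far)
    qed
    have "0 \<le> \<bar>R\<bar> + 1" by simp
    then obtain y :: oct where "norm y = \<bar>R\<bar> + 1" by (rule vector_choose_size)
    then have "axis 2 y \<in> N" by (simp add: N_def)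
    then show "N \<noteq> {}" by blast
    show "corr (ikernel 7 0) h x = 0" if "x \<in> N" for x using E0[of x] that by (simp add: N_def E_def)
  qed
  then show ?thesis using g gH by (intro exI[of _ g]) (auto simp: g_def)
qed

section \<open>The extension theorem\<close>

text \<open>Along the gradient at a boundary point the defining function becomes positive at once.\<close>

lemma frontier_in_closure_exterior:
  assumes \<Omega>: "open \<Omega>" and def: "defining_function \<Omega> W \<rho>" and p: "p \<in> frontier \<Omega>"
  shows "p \<in> closure (- closure \<Omega>)"
proof -
  have W: "open W" and cl: "closure \<Omega> \<subseteq> W" and \<rho>: "C_infinity W \<rho>"
    and \<Omega>': "\<Omega> = {x\<in>W. \<rho> x < 0}" and fr: "frontier \<Omega> = {x\<in>W. \<rho> x = 0}" and gr: "grad \<rho> p \<noteq> 0"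
    using def p smooth_on_open_iff unfolding defining_function_def by blast+
  have pW: "p \<in> W" "\<rho> p = 0" using p fr by auto
  define n where "n = grad \<rho> p"
  have d: "\<rho> differentiable (at p)" by (rule C_infinity_differentiable[OF \<rho> pW(1)])
  have "((\<lambda>t. \<rho> (p + t *\<^sub>R n)) has_real_derivative dderiv n \<rho> (p + 0 *\<^sub>R n)) (at 0)"
    by (rule DERIV_along_line) (use d in simp)
  moreover have "dderiv n \<rho> (p + 0 *\<^sub>R n) > 0"
    using grad_inner[OF d, of n, symmetric] gr by (simp add: n_def)
  ultimately obtain d0 where d0: "d0 > 0" "\<And>h. 0 < h \<Longrightarrow> h < d0 \<Longrightarrow> \<rho> (p + 0 *\<^sub>R n) < \<rho> (p + (0 + h) *\<^sub>R n)"
    using DERIV_pos_inc_right by blast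
  obtain r0 where r0: "r0 > 0" "ball p r0 \<subseteq> W" using W pW(1) openE by blast
  show ?thesis unfolding closure_approachable
  proof (intro allI impI)
    fix e :: real assume e: "e > 0"
    define m where "m = min d0 (min (e / norm n) (r0 / norm n))"
    have nn: "norm n > 0" using gr by (simp add: n_def)
    have m: "m > 0" using d0 e r0 nn by (simp add: m_def)
    define h where "h = m / 2"
    have "m \<le> d0" "m \<le> e / norm n" "m \<le> r0 / norm n" by (simp_all add: m_def)
    then have h: "0 < h" "h < d0" "h < e / norm n" "h < r0 / norm n" using m half_gt_zero[of m] field_sum_of_halves[of m] unfolding h_def by linarith+
    define q where "q = p + h *\<^sub>R n"
    have dist: "dist q p = h * norm n" using h by (simp add: q_def dist_norm)
    have qW: "q \<in> W" using r0 h(4) nn dist by (auto simp: dist_commute field_simps)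
    have "\<rho> q > 0" using d0(2)[OF h(1,2)] pW by (simp add: q_def)
    then have "q \<notin> {x\<in>W. \<rho> x < 0}" "q \<notin> {x\<in>W. \<rho> x = 0}" by auto
    then have "q \<notin> \<Omega>" "q \<notin> frontier \<Omega>" using \<Omega>' fr by simp_all
    then have "q \<in> - closure \<Omega>" using frontier_def[of \<Omega>] interior_open[OF \<Omega>] by auto
    moreover have "dist q p < e" using h(3) nn dist by (simp add: field_simps)
    ultimately show "\<exists>y\<in>- closure \<Omega>. dist y p < e" by blast
  qed
qed

theorem theorem1p3:
  fixes \<Omega> W U :: "(oct^2) set" and \<rho> u0 u1 :: "oct^2 \<Rightarrow> real"
  assumes "open \<Omega>" and "connected \<Omega>" and "\<Omega> \<noteq> {}" and "bounded \<Omega>"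
    and "connected (- closure \<Omega>)"
    and "defining_function \<Omega> W \<rho>"
    and "open U" and "frontier \<Omega> \<subseteq> U" and "U \<subseteq> W"
    and "smooth_on U u0" and "smooth_on U u1"
    and "tangentially_OPH \<Omega> \<rho> U u0 u1"
  shows "\<exists>f. oct_pluriharmonic \<Omega> f \<and> smooth_on (closure \<Omega>) f \<and>
           eq_mod_rho2 \<Omega> \<rho> f (\<lambda>x. u0 x + \<rho> x * u1 x)"
proof -
  define \<Gamma> where "\<Gamma> = frontier \<Omega>"
  have W: "open W" and clW: "closure \<Omega> \<subseteq> W" and \<rho>: "C_infinity W \<rho>"
    and \<Omega>': "\<Omega> = {x\<in>W. \<rho> x < 0}" and \<Gamma>': "\<Gamma> = {x\<in>W. \<rho> x = 0}"
    and gr: "\<And>p. p \<in> \<Gamma> \<Longrightarrow> grad \<rho> p \<noteq> 0"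
    using assms(6) smooth_on_open_iff unfolding defining_function_def \<Gamma>_def by blast+
  have cpt: "compact \<Gamma>" unfolding \<Gamma>_def using assms(4) by (rule compact_frontier_bounded)
  define F where "F x = u0 x + \<rho> x * u1 x" for x
  have u: "C_infinity U u0" "C_infinity U u1" using assms(7,10,11) smooth_on_open_iff by blast+
  have \<rho>U: "C_infinity U \<rho>" by (rule C_infinity_subset[OF \<rho> assms(7,9)])
  have F: "C_infinity U F" unfolding F_def[abs_def] by (intro C_infinity_add C_infinity_mult u \<rho>U)

  define nn where "nn x = (\<Sum>c\<in>Basis. dderiv c \<rho> x * dderiv c \<rho> x)" for x
  have nn_grad: "nn x = grad \<rho> x \<bullet> grad \<rho> x" for x
    by (simp add: nn_def euclidean_inner[of "grad \<rho> x" "grad \<rho> x"] grad_inner_Basis)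
  have nnC: "C_infinity U nn" unfolding nn_def[abs_def]
    by (intro C_infinity_sum C_infinity_mult C_infinity_dderiv \<rho>U assms(7))
  define U' where "U' = nn -` (- {0}) \<inter> U"
  have oU': "open U'" unfolding U'_def
    by (rule continuous_on_open_vimage[THEN iffD1, rule_format, OF assms(7) C_infinity_continuous_on[OF nnC]]) auto
  have \<Gamma>U': "\<Gamma> \<subseteq> U'" using assms(8) gr by (auto simp: U'_def \<Gamma>_def nn_grad)
  have U'U: "U' \<subseteq> U" by (auto simp: U'_def)
  obtain \<eta> :: "oct^2 \<Rightarrow> real" and V C where cutoff: "C_infinity UNIV \<eta> \<and> open V \<and> \<Gamma> \<subseteq> V \<and>
      compact C \<and> V \<subseteq> C \<and> C \<subseteq> U' \<and> (\<forall>x\<in>V. \<eta> x = 1) \<and> (\<forall>x. x \<notin> C \<longrightarrow> \<eta> x = 0)"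
    using smooth_cutoff_exists[OF cpt oU' \<Gamma>U'] by (elim exE) (rule that)
  have \<eta>: "C_infinity UNIV \<eta>" and V: "open V" "\<Gamma> \<subseteq> V" "V \<subseteq> C" and C: "compact C" "C \<subseteq> U'"
    and \<eta>1: "\<And>x. x \<in> V \<Longrightarrow> \<eta> x = 1" and \<eta>0: "\<And>x. x \<notin> C \<Longrightarrow> \<eta> x = 0"
    using cutoff by simp_all
  obtain RC where RC: "\<And>x. x \<in> C \<Longrightarrow> norm x \<le> RC"
    using compact_imp_bounded[OF C(1)] unfolding bounded_iff by blast
  have ext: "smooth_cpt (\<lambda>x. \<eta> x * f x)" if "C_infinity U' f" for f
  proof -
    have "C_infinity UNIV (\<lambda>x. \<eta> x *\<^sub>R f x)"
      by (rule C_infinity_extend_zero[OF that \<eta> compact_imp_closed[OF C(1)] C(2) \<eta>0])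
    moreover have "\<eta> x * f x = 0" if "norm x > RC" for x
    proof -
      have "x \<notin> C" using RC[of x] that by linarith
      then show ?thesis by (simp add: \<eta>0)
    qed
    ultimately show ?thesis unfolding smooth_cpt_def real_scaleR_def by blast
  qed
  have sub: "C_infinity U' f" if "C_infinity U f" for f :: "oct^2 \<Rightarrow> real"
    by (rule C_infinity_subset[OF that oU' U'U])
  \<comment> \<open>Everything depends only on germs along \<open>\<Gamma>\<close>, so the data are cut off and extended by zero.\<close>
  define Fg where "Fg x = \<eta> x * F x" for x
  define r where "r x = \<eta> x * \<rho> x" for x
  define \<kappa> where "\<kappa> x = \<eta> x * inverse (nn x)" for x
  have Fg: "smooth_cpt Fg" unfolding Fg_def[abs_def] by (intro ext sub F)
  have r: "smooth_cpt r" unfolding r_def[abs_def] by (intro ext sub \<rho>U)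
  have \<kappa>: "smooth_cpt \<kappa>" unfolding \<kappa>_def[abs_def]
    by (intro ext C_infinity_inverse sub nnC) (simp add: U'_def)
  have VU: "V \<subseteq> U" using V C U'U by blast
  have FgV: "Fg x = F x" and rV: "r x = \<rho> x" if "x \<in> V" for x
    using \<eta>1[OF that] by (auto simp: Fg_def r_def)
  have drV: "dderiv v r x = dderiv v \<rho> x" if "x \<in> V" for v x
    by (rule dderiv_cong[OF V(1) that rV])
  have \<kappa>V: "\<kappa> x * nn x = 1" if "x \<in> V" for x
  proof -
    have "x \<in> U'" using V(3) C(2) that by blast
    then show ?thesis using \<eta>1[OF that] by (simp add: \<kappa>_def U'_def)
  qed

  interpret boundary_jet oct_M oct_N oct_P oct_tr \<Gamma> r \<kappa>
  proof (rule boundary_jet.intro[OF oct.symbol_complex_axioms], rule hypersurface.intro)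
    show rC: "C_infinity UNIV r" and \<kappa>C: "C_infinity UNIV \<kappa>"
      using r \<kappa> smooth_cpt_C_infinity by blast+
    show "r p = 0" if "p \<in> \<Gamma>" for p using that \<Gamma>' by (simp add: r_def)
    show "vanishes k \<Gamma> (\<lambda>x. \<kappa> x * (\<Sum>c\<in>Basis. dderiv c r x * dderiv c r x) - 1)" for k
    proof (rule vanishes_near[OF _ V(1,2)])
      show "C_infinity UNIV (\<lambda>x. \<kappa> x * (\<Sum>c\<in>Basis. dderiv c r x * dderiv c r x) - 1)"
        by (intro C_infinity_diff C_infinity_mult C_infinity_sum C_infinity_dderiv rC \<kappa>C C_infinity_const open_UNIV)
      show "\<kappa> x * (\<Sum>c\<in>Basis. dderiv c r x * dderiv c r x) - 1 = 0" if "x \<in> V" for x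
        using \<kappa>V[OF that] by (simp add: drV[OF that] nn_def)
    qed
    fix g :: "oct^2 \<Rightarrow> real" and p b :: "oct^2"
    assume g: "C_infinity UNIV g" and g0: "\<And>q. q \<in> \<Gamma> \<Longrightarrow> g q = 0" and p: "p \<in> \<Gamma>" and b: "b \<in> Basis"
    have pV: "p \<in> V" and pW: "p \<in> W" and p0: "\<rho> p = 0" using p V \<Gamma>' by auto
    have gd: "g differentiable (at p)" by (rule smooth_differentiable[OF g])
    define n where "n = grad \<rho> p"
    define t where "t = \<kappa> p * dderiv b \<rho> p"
    define v where "v = b - t *\<^sub>R n"
    have nb: "n \<bullet> b = dderiv b \<rho> p" using b by (simp add: n_def grad_inner_Basis)
    have "v \<bullet> n = dderiv b \<rho> p - \<kappa> p * nn p * dderiv b \<rho> p"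
      using nb by (simp add: v_def inner_diff_left inner_diff_right t_def nn_grad n_def inner_commute)
    then have vn: "v \<bullet> grad \<rho> p = 0" using \<kappa>V[OF pV] by (simp add: n_def)
    have "dderiv v g p = 0"
      by (rule tangent_derivative_zero[OF W \<rho> pW p0 gr[OF p] gd _ vn]) (use g0 \<Gamma>' in auto)
    moreover have "dderiv v g p = dderiv b g p - t * dderiv n g p"
      using linear_simps(2,5)[OF dderiv_bounded_linear[OF gd]] by (simp add: v_def)
    moreover have "dderiv n g p = (\<Sum>c\<in>Basis. dderiv c \<rho> p * dderiv c g p)"
      unfolding dderiv_expand[OF gd, of n] by (simp add: n_def grad_inner_Basis)
    ultimately show "dderiv b g p = dderiv b r p * (\<kappa> p * (\<Sum>c\<in>Basis. dderiv c r p * dderiv c g p))"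
      by (simp add: drV[OF pV] t_def)
  qed

  have FgC: "C_infinity UNIV Fg" by (rule smooth_cpt_C_infinity[OF Fg])
  have bc: "N_grad (oct.hess Fg) p = 0" if p: "p \<in> \<Gamma>" for p
  proof -
    have pV: "p \<in> V" and pW: "p \<in> W" and p0: "\<rho> p = 0" using p V \<Gamma>' by auto
    have "oct_N (grad \<rho> p) (oct.hess Fg p) \<bullet> a = 0" for a
    proof -
      \<comment> \<open>The component of the weak equation in the constant direction \<open>a\<close>.\<close>
      define Y where "Y x = (\<Sum>b\<in>Basis. (oct_N b (oct.hess Fg x) \<bullet> a) *\<^sub>R b)" for x
      have Y: "smooth_cpt Y" unfolding Y_def[abs_def]
        by (intro smooth_cpt_sum smooth_cpt_linear[OF bounded_linear_scaleR_left]
            smooth_cpt_linear[OF bounded_linear_inner_left]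
            smooth_cpt_linear[OF bounded_bilinear.bounded_linear_right[OF bilinear_oct_N]] oct.smooth_cpt_hess Fg)
      obtain B where B: "\<And>x. norm (Y x) \<le> B" using smooth_cpt_bounded[OF Y] by blast
      have Yn: "Y x \<bullet> n = oct_N n (oct.hess Fg x) \<bullet> a" for x n
      proof -
        have "oct_N n (oct.hess Fg x) = (\<Sum>b\<in>Basis. (n \<bullet> b) *\<^sub>R oct_N b (oct.hess Fg x))"
          by (subst (1) euclidean_representation[of n, symmetric])
             (simp add: bounded_bilinear.sum_left[OF bilinear_oct_N] bounded_bilinear.scaleR_left[OF bilinear_oct_N])
        then show ?thesis by (simp add: Y_def inner_sum_left mult.commute inner_commute[of n])
      qed
      have "Y p \<bullet> grad \<rho> p = 0"
      proof (rule weak_normal_component_zero[OF _ B assms(1) W \<Omega>' pW p0 _ gr[OF p] V(1) pV])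
        show "continuous_on UNIV Y" by (intro C_infinity_continuous_on smooth_cpt_C_infinity Y)
        show "\<rho> differentiable (at p)" by (rule C_infinity_differentiable[OF \<rho> pW])
        fix \<phi> :: "oct^2 \<Rightarrow> real" assume \<phi>: "smooth_cpt \<phi>" and sup: "closure {x. \<phi> x \<noteq> 0} \<subseteq> V"
        define v where "v x = \<phi> x *\<^sub>R a" for x
        have v: "smooth_cpt v" unfolding v_def[abs_def] by (rule smooth_cpt_linear[OF bounded_linear_scaleR_left \<phi>])
        have vsup: "closure {x. v x \<noteq> 0} \<subseteq> closure {x. \<phi> x \<noteq> 0}"
          by (intro closure_mono) (auto simp: v_def)
        have "bounded {x. v x \<noteq> 0}"
        proof -
          obtain R where "\<And>x. norm x > R \<Longrightarrow> v x = 0" using v unfolding smooth_cpt_def by blast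
          then show ?thesis unfolding bounded_iff by (intro exI[of _ R]) (auto simp: not_less[symmetric])
        qed
        then have "v \<in> test_functions U"
          using v vsup sup VU smooth_cpt_C_infinity[OF v] smooth_on_open_iff[OF open_UNIV]
          unfolding test_functions_def by (auto simp: compact_closure)
        then have eq: "(LINT x:\<Omega>|lborel. inner_O2 (D1 (D0 F) x) (v x)) =
            (LINT x:\<Omega>|lborel. inner_H2 (D0 F x) (D1_adj v x))"
          using assms(12) unfolding tangentially_OPH_def J1_def F_def[abs_def] by blast
        have lhs: "inner_O2 (D1 (D0 F) x) (v x) = 0" for x
        proof (cases "x \<in> U")
          case True
          then show ?thesis using D1_D0[OF F True] by (simp add: inner_O2_zero)
        next
          case False
          then have "\<phi> x = 0" using sup VU closure_subset[of "{x. \<phi> x \<noteq> 0}"] by blast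
          then show ?thesis by (simp add: v_def inner_O2_zero)
        qed
        have dv: "dderiv w v x = dderiv w \<phi> x *\<^sub>R a" for w x
          unfolding v_def[abs_def]
          by (rule dderiv_linear[OF bounded_linear_scaleR_left smooth_cpt_differentiable[OF \<phi>]])
        have rhs: "inner_H2 (D0 F x) (D1_adj v x) = - dderiv (Y x) \<phi> x" for x
        proof (cases "x \<in> V")
          case True
          have "D0 F x = to_mat (oct.hess Fg x)"
            using D0_eq[OF F subsetD[OF VU True]] oct.hess_cong[OF V(1) True, of Fg F] FgV by simp
          then have "inner_H2 (D0 F x) (D1_adj v x) = - (\<Sum>b\<in>Basis. oct_N b (oct.hess Fg x) \<bullet> dderiv b v x)"
            using D1_adj_eq[OF smooth_cpt_differentiable[OF v]] by simp
          also have "(\<Sum>b\<in>Basis. oct_N b (oct.hess Fg x) \<bullet> dderiv b v x) =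
              (\<Sum>b\<in>Basis. (Y x \<bullet> b) *\<^sub>R dderiv b \<phi> x)"
            unfolding dv Yn by (simp add: mult.commute)
          also have "\<dots> = dderiv (Y x) \<phi> x" by (rule dderiv_expand[OF smooth_cpt_differentiable[OF \<phi>], symmetric])
          finally show ?thesis .
        next
          case False
          then have x: "x \<in> - closure {x. \<phi> x \<noteq> 0}" using sup by blast
          have d\<phi>: "dderiv w \<phi> x = 0" for w
          proof -
            have "dderiv w \<phi> x = dderiv w (\<lambda>x. 0) x"
            proof (rule dderiv_cong[OF _ x])
              show "open (- closure {x. \<phi> x \<noteq> 0})" by auto
              show "\<phi> y = 0" if "y \<in> - closure {x. \<phi> x \<noteq> 0}" for y
                using that closure_subset[of "{x. \<phi> x \<noteq> 0}"] by blast
            qed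
            then show ?thesis by simp
          qed
          have dvi: "dderiv w (\<lambda>y. v y $ i) x = 0" "dderiv w (\<lambda>y. oconj (v y $ i)) x = 0" for w i
            using dderiv_linear[OF bounded_linear_vec_nth smooth_cpt_differentiable[OF v], of w i x]
              dderiv_linear[OF bounded_linear_compose[OF linear_oconj bounded_linear_vec_nth]
                smooth_cpt_differentiable[OF v], of w i x]
            by (simp_all add: dv d\<phi> oconj_simps)
          have "inner_H2 (D0 F x) (D1_adj v x) = 0"
            unfolding D1_adj_def inner_H2_def mat2_nth dd_def dd_r_def dbar_def partial_def dvi
            by (simp add: omult_zero linear_simps[OF linear_ore] oct_of_real_def ore_def)
          then show ?thesis by (simp add: d\<phi>)
        qed
        show "(\<integral>x. indicator \<Omega> x * dderiv (Y x) \<phi> x \<partial>lborel) = 0"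
          using eq unfolding lhs rhs set_lebesgue_integral_def by simp
      qed
      then show ?thesis by (simp add: Yn)
    qed
    then have "oct_N (grad \<rho> p) (oct.hess Fg p) = 0" using inner_eq_zero_iff by blast
    moreover have "grad r p = grad \<rho> p" unfolding grad_def using drV[OF pV] by simp
    ultimately show ?thesis by (simp add: N_grad_eq)
  qed

  obtain G where G: "C_infinity UNIV G" "vanishes 2 \<Gamma> (\<lambda>x. G x - Fg x)" "\<And>k. vanishes k \<Gamma> (oct.hess G)"
    using formal_solution[OF \<kappa> FgC bc] by blast
  \<comment> \<open>Flatness of the Hessian on \<open>\<Gamma>\<close> makes its extension by zero smooth.\<close>
  define H where "H = cut \<Omega> (oct.hess G)"
  have van: "\<And>k. vanishes k (frontier \<Omega>) (oct.hess G)" using G(3) by (simp add: \<Gamma>_def)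
  have HC: "C_infinity UNIV H" unfolding H_def by (rule C_infinity_cut[OF assms(1) van])
  have H: "smooth_cpt H"
  proof -
    obtain R where R: "\<And>x. x \<in> \<Omega> \<Longrightarrow> norm x \<le> R" using assms(4) unfolding bounded_iff by blast
    have "H x = 0" if "norm x > R" for x
      using R[of x] that by (auto simp: H_def cut_def)
    then show ?thesis using HC unfolding smooth_cpt_def by blast
  qed
  have cH: "oct.compat H x = 0" for x
  proof -
    have "oct.compat H x = (\<Sum>b\<in>Basis. oct_N b (cut \<Omega> (dderiv b (oct.hess G)) x))"
      unfolding oct.compat_def H_def dderiv_cut[OF assms(1) van] ..
    also have "\<dots> = (if x \<in> \<Omega> then oct.compat (oct.hess G) x else 0)"
      by (simp add: cut_def oct.compat_def bounded_bilinear.zero_right[OF bilinear_oct_N])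
    finally show ?thesis using oct.compat_hess[OF G(1) UNIV_I] by simp
  qed
  define D where "D = - closure \<Omega>"
  have "\<exists>g. C_infinity UNIV g \<and> (\<forall>x. oct.hess g x = H x) \<and> (\<forall>x\<in>D. g x = 0)"
  proof (rule oct_hess_solution[OF H cH])
    show "open D" "connected D" using assms(5) by (auto simp: D_def)
    show "H x = 0" if "x \<in> D" for x
      using that closure_subset[of \<Omega>] by (auto simp: D_def H_def cut_def)
    show "bounded (- D)" using bounded_closure[OF assms(4)] by (simp add: D_def)
  qed
  then obtain g where g: "C_infinity UNIV g" "\<And>x. oct.hess g x = H x" "\<And>x. x \<in> D \<Longrightarrow> g x = 0" by blast
  have zero: "f p = 0" if "continuous_on UNIV f" "\<And>x. x \<in> D \<Longrightarrow> f x = 0" "p \<in> \<Gamma>" for f :: "oct^2 \<Rightarrow> real" and p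
  proof (rule continuous_constant_on_closure[of D f 0])
    show "continuous_on (closure D) f" using that(1) continuous_on_subset by blast
    show "p \<in> closure D"
      using frontier_in_closure_exterior[OF assms(1,6)] that(3) by (simp add: D_def \<Gamma>_def)
  qed (use that in auto)
  have gv: "vanishes 2 \<Gamma> g"
  proof -
    have gd0: "dderiv b g x = 0" if "x \<in> D" for b x
    proof -
      have "dderiv b g x = dderiv b (\<lambda>x. 0) x"
        by (rule dderiv_cong[OF _ that]) (auto simp: D_def intro!: g(3))
      then show ?thesis by simp
    qed
    have "dderiv b g p = 0" if "p \<in> \<Gamma>" for b p
      by (rule zero[OF C_infinity_continuous_on[OF C_infinity_dderiv[OF g(1)]] gd0 that])
    moreover have "g p = 0" if "p \<in> \<Gamma>" for p
      by (rule zero[OF C_infinity_continuous_on[OF g(1)] g(3) that])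
    ultimately show ?thesis by (simp add: numeral_2_eq_2 g(1) C_infinity_dderiv)
  qed

  define f where "f x = G x - g x" for x
  have fC: "C_infinity UNIV f" unfolding f_def[abs_def] by (intro C_infinity_diff G g)
  have "D0 f x = 0" if "x \<in> \<Omega>" for x
  proof -
    have "oct.hess f x = oct.hess G x - H x"
      unfolding f_def[abs_def] using oct.hess_diff[OF G(1) g(1) UNIV_I] g(2) by simp
    then have "oct.hess f x = 0" using that by (simp add: H_def cut_def)
    then show ?thesis using D0_eq[OF fC UNIV_I, of x]
      by (simp add: to_mat_def vec2_eq_iff oconj_simps linear_simps[OF linear_oct_of_real])
  qed
  moreover have "smooth_on \<Omega> f"
    using C_infinity_subset[OF fC assms(1)] smooth_on_open_iff[OF assms(1)] by blast
  ultimately have 1: "oct_pluriharmonic \<Omega> f" by (simp add: oct_pluriharmonic_def)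
  have 2: "smooth_on (closure \<Omega>) f" unfolding smooth_on_def using fC by blast
  define w where "w x = \<eta> x * (f x - Fg x)" for x
  have w: "smooth_cpt w" unfolding w_def[abs_def]
    by (intro ext C_infinity_diff C_infinity_subset[OF fC oU'] C_infinity_subset[OF FgC oU']) auto
  have wv: "vanishes 2 \<Gamma> w"
  proof -
    have "vanishes 2 \<Gamma> (\<lambda>x. (G x - Fg x) - g x)" by (rule vanishes_diff[OF G(2) gv])
    from vanishes_scaleR_right[OF \<eta> this] show ?thesis by (simp add: w_def[abs_def] f_def algebra_simps)
  qed
  obtain V' K where V': "open V'" "\<Gamma> \<subseteq> V'" "\<And>x. x \<in> V' \<Longrightarrow> \<bar>w x\<bar> \<le> K * (\<rho> x)\<^sup>2"
    using boundary_quadratic_bound[OF W \<rho> cpt \<Gamma>' gr w wv] by blast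
  have 3: "eq_mod_rho2 \<Omega> \<rho> f F"
    unfolding eq_mod_rho2_def
  proof (intro exI conjI ballI)
    show "open (V \<inter> V')" "frontier \<Omega> \<subseteq> V \<inter> V'" using V V' by (auto simp: \<Gamma>_def)
    fix x assume x: "x \<in> V \<inter> V' \<inter> closure \<Omega>"
    then have "w x = f x - F x" using FgV \<eta>1 by (simp add: w_def)
    then show "\<bar>f x - F x\<bar> \<le> K * (\<rho> x)\<^sup>2" using V'(3)[of x] x by simp
  qed
  show ?thesis using 1 2 3 unfolding F_def[abs_def] by blast
qed

end
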